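(* Let $(X,\mathcal{X},\eta)$ be a standard probability space, let $T:X\to X$ be an invertible map satisfying $\eta(Z)=\eta(T^{-1}(Z))$ for all $Z\in\mathcal{X}$, and let $\mathbf{A}=(A,\mu,\alpha)$ be the classical system with $A=L^\infty(\eta)$, $\mu(f)=\int_X f\,\mathrm{d}\eta$ and $\alpha(f)=f\circ T$. Let $\mathbf{F}=(F,\lambda,\varphi)$ be a subsystem of $\mathbf{A}$. Then $\mathbf{A}$ has discrete spectrum relative to $\mathbf{F}$ (that is, $\mathcal{E}_{A/F}=H\ominus H_F$) if and only if $\mathbf{A}$ has relative discrete spectrum over $\mathbf{F}$ in the classical sense.
   Context: Inner products are linear in the second variable. A system $\mathbf{A}=(A,\mu,\alpha)$ consists of a von Neumann algebra $A$, a faithful normal trace $\mu$ on $A$ (a positive linear functional on $A$, so $A$ is finite), and a $*$-automorphism $\alpha$ of $A$ with $\mu\circ\alpha=\mu$. $A$ is taken to act on a Hilbert space $H$ with a cyclic and separating vector $\Omega$ such that $\mu(a)=\langle\Omega,a\Omega\rangle$ for all $a\in A$; in the classical case $A=L^\infty(\eta)$ acts on $H=L^2(\eta)$ by pointwise multiplication, with $\Omega=1$. $U$ is the unitary on $H$ determined by $Ua\Omega=\alpha(a)\Omega$ for $a\in A$. A system $\mathbf{F}=(F,\lambda,\varphi)$ is a subsystem of $\mathbf{A}$ if $F$ is a von Neumann subalgebra of $A$ containing the unit of $A$, $\mu|_F=\lambda$ and $\alpha|_F=\varphi$. Put $H_F:=\overline{F\Omega}$ and let $e_F$ be the orthogonal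 projection of $H$ onto $H_F$. Let $J$ be the modular conjugation (the antiunitary extending $a\Omega\mapsto a^*\Omega$, $a\in A$) and $j(a):=Ja^*J$. The basic construction $\langle A,e_F\rangle$ is the von Neumann algebra on $H$ generated by $A$ and $e_F$; it carries the canonical faithful normal semifinite tracial weight $\bar\mu:\langle A,e_F\rangle^+\to[0,\infty]$ determined by $\bar\mu(ae_Fb)=\mu(ab)$ for $a,b\in A$ (extended linearly to $\operatorname{span}\{ae_Fb:a,b\in A\}$). $H$ is a right $A$-module by $xa:=j(a)x$ (in the classical case this is pointwise multiplication). A closed subspace $V\subset H$ is a right-$F$-submodule if $xa\in V$ for all $x\in V$, $a\in F$ (equivalently, its orthogonal projection $P_V$ lies in $\langle A,e_F\rangle$), and is $U$-invariant if $UV=V$. A $U$-$\bar\mu$-module is a $U$-invariant right-$F$-submodule $V\subset H\ominus H_F$ with $\bar\mu(P_V)<\infty$. $\mathcal{E}_{A/F}$ is the closed subspace of $H\ominus H_F$ spanned by all $U$-$\bar\mu$-modules. $\mathbf{A}$ has discrete spectrum relative to $\mathbf{F}$ if $\mathcal{E}_{A/F}=H\ominus H_F$. Classical sense: an $F$-submodule $V$ of $H=L^2(\eta)$ is of finite rank if there are $x_1,\dots,x_n\in V$ such that $V=\overline{\{\sum_{i=1}^n a_ix_i: a_1,\dots,a_n\in F\}}$, where $a_ix_i$ is pointwise multiplication of functions. A vector $x\in H$ is an $F$-eigenvector of $U$ if $x$ belongs to some $U$-invariant finite rank $F$-module ($x=0$ is allowed). $\mathbf{A}$ has relative discrete spectrum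 over $\mathbf{F}$ in the classical sense if $H\ominus H_F$ is spanned (as a closed linear span) by the $F$-eigenvectors of $U$ it contains; equivalently, $H$ is the closed linear span of the $F$-eigenvectors of $U$. *)

theory Defs
  imports "HOL-Probability.Probability_Measure"
begin

text \<open>
  The inner product \<open>cinner\<close> is linear in the second variable. Its real part is the real inner
  product of the underlying real Hilbert space, so the norm and the topology are the library's.
\<close>

class chilbert_space = real_inner + complete_space +
  fixes scaleC :: "complex \<Rightarrow> 'a \<Rightarrow> 'a" (infixr "*\<^sub>C" 75)
    and cinner :: "'a \<Rightarrow> 'a \<Rightarrow> complex"
  assumes scaleC_add_right: "c *\<^sub>C (x + y) = c *\<^sub>C x + c *\<^sub>C y"
    and scaleC_add_left: "(c + d) *\<^sub>C x = c *\<^sub>C x + d *\<^sub>C x"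
    and scaleC_scaleC: "c *\<^sub>C d *\<^sub>C x = (c * d) *\<^sub>C x"
    and scaleC_of_real: "complex_of_real r *\<^sub>C x = r *\<^sub>R x"
    and cinner_commute: "cinner x y = cnj (cinner y x)"
    and cinner_add_right: "cinner x (y + z) = cinner x y + cinner x z"
    and cinner_scaleC_right: "cinner x (c *\<^sub>C y) = c * cinner x y"
    and inner_eq_Re_cinner: "inner x y = Re (cinner x y)"

instantiation complex :: chilbert_space
begin

definition scaleC_complex :: "complex \<Rightarrow> complex \<Rightarrow> complex"
  where "scaleC_complex c x = c * x"

definition cinner_complex :: "complex \<Rightarrow> complex \<Rightarrow> complex"
  where "cinner_complex x y = cnj x * y"

instance
  by standard
    (simp_all add: scaleC_complex_def cinner_complex_def algebra_simps scaleR_conv_of_real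
      inner_complex_def)

end

definition csubspace :: "'h::chilbert_space set \<Rightarrow> bool"
  where "csubspace V \<longleftrightarrow>
    0 \<in> V \<and> (\<forall>x\<in>V. \<forall>y\<in>V. x + y \<in> V) \<and> (\<forall>c. \<forall>x\<in>V. c *\<^sub>C x \<in> V)"

definition closed_csubspace :: "'h::chilbert_space set \<Rightarrow> bool"
  where "closed_csubspace V \<longleftrightarrow> csubspace V \<and> closed V"

definition closed_cspan :: "'h::chilbert_space set \<Rightarrow> 'h set"
  where "closed_cspan X = closed_csubspace hull X"

definition orth_compl :: "'h::chilbert_space set \<Rightarrow> 'h set"
  where "orth_compl V = {x. \<forall>y\<in>V. cinner y x = 0}"

definition orth_proj :: "'h::chilbert_space set \<Rightarrow> 'h \<Rightarrow> 'h"
  where "orth_proj V x = (THE y. y \<in> V \<and> x - y \<in> orth_compl V)"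

definition bounded_ops :: "('h::chilbert_space \<Rightarrow> 'h) set"
  where "bounded_ops = {S. bounded_linear S \<and> (\<forall>c x. S (c *\<^sub>C x) = c *\<^sub>C S x)}"

definition adj :: "('h::chilbert_space \<Rightarrow> 'h) \<Rightarrow> 'h \<Rightarrow> 'h"
  where "adj S = (THE R. \<forall>x y. cinner (S x) y = cinner x (R y))"

definition unitary_op :: "('h::chilbert_space \<Rightarrow> 'h) \<Rightarrow> bool"
  where "unitary_op W \<longleftrightarrow>
    W \<in> bounded_ops \<and> surj W \<and> (\<forall>x y. cinner (W x) (W y) = cinner x y)"

definition antiunitary_op :: "('h::chilbert_space \<Rightarrow> 'h) \<Rightarrow> bool"
  where "antiunitary_op W \<longleftrightarrow>
    (\<forall>x y. W (x + y) = W x + W y) \<and> (\<forall>c x. W (c *\<^sub>C x) = cnj c *\<^sub>C W x) \<and>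
    surj W \<and> (\<forall>x y. cinner (W x) (W y) = cinner y x)"

definition positive_op :: "('h::chilbert_space \<Rightarrow> 'h) \<Rightarrow> bool"
  where "positive_op S \<longleftrightarrow>
    S \<in> bounded_ops \<and> (\<forall>x. cinner x (S x) \<in> \<real> \<and> 0 \<le> Re (cinner x (S x)))"

definition op_le :: "('h::chilbert_space \<Rightarrow> 'h) \<Rightarrow> ('h \<Rightarrow> 'h) \<Rightarrow> bool"
  where "op_le S R \<longleftrightarrow> positive_op (\<lambda>x. R x - S x)"

definition positive_part :: "('h::chilbert_space \<Rightarrow> 'h) set \<Rightarrow> ('h \<Rightarrow> 'h) set"
  where "positive_part N = {S\<in>N. positive_op S}"

definition commutant :: "('h::chilbert_space \<Rightarrow> 'h) set \<Rightarrow> ('h \<Rightarrow> 'h) set"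
  where "commutant X = {S\<in>bounded_ops. \<forall>R\<in>X. S \<circ> R = R \<circ> S}"

definition von_neumann_algebra :: "('h::chilbert_space \<Rightarrow> 'h) set \<Rightarrow> bool"
  where "von_neumann_algebra N \<longleftrightarrow>
    N \<subseteq> bounded_ops \<and> (\<forall>a\<in>N. adj a \<in> N) \<and> commutant (commutant N) = N"

definition vn_generated :: "('h::chilbert_space \<Rightarrow> 'h) set \<Rightarrow> ('h \<Rightarrow> 'h) set"
  where "vn_generated X = von_neumann_algebra hull X"

definition op_directed :: "('h::chilbert_space \<Rightarrow> 'h) set \<Rightarrow> bool"
  where "op_directed D \<longleftrightarrow>
    D \<noteq> {} \<and> (\<forall>a\<in>D. \<forall>b\<in>D. \<exists>c\<in>D. op_le a c \<and> op_le b c)"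

definition is_op_sup ::
    "('h::chilbert_space \<Rightarrow> 'h) set \<Rightarrow> ('h \<Rightarrow> 'h) set \<Rightarrow> ('h \<Rightarrow> 'h) \<Rightarrow> bool"
  where "is_op_sup N D s \<longleftrightarrow>
    s \<in> positive_part N \<and> (\<forall>d\<in>D. op_le d s) \<and>
    (\<forall>t\<in>positive_part N. (\<forall>d\<in>D. op_le d t) \<longrightarrow> op_le s t)"

definition faithful_normal_trace ::
    "('h::chilbert_space \<Rightarrow> 'h) set \<Rightarrow> (('h \<Rightarrow> 'h) \<Rightarrow> complex) \<Rightarrow> bool"
  where "faithful_normal_trace N \<mu> \<longleftrightarrow>
    (\<forall>a\<in>N. \<forall>b\<in>N. \<mu> (\<lambda>x. a x + b x) = \<mu> a + \<mu> b) \<and>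
    (\<forall>c. \<forall>a\<in>N. \<mu> (\<lambda>x. c *\<^sub>C a x) = c * \<mu> a) \<and>
    (\<forall>a\<in>positive_part N. \<mu> a \<in> \<real> \<and> 0 \<le> Re (\<mu> a)) \<and>
    (\<forall>a\<in>N. \<forall>b\<in>N. \<mu> (a \<circ> b) = \<mu> (b \<circ> a)) \<and>
    (\<forall>a\<in>positive_part N. \<mu> a = 0 \<longrightarrow> a = (\<lambda>x. 0)) \<and>
    (\<forall>D s. D \<subseteq> positive_part N \<and> op_directed D \<and> is_op_sup N D s \<longrightarrow>
      Re (\<mu> s) = (SUP d\<in>D. Re (\<mu> d)))"

definition fns_tracial_weight ::
    "('h::chilbert_space \<Rightarrow> 'h) set \<Rightarrow> (('h \<Rightarrow> 'h) \<Rightarrow> ennreal) \<Rightarrow> bool"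
  where "fns_tracial_weight N w \<longleftrightarrow>
    (\<forall>a\<in>positive_part N. \<forall>b\<in>positive_part N. w (\<lambda>x. a x + b x) = w a + w b) \<and>
    (\<forall>r\<ge>0. \<forall>a\<in>positive_part N. w (\<lambda>x. r *\<^sub>R a x) = ennreal r * w a) \<and>
    (\<forall>a\<in>N. w (adj a \<circ> a) = w (a \<circ> adj a)) \<and>
    (\<forall>a\<in>positive_part N. w a = 0 \<longrightarrow> a = (\<lambda>x. 0)) \<and>
    (\<forall>D s. D \<subseteq> positive_part N \<and> op_directed D \<and> is_op_sup N D s \<longrightarrow>
      w s = (SUP d\<in>D. w d)) \<and>
    (\<forall>a\<in>positive_part N. a \<noteq> (\<lambda>x. 0) \<longrightarrow>
      (\<exists>b\<in>positive_part N. op_le b a \<and> b \<noteq> (\<lambda>x. 0) \<and> w b < \<infinity>))"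

record 'h vn_system =
  alg :: "('h \<Rightarrow> 'h) set"
  tr :: "('h \<Rightarrow> 'h) \<Rightarrow> complex"
  aut :: "('h \<Rightarrow> 'h) \<Rightarrow> ('h \<Rightarrow> 'h)"

definition star_automorphism ::
    "('h::chilbert_space \<Rightarrow> 'h) set \<Rightarrow> (('h \<Rightarrow> 'h) \<Rightarrow> ('h \<Rightarrow> 'h)) \<Rightarrow> bool"
  where "star_automorphism N \<alpha> \<longleftrightarrow>
    bij_betw \<alpha> N N \<and>
    (\<forall>a\<in>N. \<forall>b\<in>N. \<alpha> (\<lambda>x. a x + b x) = (\<lambda>x. \<alpha> a x + \<alpha> b x)) \<and>
    (\<forall>c. \<forall>a\<in>N. \<alpha> (\<lambda>x. c *\<^sub>C a x) = (\<lambda>x. c *\<^sub>C \<alpha> a x)) \<and>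
    (\<forall>a\<in>N. \<forall>b\<in>N. \<alpha> (a \<circ> b) = \<alpha> a \<circ> \<alpha> b) \<and>
    (\<forall>a\<in>N. \<alpha> (adj a) = adj (\<alpha> a))"

definition is_system :: "'h::chilbert_space vn_system \<Rightarrow> bool"
  where "is_system A \<longleftrightarrow>
    von_neumann_algebra (alg A) \<and> faithful_normal_trace (alg A) (tr A) \<and>
    star_automorphism (alg A) (aut A) \<and> (\<forall>a\<in>alg A. tr A (aut A a) = tr A a)"

definition subsystem :: "'h::chilbert_space vn_system \<Rightarrow> 'h vn_system \<Rightarrow> bool"
  where "subsystem F A \<longleftrightarrow>
    is_system F \<and> alg F \<subseteq> alg A \<and> id \<in> alg F \<and>
    (\<forall>a\<in>alg F. tr F a = tr A a \<and> aut F a = aut A a)"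

text \<open>
  Throughout, \<open>A\<close> is a system whose algebra acts with the cyclic and separating vector \<open>\<Omega>\<close>
  satisfying \<open>tr A a = cinner \<Omega> (a \<Omega>)\<close>, and \<open>F\<close> is a subsystem of \<open>A\<close>.
\<close>

definition sys_unitary :: "'h::chilbert_space vn_system \<Rightarrow> 'h \<Rightarrow> 'h \<Rightarrow> 'h"
  where "sys_unitary A \<Omega> = (THE W. unitary_op W \<and> (\<forall>a\<in>alg A. W (a \<Omega>) = aut A a \<Omega>))"

definition modular_conj :: "'h::chilbert_space vn_system \<Rightarrow> 'h \<Rightarrow> 'h \<Rightarrow> 'h"
  where "modular_conj A \<Omega> = (THE W. antiunitary_op W \<and> (\<forall>a\<in>alg A. W (a \<Omega>) = adj a \<Omega>))"

definition jmap :: "'h::chilbert_space vn_system \<Rightarrow> 'h \<Rightarrow> ('h \<Rightarrow> 'h) \<Rightarrow> 'h \<Rightarrow> 'h"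
  where "jmap A \<Omega> a = modular_conj A \<Omega> \<circ> adj a \<circ> modular_conj A \<Omega>"

definition sub_space :: "'h::chilbert_space vn_system \<Rightarrow> 'h \<Rightarrow> 'h set"
  where "sub_space F \<Omega> = closure ((\<lambda>a. a \<Omega>) ` alg F)"

definition sub_proj :: "'h::chilbert_space vn_system \<Rightarrow> 'h \<Rightarrow> 'h \<Rightarrow> 'h"
  where "sub_proj F \<Omega> = orth_proj (sub_space F \<Omega>)"

definition basic_construction ::
    "'h::chilbert_space vn_system \<Rightarrow> 'h vn_system \<Rightarrow> 'h \<Rightarrow> ('h \<Rightarrow> 'h) set"
  where "basic_construction A F \<Omega> = vn_generated (insert (sub_proj F \<Omega>) (alg A))"

text \<open>
  The last clause is \<open>w (a e b) = tr A (a b)\<close>, \<open>e = sub_proj F \<Omega>\<close>, extended linearly to the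
  span of the operators \<open>a e b\<close>. As \<open>w\<close> is a \<open>[0, \<infinity>]\<close>-valued weight, this is a condition on the
  positive operators in that span.
\<close>

definition canonical_weight ::
    "'h::chilbert_space vn_system \<Rightarrow> 'h vn_system \<Rightarrow> 'h \<Rightarrow> (('h \<Rightarrow> 'h) \<Rightarrow> ennreal) \<Rightarrow> bool"
  where "canonical_weight A F \<Omega> w \<longleftrightarrow>
    fns_tracial_weight (basic_construction A F \<Omega>) w \<and>
    (\<forall>(n::nat) a b S.
      (\<forall>i<n. a i \<in> alg A \<and> b i \<in> alg A) \<and>
      S = (\<lambda>x. \<Sum>i<n. a i (sub_proj F \<Omega> (b i x))) \<and> positive_op S \<longrightarrow>
      w S < \<infinity> \<and> complex_of_real (enn2real (w S)) = (\<Sum>i<n. tr A (a i \<circ> b i)))"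

definition right_submodule ::
    "'h::chilbert_space vn_system \<Rightarrow> 'h vn_system \<Rightarrow> 'h \<Rightarrow> 'h set \<Rightarrow> bool"
  where "right_submodule A F \<Omega> V \<longleftrightarrow>
    closed_csubspace V \<and> (\<forall>x\<in>V. \<forall>a\<in>alg F. jmap A \<Omega> a x \<in> V)"

definition U_weight_module ::
    "'h::chilbert_space vn_system \<Rightarrow> 'h vn_system \<Rightarrow> 'h \<Rightarrow> (('h \<Rightarrow> 'h) \<Rightarrow> ennreal) \<Rightarrow> 'h set \<Rightarrow> bool"
  where "U_weight_module A F \<Omega> w V \<longleftrightarrow>
    right_submodule A F \<Omega> V \<and> sys_unitary A \<Omega> ` V = V \<and>
    V \<subseteq> orth_compl (sub_space F \<Omega>) \<and> w (orth_proj V) < \<infinity>"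

definition discrete_part ::
    "'h::chilbert_space vn_system \<Rightarrow> 'h vn_system \<Rightarrow> 'h \<Rightarrow> (('h \<Rightarrow> 'h) \<Rightarrow> ennreal) \<Rightarrow> 'h set"
  where "discrete_part A F \<Omega> w = closed_cspan (\<Union>{V. U_weight_module A F \<Omega> w V})"

definition rel_discrete_spectrum ::
    "'h::chilbert_space vn_system \<Rightarrow> 'h vn_system \<Rightarrow> 'h \<Rightarrow> (('h \<Rightarrow> 'h) \<Rightarrow> ennreal) \<Rightarrow> bool"
  where "rel_discrete_spectrum A F \<Omega> w \<longleftrightarrow>
    discrete_part A F \<Omega> w = orth_compl (sub_space F \<Omega>)"

text \<open>
  For the classical system below, the elements of \<open>alg F\<close> are multiplication operators, so \<open>a x\<close>
  is the pointwise product of the function \<open>a\<close> with \<open>x\<close>.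
\<close>

definition finite_rank_module :: "'h::chilbert_space vn_system \<Rightarrow> 'h set \<Rightarrow> bool"
  where "finite_rank_module F V \<longleftrightarrow>
    closed_csubspace V \<and> (\<forall>x\<in>V. \<forall>a\<in>alg F. a x \<in> V) \<and>
    (\<exists>(n::nat) x. (\<forall>i<n. x i \<in> V) \<and>
      V = closure {\<Sum>i<n. a i (x i) | a. \<forall>i<n. a i \<in> alg F})"

definition F_eigenvector ::
    "'h::chilbert_space vn_system \<Rightarrow> 'h vn_system \<Rightarrow> 'h \<Rightarrow> 'h \<Rightarrow> bool"
  where "F_eigenvector A F \<Omega> x \<longleftrightarrow>
    (\<exists>V. finite_rank_module F V \<and> sys_unitary A \<Omega> ` V = V \<and> x \<in> V)"

definition classical_rel_discrete_spectrum ::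
    "'h::chilbert_space vn_system \<Rightarrow> 'h vn_system \<Rightarrow> 'h \<Rightarrow> bool"
  where "classical_rel_discrete_spectrum A F \<Omega> \<longleftrightarrow>
    closed_cspan {x \<in> orth_compl (sub_space F \<Omega>). F_eigenvector A F \<Omega> x}
      = orth_compl (sub_space F \<Omega>)"

definition standard_borel :: "'x measure \<Rightarrow> bool"
  where "standard_borel M \<longleftrightarrow>
    (\<exists>X. completely_metrizable_space X \<and> second_countable X \<and> topspace X = space M \<and>
      sets M = sigma_sets (topspace X) {Z. openin X Z})"

text \<open>Both customary conventions are allowed: the Borel \<open>\<sigma>\<close>-algebra and its completion.\<close>

definition standard_prob_space :: "'x measure \<Rightarrow> bool"
  where "standard_prob_space M \<longleftrightarrow>
    prob_space M \<and> (\<exists>N. standard_borel N \<and> (M = N \<or> M = completion N))"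

definition invertible_measure_preserving :: "'x measure \<Rightarrow> ('x \<Rightarrow> 'x) \<Rightarrow> bool"
  where "invertible_measure_preserving M T \<longleftrightarrow>
    bij_betw T (space M) (space M) \<and>
    T \<in> measurable M M \<and> the_inv_into (space M) T \<in> measurable M M \<and>
    (\<forall>Z\<in>sets M. emeasure M (T -` Z \<inter> space M) = emeasure M Z)"

definition L2_functions :: "'x measure \<Rightarrow> ('x \<Rightarrow> complex) set"
  where "L2_functions M =
    {f \<in> borel_measurable M. integrable M (\<lambda>\<omega>. (cmod (f \<omega>))\<^sup>2)}"

definition Linf_functions :: "'x measure \<Rightarrow> ('x \<Rightarrow> complex) set"
  where "Linf_functions M =
    {f \<in> borel_measurable M. \<exists>c::real. AE \<omega> in M. cmod (f \<omega>) \<le> c}"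

text \<open>
  \<open>is_L2 M q\<close> says that the Hilbert space \<open>'h\<close> is the space \<open>L\<^sup>2\<close> of \<open>M\<close>, with \<open>q f\<close> the class of the
  square-integrable function \<open>f\<close>: the last two clauses make \<open>q f = q g\<close> equivalent to \<open>f = g\<close>
  almost everywhere. Outside the square-integrable functions \<open>q\<close> is unspecified.
\<close>

definition is_L2 :: "'x measure \<Rightarrow> (('x \<Rightarrow> complex) \<Rightarrow> 'h::chilbert_space) \<Rightarrow> bool"
  where "is_L2 M q \<longleftrightarrow>
    q ` L2_functions M = UNIV \<and>
    (\<forall>f\<in>L2_functions M. \<forall>g\<in>L2_functions M. q (\<lambda>\<omega>. f \<omega> + g \<omega>) = q f + q g) \<and>
    (\<forall>c. \<forall>f\<in>L2_functions M. q (\<lambda>\<omega>. c * f \<omega>) = c *\<^sub>C q f) \<and>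
    (\<forall>f\<in>L2_functions M. \<forall>g\<in>L2_functions M.
      cinner (q f) (q g) = (\<integral>\<omega>. cnj (f \<omega>) * g \<omega> \<partial>M))"

definition mult_op ::
    "'x measure \<Rightarrow> (('x \<Rightarrow> complex) \<Rightarrow> 'h::chilbert_space) \<Rightarrow> ('x \<Rightarrow> complex) \<Rightarrow> 'h \<Rightarrow> 'h"
  where "mult_op M q f x =
    (let g = (SOME g. g \<in> L2_functions M \<and> q g = x) in q (\<lambda>\<omega>. f \<omega> * g \<omega>))"

definition mult_symbol ::
    "'x measure \<Rightarrow> (('x \<Rightarrow> complex) \<Rightarrow> 'h::chilbert_space) \<Rightarrow> ('h \<Rightarrow> 'h) \<Rightarrow> 'x \<Rightarrow> complex"
  where "mult_symbol M q a = (SOME f. f \<in> Linf_functions M \<and> mult_op M q f = a)"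

definition classical_system ::
    "'x measure \<Rightarrow> ('x \<Rightarrow> 'x) \<Rightarrow> (('x \<Rightarrow> complex) \<Rightarrow> 'h::chilbert_space) \<Rightarrow> 'h vn_system"
  where "classical_system M T q =
    \<lparr>alg = mult_op M q ` Linf_functions M,
     tr = (\<lambda>a. \<integral>\<omega>. mult_symbol M q a \<omega> \<partial>M),
     aut = (\<lambda>a. mult_op M q (mult_symbol M q a \<circ> T))\<rparr>"

end

(*
The algebra F is L^infinity of a sub-sigma-algebra G, and H_F = L^2(G). An operator commuting with F lies
in the basic construction, because an operator commuting with A and e_F is multiplication by an element
of F. In particular the projection onto an F-submodule does, and the projection onto the cyclic
module of x is equivalent, via multiplication by x / E(|x|^2 | F)^(1/2), to 1_Z e_F, where Z is the
support of E(|x|^2 | F); its weight is therefore the measure of Z. By orthogonalization, a module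
generated by n vectors has weight at most n, so finite rank modules have finite weight.

Conversely, let V be U-invariant of finite weight, and for each n let Y_n in G be the largest set such
that 1_{Y_n} V is generated by n vectors. Being canonical, Y_n is T-invariant, so 1_{Y_n} V is an
invariant module of finite rank. Off the union of the Y_n one can split off orthogonal cyclic submodules
of full support without end, each of weight at least the measure of that region; as V has finite
weight, the region is null and the 1_{Y_n} V together span V.
*)

theory Submission
  imports Defs "HOL-Probability.Conditional_Expectation"
begin

section \<open>Complex Hilbert spaces\<close>

text \<open>Commutativity of A turns the right action through the modular conjugation into plain
  multiplication, so the two notions of module become comparable. Fibre dimensions and measurable
  fields are avoided: rank is encoded by the sets of G over which n vectors generate. This family is
  closed under subsets and countable disjoint unions, so it has a largest member up to null sets,
  and that member depends on V alone. Invariance under T can therefore be had for the set, although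
  U moves the generating vectors. Null sets intervene everywhere, since elements of H are classes;
  they are harmless because G contains all null sets of M, so that G-measurability does not depend
  on a representative, and because multiplication by indicators of sets equal up to a null set is
  the same operator. An eigenvector orthogonal to H_F may come from a finite rank module that is not
  orthogonal to H_F; that module has to be projected off H_F, an operation that commutes with both U
  and F. Convergence is handled in the L2 norm throughout, which is why F is first shown to be
  closed in that norm inside A.\<close>

instance chilbert_space \<subseteq> banach ..

lemma scaleC_minus_one: "(-1) *\<^sub>C x = - (x::'h::chilbert_space)"
  using scaleC_of_real[of "-1" x] by simp

lemma scaleC_one [simp]: "1 *\<^sub>C x = (x::'h::chilbert_space)"
  using scaleC_of_real[of 1 x] by simp

lemma scaleC_zero_left [simp]: "0 *\<^sub>C x = (0::'h::chilbert_space)"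
  using scaleC_of_real[of 0 x] by simp

lemma scaleC_zero_right [simp]: "c *\<^sub>C (0::'h::chilbert_space) = 0"
  using scaleC_add_right[of c 0 0] by simp

lemma cinner_add_left: "cinner (x + y) z = cinner x z + cinner y (z::'h::chilbert_space)"
  by (metis cinner_add_right cinner_commute complex_cnj_add)

lemma cinner_scaleC_left: "cinner (c *\<^sub>C x) y = cnj c * cinner x (y::'h::chilbert_space)"
  by (metis cinner_scaleC_right cinner_commute complex_cnj_mult)

lemma cinner_zero_right [simp]: "cinner x (0::'h::chilbert_space) = 0"
  using cinner_add_right[of x 0 0] by simp

lemma cinner_zero_left [simp]: "cinner 0 (x::'h::chilbert_space) = 0"
  using cinner_add_left[of 0 0 x] by simp

lemma cinner_minus_right: "cinner x (- y) = - cinner x (y::'h::chilbert_space)"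
  using cinner_add_right[of x y "-y"] by (simp add: add_eq_0_iff2)

lemma cinner_minus_left: "cinner (- x) y = - cinner x (y::'h::chilbert_space)"
  using cinner_add_left[of x "-x" y] by (simp add: add_eq_0_iff2)

lemma cinner_diff_right: "cinner x (y - z) = cinner x y - cinner x (z::'h::chilbert_space)"
  using cinner_add_right[of x y "-z"] by (simp add: cinner_minus_right)

lemma cinner_diff_left: "cinner (x - y) z = cinner x z - cinner y (z::'h::chilbert_space)"
  using cinner_add_left[of x "-y" z] by (simp add: cinner_minus_left)

lemma scaleC_minus_right: "c *\<^sub>C (- x) = - (c *\<^sub>C (x::'h::chilbert_space))"
  by (metis scaleC_minus_one scaleC_scaleC mult.commute)

lemma scaleC_diff_right: "c *\<^sub>C (x - y) = c *\<^sub>C x - c *\<^sub>C (y::'h::chilbert_space)"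
  by (metis diff_conv_add_uminus scaleC_add_right scaleC_minus_right)

lemma cinner_self: "cinner x x = complex_of_real ((norm (x::'h::chilbert_space))\<^sup>2)"
proof (rule complex_eqI)
  show "Re (cinner x x) = Re (complex_of_real ((norm x)\<^sup>2))"
    by (simp add: inner_eq_Re_cinner[symmetric] dot_square_norm)
  show "Im (cinner x x) = Im (complex_of_real ((norm x)\<^sup>2))"
    using arg_cong[OF cinner_commute[of x x], of Im] by simp
qed

lemma norm_scaleC: "norm (c *\<^sub>C x) = cmod c * norm (x::'h::chilbert_space)"
proof -
  have "complex_of_real ((norm (c *\<^sub>C x))\<^sup>2) = (cnj c * c) * complex_of_real ((norm x)\<^sup>2)"
    by (metis cinner_self cinner_scaleC_right cinner_scaleC_left mult.assoc)
  also have "\<dots> = complex_of_real ((cmod c * norm x)\<^sup>2)"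
    by (metis complex_norm_square mult.commute of_real_mult power_mult_distrib)
  finally have "(norm (c *\<^sub>C x))\<^sup>2 = (cmod c * norm x)\<^sup>2"
    using of_real_eq_iff by blast
  then show ?thesis by (simp add: power2_eq_iff_nonneg)
qed

lemma norm_eqI_cinner: "cinner x x = cinner y y \<Longrightarrow> norm (x::'h::chilbert_space) = norm y"
  unfolding cinner_self of_real_eq_iff by simp

lemma cinner_Cauchy_Schwarz: "cmod (cinner x y) \<le> norm x * norm (y::'h::chilbert_space)"
proof (cases "cinner x y = 0")
  case False
  define z where "z = cinner x y"
  \<comment> \<open>The phase that turns \<open>cinner x y\<close> into its modulus, so that the
    real Cauchy-Schwarz inequality yields the complex one.\<close>
  define c where "c = cnj z / cmod z"
  have z: "z \<noteq> 0" using False z_def by simp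
  have c: "cmod c = 1" using z by (simp add: c_def norm_divide)
  have "c * z = complex_of_real (cmod z)"
    using z by (simp add: c_def complex_norm_square[symmetric] mult.commute power2_eq_square)
  then have "cmod z = inner x (c *\<^sub>C y)"
    by (simp add: inner_eq_Re_cinner cinner_scaleC_right z_def)
  also have "\<dots> \<le> norm x * norm (c *\<^sub>C y)"
    by (rule norm_cauchy_schwarz)
  finally show ?thesis by (simp add: norm_scaleC c z_def)
qed simp

lemma bounded_linear_cinner_right: "bounded_linear (cinner (x::'h::chilbert_space))"
proof (rule bounded_linear_intro[where K = "norm x"])
  fix r y show "cinner x (r *\<^sub>R y) = r *\<^sub>R cinner x y"
    by (metis cinner_scaleC_right scaleC_of_real scaleR_conv_of_real)
qed (simp_all add: cinner_add_right cinner_Cauchy_Schwarz mult.commute[of _ "norm x"])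

lemma bounded_linear_scaleC_right: "bounded_linear (\<lambda>x::'h::chilbert_space. c *\<^sub>C x)"
proof (rule bounded_linear_intro[where K = "cmod c"])
  fix r and x :: 'h show "c *\<^sub>C (r *\<^sub>R x) = r *\<^sub>R (c *\<^sub>C x)"
    by (metis mult.commute scaleC_of_real scaleC_scaleC)
qed (simp_all add: scaleC_add_right norm_scaleC mult.commute)

lemma bounded_opsI:
  assumes "\<And>x y. S (x + y) = S x + S y" "\<And>c x. S (c *\<^sub>C x) = c *\<^sub>C S x"
    and "\<And>x. norm (S x) \<le> norm x * K"
  shows "S \<in> bounded_ops"
proof -
  have "S (r *\<^sub>R x) = r *\<^sub>R S x" for r x
    using assms(2)[of "complex_of_real r" x] by (simp add: scaleC_of_real)
  then have "bounded_linear S" using assms by (intro bounded_linear_intro[where K = K])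
  then show ?thesis using assms(2) by (simp add: bounded_ops_def)
qed

lemma cinner_tendsto_right:
  "f \<longlonglongrightarrow> y \<Longrightarrow> (\<lambda>n. cinner x (f n)) \<longlonglongrightarrow> cinner x (y::'h::chilbert_space)"
  by (rule bounded_linear.tendsto[OF bounded_linear_cinner_right])

lemma cinner_tendsto_left:
  assumes "f \<longlonglongrightarrow> y"
  shows "(\<lambda>n. cinner (f n) x) \<longlonglongrightarrow> cinner y (x::'h::chilbert_space)"
proof -
  have "(\<lambda>n. cnj (cinner x (f n))) \<longlonglongrightarrow> cnj (cinner x y)"
    by (intro tendsto_cnj cinner_tendsto_right assms)
  then show ?thesis by (simp add: cinner_commute[symmetric])
qed

text \<open>The identities make the squared norm of \<open>P x\<close> equal to the inner product of
  \<open>x\<close> with \<open>P x\<close>. They are asked only at the given \<open>x\<close>, so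
  the bound is available for projections before their linearity is established.\<close>

lemma norm_selfadjoint_idempotent:
  fixes P :: "'h::chilbert_space \<Rightarrow> 'h"
  assumes "cinner (P x) (P x) = cinner x (P (P x))" "P (P x) = P x"
  shows "norm (P x) \<le> norm x"
proof -
  have "complex_of_real ((norm (P x))\<^sup>2) = cinner x (P x)"
    using assms by (simp add: cinner_self)
  then have "(norm (P x))\<^sup>2 = inner x (P x)" by (metis inner_eq_Re_cinner Re_complex_of_real)
  also have "\<dots> \<le> norm x * norm (P x)" by (rule norm_cauchy_schwarz)
  finally have "norm (P x) * norm (P x) \<le> norm x * norm (P x)" by (simp add: power2_eq_square)
  then show ?thesis by (cases "norm (P x) = 0") (auto simp: mult_le_cancel_right)
qed

subsection \<open>Subspaces and projections\<close>

lemma csubspace_0: "csubspace V \<Longrightarrow> 0 \<in> V"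
  and csubspace_add: "csubspace V \<Longrightarrow> x \<in> V \<Longrightarrow> y \<in> V \<Longrightarrow> x + y \<in> V"
  and csubspace_scaleC: "csubspace V \<Longrightarrow> x \<in> V \<Longrightarrow> c *\<^sub>C x \<in> V"
  by (simp_all add: csubspace_def)

lemma csubspace_scaleR: "csubspace V \<Longrightarrow> x \<in> V \<Longrightarrow> r *\<^sub>R x \<in> V"
  by (metis csubspace_scaleC scaleC_of_real)

lemma csubspace_minus: "csubspace V \<Longrightarrow> x \<in> V \<Longrightarrow> - x \<in> V"
  by (metis csubspace_scaleC scaleC_minus_one)

lemma csubspace_diff: "csubspace V \<Longrightarrow> x \<in> V \<Longrightarrow> y \<in> V \<Longrightarrow> x - y \<in> V"
  by (metis csubspace_add csubspace_minus diff_conv_add_uminus)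

lemma csubspace_sum: "csubspace V \<Longrightarrow> (\<And>i. i \<in> I \<Longrightarrow> f i \<in> V) \<Longrightarrow> (\<Sum>i\<in>I. f i) \<in> V"
  by (induction I rule: infinite_finite_induct) (auto simp: csubspace_0 csubspace_add)

lemma csubspace_closure:
  assumes "csubspace V" shows "csubspace (closure V)"
  unfolding csubspace_def
proof (intro conjI ballI allI)
  show "0 \<in> closure V" using assms csubspace_0 closure_subset by blast
next
  fix x y assume "x \<in> closure V" "y \<in> closure V"
  then obtain f g where "\<forall>n. f n \<in> V" "f \<longlonglongrightarrow> x" "\<forall>n. g n \<in> V" "g \<longlonglongrightarrow> y"
    unfolding closure_sequential by auto
  then have "\<forall>n. f n + g n \<in> V" "(\<lambda>n. f n + g n) \<longlonglongrightarrow> x + y"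
    by (simp_all add: csubspace_add[OF assms] tendsto_add)
  then show "x + y \<in> closure V"
    unfolding closure_sequential by (intro exI[of _ "\<lambda>n. f n + g n"] conjI)
next
  fix c x assume "x \<in> closure V"
  then obtain f where "\<forall>n. f n \<in> V" "f \<longlonglongrightarrow> x"
    unfolding closure_sequential by auto
  then have "\<forall>n. c *\<^sub>C f n \<in> V" "(\<lambda>n. c *\<^sub>C f n) \<longlonglongrightarrow> c *\<^sub>C x"
    by (simp_all add: csubspace_scaleC[OF assms] bounded_linear.tendsto[OF bounded_linear_scaleC_right])
  then show "c *\<^sub>C x \<in> closure V"
    unfolding closure_sequential by (intro exI[of _ "\<lambda>n. c *\<^sub>C f n"] conjI)
qed

lemma closed_csubspace_closure: "csubspace V \<Longrightarrow> closed_csubspace (closure V)"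
  by (simp add: closed_csubspace_def csubspace_closure)

lemma closed_csubspace_Inter:
  "(\<And>V. V \<in> \<V> \<Longrightarrow> closed_csubspace V) \<Longrightarrow> closed_csubspace (\<Inter>\<V>)"
  by (auto simp: closed_csubspace_def csubspace_def)

lemma closed_csubspace_Int:
  "closed_csubspace V \<Longrightarrow> closed_csubspace W \<Longrightarrow> closed_csubspace (V \<inter> W)"
  by (auto simp: closed_csubspace_def csubspace_def)

lemma closed_csubspace_closed_cspan: "closed_csubspace (closed_cspan X)"
  unfolding closed_cspan_def by (rule hull_in) (auto intro: closed_csubspace_Inter)

lemma closed_cspan_superset: "X \<subseteq> closed_cspan X"
  unfolding closed_cspan_def by (rule hull_subset)

lemma closed_cspan_minimal: "X \<subseteq> V \<Longrightarrow> closed_csubspace V \<Longrightarrow> closed_cspan X \<subseteq> V"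
  unfolding closed_cspan_def by (rule hull_minimal)

lemma closed_csubspace_preimage:
  assumes "closed_csubspace V" "S \<in> bounded_ops"
  shows "closed_csubspace {x. S x \<in> V}"
proof -
  interpret bounded_linear S using assms(2) by (simp add: bounded_ops_def)
  have "closed (S -` V)"
    using assms(1) by (intro closed_vimage continuous_on continuous_on_id)
      (simp_all add: closed_csubspace_def)
  then show ?thesis
    using assms by (auto simp: closed_csubspace_def csubspace_def bounded_ops_def vimage_def zero add)
qed

lemma closed_csubspace_orth_compl: "closed_csubspace (orth_compl V)"
proof -
  have "closed (\<Inter>y\<in>V. cinner y -` {0})"
    by (intro closed_INT ballI closed_vimage linear_continuous_on bounded_linear_cinner_right closed_singleton)
  moreover have "(\<Inter>y\<in>V. cinner y -` {0}) = orth_compl V"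
    by (auto simp: orth_compl_def)
  ultimately show ?thesis
    by (auto simp: closed_csubspace_def csubspace_def orth_compl_def cinner_add_right
        cinner_scaleC_right)
qed

lemma orth_compl_cinner: "x \<in> orth_compl V \<Longrightarrow> y \<in> V \<Longrightarrow> cinner y x = 0"
  by (simp add: orth_compl_def)

lemma orth_compl_cinner': "x \<in> orth_compl V \<Longrightarrow> y \<in> V \<Longrightarrow> cinner x y = 0"
  by (metis cinner_commute complex_cnj_zero orth_compl_cinner)

lemma orth_compl_Int: "x \<in> V \<Longrightarrow> x \<in> orth_compl V \<Longrightarrow> x = 0"
  using orth_compl_cinner[of x V x] by (simp add: cinner_self)

text \<open>A minimizing sequence is Cauchy by the parallelogram law: the midpoint of two of its
  members stays in \<open>V\<close>, so it is no closer to \<open>x\<close> than the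
  infimum.\<close>

lemma nearest_point_exists:
  fixes V :: "'h::{real_inner, complete_space} set"
  assumes "closed V" "convex V" "V \<noteq> {}"
  obtains y where "y \<in> V" "\<And>z. z \<in> V \<Longrightarrow> norm (x - y) \<le> norm (x - z)"
proof -
  define d where "d = (INF z\<in>V. (norm (x - z))\<^sup>2)"
  have bdd: "bdd_below ((\<lambda>z. (norm (x - z))\<^sup>2) ` V)"
    by (rule bdd_belowI[of _ 0]) auto
  have d_le: "d \<le> (norm (x - z))\<^sup>2" if "z \<in> V" for z
    unfolding d_def by (rule cINF_lower[OF bdd that])
  have "\<exists>z\<in>V. (norm (x - z))\<^sup>2 < d + 1 / Suc n" for n
    using cINF_less_iff[OF assms(3) bdd, of "d + 1 / Suc n"] by (simp add: d_def)
  then obtain f where f: "\<And>n. f n \<in> V" "\<And>n. (norm (x - f n))\<^sup>2 < d + 1 / Suc n"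
    by metis
  have close: "(norm (f m - f n))\<^sup>2 \<le> 4 / Suc N" if "m \<ge> N" "n \<ge> N" for m n N
  proof -
    have "(1/2) *\<^sub>R f m + (1/2) *\<^sub>R f n \<in> V"
      using assms(2) f(1) by (intro convexD) auto
    from d_le[OF this] have "4 * d \<le> (norm ((x - f m) + (x - f n)))\<^sup>2"
    proof -
      have "(x - f m) + (x - f n) = 2 *\<^sub>R (x - ((1/2) *\<^sub>R f m + (1/2) *\<^sub>R f n))"
        by (simp add: algebra_simps scaleR_2)
      then show ?thesis
        using \<open>d \<le> _\<close> by (simp add: power_mult_distrib)
    qed
    moreover have "(norm ((x - f m) + (x - f n)))\<^sup>2 + (norm (f m - f n))\<^sup>2
        = 2 * (norm (x - f m))\<^sup>2 + 2 * (norm (x - f n))\<^sup>2"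
      by (simp add: power2_norm_eq_inner inner_diff inner_add algebra_simps inner_commute)
    moreover have "1 / real (Suc m) \<le> 1 / Suc N" "1 / real (Suc n) \<le> 1 / Suc N"
      using that by (simp_all add: frac_le)
    ultimately show ?thesis using f(2)[of m] f(2)[of n] by linarith
  qed
  have "Cauchy f"
  proof (rule metric_CauchyI)
    fix e :: real assume "e > 0"
    then obtain N where N: "4 / e\<^sup>2 < real (Suc N)"
      by (meson reals_Archimedean2 less_trans of_nat_less_iff lessI)
    then have "4 / Suc N < e\<^sup>2"
      using \<open>e > 0\<close> by (simp add: field_simps)
    then have "norm (f m - f n) < e" if "m \<ge> N" "n \<ge> N" for m n
      using close[OF that] \<open>e > 0\<close> by (meson le_less_trans less_imp_le power2_less_imp_less)
    then show "\<exists>N. \<forall>m\<ge>N. \<forall>n\<ge>N. dist (f m) (f n) < e"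
      by (auto simp: dist_norm)
  qed
  then obtain y where y: "f \<longlonglongrightarrow> y"
    using Cauchy_convergent convergent_def by blast
  have "y \<in> V" using closed_sequentially[OF assms(1) _ y] f(1) by blast
  moreover have "(norm (x - y))\<^sup>2 \<le> d"
  proof (rule LIMSEQ_le)
    show "(\<lambda>n. (norm (x - f n))\<^sup>2) \<longlonglongrightarrow> (norm (x - y))\<^sup>2"
      by (intro tendsto_intros y)
    show "(\<lambda>n. d + 1 / Suc n) \<longlonglongrightarrow> d"
      using tendsto_add[OF tendsto_const[of d] LIMSEQ_Suc[OF lim_1_over_n[where 'a=real]]] by simp
    show "\<exists>N. \<forall>n\<ge>N. (norm (x - f n))\<^sup>2 \<le> d + 1 / Suc n"
      using f(2) less_imp_le by blast
  qed
  ultimately show thesis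
    using d_le by (intro that[of y]) (meson norm_ge_zero order_trans power2_le_imp_le)+
qed

lemma orth_decomposition_exists:
  fixes V :: "'h::chilbert_space set"
  assumes "closed_csubspace V"
  obtains y where "y \<in> V" "x - y \<in> orth_compl V"
proof -
  have V: "csubspace V" "closed V" using assms by (simp_all add: closed_csubspace_def)
  have "convex V"
    by (intro convexI csubspace_add[OF V(1)] csubspace_scaleR[OF V(1)])
  with V obtain y where y: "y \<in> V" "\<And>z. z \<in> V \<Longrightarrow> norm (x - y) \<le> norm (x - z)"
    using nearest_point_exists[of V x] csubspace_0 by blast
  \<comment> \<open>Moving the nearest point by a multiple \<open>t\<close> of \<open>z\<close>
    cannot shorten the distance; the resulting quadratic in \<open>t\<close> is evaluated at its
    minimum \<open>b / a\<close>.\<close>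
  have re: "inner z (x - y) = 0" if z: "z \<in> V" for z
  proof -
    have "0 \<le> t\<^sup>2 * inner z z - 2 * t * inner z (x - y)" for t
    proof -
      have "norm (x - y) \<le> norm (x - (y + t *\<^sub>R z))"
        using y(1) z V(1) by (intro y(2) csubspace_add csubspace_scaleR)
      then have "inner (x - y) (x - y) \<le> inner (x - y - t *\<^sub>R z) (x - y - t *\<^sub>R z)"
        by (simp add: norm_le diff_diff_eq)
      then show ?thesis
        by (simp add: inner_diff inner_commute algebra_simps power2_eq_square)
    qed
    show ?thesis
    proof (cases "z = 0")
      case False
      define a b where "a = inner z z" and "b = inner z (x - y)"
      have "a > 0" using False by (simp add: a_def)
      have "0 \<le> (b / a)\<^sup>2 * a - 2 * (b / a) * b"
        using \<open>\<And>t. 0 \<le> t\<^sup>2 * inner z z - 2 * t * inner z (x - y)\<close>[of "b / a"]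
        by (simp add: a_def b_def)
      also have "\<dots> = - (b\<^sup>2 / a)"
        using \<open>a > 0\<close> by (simp add: power2_eq_square field_simps)
      finally show ?thesis
        using \<open>a > 0\<close> by (simp add: divide_le_0_iff b_def)
    qed simp
  qed
  have "cinner z (x - y) = 0" if z: "z \<in> V" for z
  proof (rule complex_eqI)
    show "Re (cinner z (x - y)) = Re 0" using re[OF z] by (simp add: inner_eq_Re_cinner)
    \<comment> \<open>The imaginary part against \<open>z\<close> is the real part against i times
      \<open>z\<close>, which also lies in \<open>V\<close>.\<close>
    show "Im (cinner z (x - y)) = Im 0"
      using re[OF csubspace_scaleC[OF V(1) z, of \<i>]]
      by (simp add: inner_eq_Re_cinner cinner_scaleC_left)
  qed
  with y(1) show thesis by (intro that[of y]) (auto simp: orth_compl_def)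
qed

lemma orth_proj_unique:
  assumes "csubspace V" "y \<in> V" "x - y \<in> orth_compl V"
  shows "orth_proj V x = y"
  unfolding orth_proj_def
proof (rule the_equality)
  fix z assume z: "z \<in> V \<and> x - z \<in> orth_compl V"
  have "(x - y) - (x - z) \<in> orth_compl V"
    using z assms closed_csubspace_orth_compl[of V] csubspace_diff
    by (simp only: closed_csubspace_def) blast
  moreover have "z - y \<in> V" using z assms by (simp add: csubspace_diff)
  ultimately show "z = y" using orth_compl_Int[of "z - y" V] by simp
qed (use assms in simp)

context
  fixes V :: "'h::chilbert_space set"
  assumes V: "closed_csubspace V"
begin

lemma orth_proj_in: "orth_proj V x \<in> V"
  and orth_proj_compl: "x - orth_proj V x \<in> orth_compl V"
proof -
  obtain y where "y \<in> V" "x - y \<in> orth_compl V" using orth_decomposition_exists[OF V] .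
  moreover have "csubspace V" using V by (simp add: closed_csubspace_def)
  ultimately show "orth_proj V x \<in> V" "x - orth_proj V x \<in> orth_compl V"
    using orth_proj_unique by metis+
qed

lemma orth_proj_eqI: "y \<in> V \<Longrightarrow> x - y \<in> orth_compl V \<Longrightarrow> orth_proj V x = y"
  using V unfolding closed_csubspace_def by (blast intro: orth_proj_unique)

lemma orth_proj_fix: "x \<in> V \<Longrightarrow> orth_proj V x = x"
  using closed_csubspace_orth_compl[of V]
  by (intro orth_proj_eqI) (auto simp: closed_csubspace_def csubspace_0)

lemma orth_proj_orth: "x \<in> orth_compl V \<Longrightarrow> orth_proj V x = 0"
  using V by (intro orth_proj_eqI) (auto simp: closed_csubspace_def csubspace_0)

lemma cinner_orth_proj: "cinner (orth_proj V x) y = cinner x (orth_proj V y)"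
proof -
  have "cinner (orth_proj V x) (y - orth_proj V y) = 0"
    by (rule orth_compl_cinner[OF orth_proj_compl orth_proj_in])
  moreover have "cinner (x - orth_proj V x) (orth_proj V y) = 0"
    by (rule orth_compl_cinner'[OF orth_proj_compl orth_proj_in])
  ultimately show ?thesis by (simp add: cinner_diff_left cinner_diff_right)
qed

lemma norm_orth_proj_le: "norm (orth_proj V x) \<le> norm x"
  by (rule norm_selfadjoint_idempotent) (simp_all add: cinner_orth_proj orth_proj_fix orth_proj_in)

lemma orth_proj_bounded_ops: "orth_proj V \<in> bounded_ops"
proof -
  note sub = V[unfolded closed_csubspace_def, THEN conjunct1]
  note sub' = closed_csubspace_orth_compl[of V, unfolded closed_csubspace_def, THEN conjunct1]
  have add: "orth_proj V (x + y) = orth_proj V x + orth_proj V y" for x y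
    using csubspace_add[OF sub' orth_proj_compl[of x] orth_proj_compl[of y]]
    by (intro orth_proj_eqI csubspace_add[OF sub] orth_proj_in) (simp add: algebra_simps)
  have scale: "orth_proj V (c *\<^sub>C x) = c *\<^sub>C orth_proj V x" for c x
    using csubspace_scaleC[OF sub' orth_proj_compl[of x], of c]
    by (intro orth_proj_eqI csubspace_scaleC[OF sub] orth_proj_in) (simp add: scaleC_diff_right)
  show ?thesis using norm_orth_proj_le by (intro bounded_opsI[where K = 1] add scale) simp
qed

lemma positive_orth_proj: "positive_op (orth_proj V)"
proof -
  have "cinner x (orth_proj V x) = complex_of_real ((norm (orth_proj V x))\<^sup>2)" for x
    by (metis cinner_orth_proj cinner_self orth_proj_fix orth_proj_in)
  then show ?thesis by (simp add: positive_op_def orth_proj_bounded_ops)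
qed

text \<open>\<open>R\<close> is the adjoint of \<open>S\<close>; invariance under both makes
  \<open>V\<close> a reducing subspace.\<close>

lemma orth_proj_commute:
  assumes "S \<in> bounded_ops" "\<And>x. x \<in> V \<Longrightarrow> S x \<in> V" "\<And>x. x \<in> V \<Longrightarrow> R x \<in> V"
    and adj: "\<And>x y. cinner (R x) y = cinner x (S y)"
  shows "S (orth_proj V x) = orth_proj V (S x)"
proof (rule orth_proj_eqI[symmetric])
  interpret bounded_linear S using assms(1) by (simp add: bounded_ops_def)
  show "S (orth_proj V x) \<in> V" by (intro assms orth_proj_in)
  show "S x - S (orth_proj V x) \<in> orth_compl V"
    using assms(3) orth_compl_cinner[OF orth_proj_compl]
    by (auto simp: orth_compl_def diff[symmetric] adj[symmetric])
qed

end

text \<open>The sum is closed because it is the fixed point set of a continuous map, the sum of the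
  two projections.\<close>

lemma orth_proj_orth_sum:
  fixes V :: "'h::chilbert_space set"
  assumes V: "closed_csubspace V" and W: "closed_csubspace W" and orth: "W \<subseteq> orth_compl V"
  defines "S \<equiv> {x + y | x y. x \<in> V \<and> y \<in> W}"
  shows "closed_csubspace S" and "orth_proj S = (\<lambda>x. orth_proj V x + orth_proj W x)"
proof -
  have sub: "csubspace V" "csubspace W" "csubspace (orth_compl V)" "csubspace (orth_compl W)"
    using V W closed_csubspace_orth_compl by (auto simp: closed_csubspace_def)
  have orth': "V \<subseteq> orth_compl W"
    using orth orth_compl_cinner'[of _ V] by (auto simp: orth_compl_def[of W])
  define P where "P x = orth_proj V x + orth_proj W x" for x
  have in_S: "P x \<in> S" for x
    unfolding S_def P_def using orth_proj_in[OF V] orth_proj_in[OF W] by blast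
  have rest: "x - P x \<in> orth_compl S" for x
  proof -
    have "(x - orth_proj V x) - orth_proj W x \<in> orth_compl V"
      using orth orth_proj_in[OF W] by (intro csubspace_diff[OF sub(3)] orth_proj_compl[OF V]) auto
    moreover have "(x - orth_proj W x) - orth_proj V x \<in> orth_compl W"
      using orth' orth_proj_in[OF V] by (intro csubspace_diff[OF sub(4)] orth_proj_compl[OF W]) auto
    ultimately show ?thesis
      by (auto simp: P_def orth_compl_def S_def cinner_add_left algebra_simps)
  qed
  have P_S: "P x = x" if "x \<in> S" for x
  proof -
    obtain y z where x: "x = y + z" "y \<in> V" "z \<in> W" using \<open>x \<in> S\<close> unfolding S_def by auto
    have "orth_proj V x = y" using x orth by (intro orth_proj_eqI[OF V]) auto
    moreover have "orth_proj W x = z" using x orth' by (intro orth_proj_eqI[OF W]) auto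
    ultimately show ?thesis using x by (simp add: P_def)
  qed
  have P_lin: "bounded_linear P"
    unfolding P_def using orth_proj_bounded_ops[OF V] orth_proj_bounded_ops[OF W]
    by (intro bounded_linear_add) (simp_all add: bounded_ops_def)
  have "closed {x. P x = x}"
    by (intro closed_Collect_eq continuous_on_id linear_continuous_on P_lin)
  moreover have "{x. P x = x} = S"
  proof (intro equalityI subsetI)
    fix x assume "x \<in> {x. P x = x}" then show "x \<in> S" using in_S[of x] by simp
  qed (simp add: P_S)
  moreover have "csubspace S"
    unfolding csubspace_def
  proof (intro conjI ballI allI)
    show "0 \<in> S" unfolding S_def using sub by (force dest: csubspace_0)
  next
    fix x y assume "x \<in> S" "y \<in> S"
    then obtain a b c d where "x = a + b" "y = c + d" "a \<in> V" "b \<in> W" "c \<in> V" "d \<in> W"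
      unfolding S_def by auto
    then show "x + y \<in> S" unfolding S_def using sub
      by (intro CollectI exI[of _ "a + c"] exI[of _ "b + d"]) (simp add: csubspace_add)
  next
    fix c x assume "x \<in> S"
    then obtain a b where "x = a + b" "a \<in> V" "b \<in> W" unfolding S_def by auto
    then show "c *\<^sub>C x \<in> S" unfolding S_def using sub
      by (intro CollectI exI[of _ "c *\<^sub>C a"] exI[of _ "c *\<^sub>C b"])
        (simp add: csubspace_scaleC scaleC_add_right)
  qed
  ultimately show S: "closed_csubspace S" by (simp add: closed_csubspace_def)
  show "orth_proj S = (\<lambda>x. orth_proj V x + orth_proj W x)"
    using orth_proj_eqI[OF S in_S rest] by (auto simp: P_def)
qed

lemma orth_proj_split:
  fixes V :: "'h::chilbert_space set"
  assumes V: "closed_csubspace V" and W: "closed_csubspace W" and "V \<subseteq> W"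
  shows "orth_proj W = (\<lambda>x. orth_proj V x + orth_proj (W \<inter> orth_compl V) x)"
proof -
  have R: "closed_csubspace (W \<inter> orth_compl V)"
    by (intro closed_csubspace_Int W closed_csubspace_orth_compl)
  have sub: "csubspace W" using W by (simp add: closed_csubspace_def)
  have "{x + y | x y. x \<in> V \<and> y \<in> W \<inter> orth_compl V} = W"
  proof (intro equalityI subsetI)
    fix x assume "x \<in> W"
    moreover have "orth_proj V x \<in> W" using orth_proj_in[OF V] assms(3) by blast
    ultimately show "x \<in> {x + y | x y. x \<in> V \<and> y \<in> W \<inter> orth_compl V}"
      using orth_proj_in[OF V, of x] orth_proj_compl[OF V, of x] csubspace_diff[OF sub]
      by (intro CollectI exI[of _ "orth_proj V x"] exI[of _ "x - orth_proj V x"]) auto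
  qed (use assms(3) csubspace_add[OF sub] in auto)
  then show ?thesis using orth_proj_orth_sum(2)[OF V R] by simp
qed

subsection \<open>Adjoints and partial isometries\<close>

lemma adj_eqI:
  fixes S :: "'h::chilbert_space \<Rightarrow> 'h"
  assumes "\<And>x y. cinner (S x) y = cinner x (R y)"
  shows "adj S = R"
  unfolding adj_def
proof (rule the_equality)
  fix R' assume R': "\<forall>x y. cinner (S x) y = cinner x (R' y)"
  show "R' = R"
  proof
    fix y
    have "cinner (R' y - R y) (R' y - R y) = 0"
      using R' assms by (simp add: cinner_diff_right)
    then show "R' y = R y" by (simp add: cinner_self)
  qed
qed (use assms in simp)

text \<open>Polarization recovers real inner products from norms of sums, and imaginary parts by
  replacing \<open>y\<close> with i times \<open>y\<close>. Norms need to be preserved only on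
  \<open>E\<close>, the initial space of a partial isometry.\<close>

lemma cinner_isometry:
  fixes v :: "'h::chilbert_space \<Rightarrow> 'h"
  assumes v: "v \<in> bounded_ops" and E: "csubspace E"
    and norm: "\<And>x. x \<in> E \<Longrightarrow> norm (v x) = norm x"
    and xy: "x \<in> E" "y \<in> E"
  shows "cinner (v x) (v y) = cinner x y"
proof (rule complex_eqI)
  interpret bounded_linear v using v by (simp add: bounded_ops_def)
  have inner: "inner (v x) (v y) = inner x y" if "x \<in> E" "y \<in> E" for x y
    using norm[OF csubspace_add[OF E that]] norm[OF that(1)] norm[OF that(2)]
    by (simp add: dot_norm add)
  show "Re (cinner (v x) (v y)) = Re (cinner x y)"
    using inner[OF xy] by (simp add: inner_eq_Re_cinner)
  have "v (\<i> *\<^sub>C y) = \<i> *\<^sub>C v y" using v by (simp add: bounded_ops_def)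
  then show "Im (cinner (v x) (v y)) = Im (cinner x y)"
    using inner[OF xy(1) csubspace_scaleC[OF E xy(2), of \<i>]]
    by (simp add: inner_eq_Re_cinner cinner_scaleC_right)
qed

text \<open>The isometric image of the complete space \<open>E\<close> is complete, hence closed.
  The adjoint is exhibited explicitly as \<open>r\<close>: project onto the range, then pull back
  into \<open>E\<close>.\<close>

lemma partial_isometry:
  fixes E :: "'h::chilbert_space set"
  assumes E: "closed_csubspace E" and v: "v \<in> bounded_ops"
    and vE: "\<And>x. v (orth_proj E x) = v x"
    and iso: "\<And>x y. x \<in> E \<Longrightarrow> y \<in> E \<Longrightarrow> cinner (v x) (v y) = cinner x y"
  shows "closed_csubspace (v ` E)" and "v \<circ> adj v = orth_proj (v ` E)"
    and "adj v \<circ> v = orth_proj E"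
proof -
  interpret bounded_linear v using v by (simp add: bounded_ops_def)
  have sub: "csubspace E" "closed E" using E by (simp_all add: closed_csubspace_def)
  have norm: "norm (v x) = norm x" if "x \<in> E" for x
    by (rule norm_eqI_cinner) (rule iso[OF that that])
  have "subspace E"
    by (intro subspaceI csubspace_0 csubspace_add csubspace_scaleR sub)
  then have "complete (v ` E)"
    using sub(2) by (intro complete_isometric_image[of 1]) (auto simp: norm bounded_linear_axioms
        complete_eq_closed)
  moreover have "csubspace (v ` E)"
    using v unfolding csubspace_def bounded_ops_def
    by (auto simp: add[symmetric] intro!: csubspace_add[OF sub(1)] imageI)
      (metis csubspace_0[OF sub(1)] image_eqI zero,
       metis csubspace_scaleC[OF sub(1)] image_eqI)
  ultimately show W: "closed_csubspace (v ` E)"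
    by (simp add: closed_csubspace_def complete_imp_closed)
  define r where "r y = (SOME x. x \<in> E \<and> v x = orth_proj (v ` E) y)" for y
  have "\<exists>x. x \<in> E \<and> v x = orth_proj (v ` E) y" for y
    using orth_proj_in[OF W, of y] by (metis imageE)
  then have r: "r y \<in> E" "v (r y) = orth_proj (v ` E) y" for y
    unfolding r_def by (metis (mono_tags, lifting) someI_ex)+
  have "cinner (v x) y = cinner x (r y)" for x y
  proof -
    have "v x = orth_proj (v ` E) (v x)"
      using orth_proj_fix[OF W] orth_proj_in[OF E, of x] vE[of x] by (metis image_eqI)
    then have "cinner (v x) y = cinner (v (orth_proj E x)) (v (r y))"
      by (metis cinner_orth_proj[OF W] r(2) vE)
    also have "\<dots> = cinner (orth_proj E x) (r y)"
      by (rule iso[OF orth_proj_in[OF E] r(1)])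
    also have "\<dots> = cinner x (r y)"
      by (simp add: cinner_orth_proj[OF E] orth_proj_fix[OF E r(1)])
    finally show ?thesis .
  qed
  then have adj: "adj v = r" by (rule adj_eqI)
  then show "v \<circ> adj v = orth_proj (v ` E)" by (simp add: fun_eq_iff r(2))
  have "r (v x) = orth_proj E x" for x
  proof -
    have "v (r (v x)) = v (orth_proj E x)"
      unfolding r(2) vE using orth_proj_fix[OF W] orth_proj_in[OF E, of x] vE[of x]
      by (metis image_eqI)
    then have "norm (r (v x) - orth_proj E x) = 0"
      using norm[OF csubspace_diff[OF sub(1) r(1) orth_proj_in[OF E]]] by (metis diff eq_iff_diff_eq_0 norm_zero)
    then show ?thesis by simp
  qed
  then show "adj v \<circ> v = orth_proj E" by (auto simp: adj)
qed

section \<open>The Hilbert space of square-integrable functions\<close>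

locale L2_space = prob_space M for M :: "'x measure" +
  fixes q :: "('x \<Rightarrow> complex) \<Rightarrow> 'h::chilbert_space"
  assumes is_L2: "is_L2 M q"
begin

abbreviation L2 :: "('x \<Rightarrow> complex) set" where "L2 \<equiv> L2_functions M"

abbreviation Linf :: "('x \<Rightarrow> complex) set" where "Linf \<equiv> Linf_functions M"

section \<open>Closure properties of square-integrable and essentially bounded functions\<close>

lemma L2_measurable [measurable_dest]: "f \<in> L2 \<Longrightarrow> f \<in> borel_measurable M"
  by (simp add: L2_functions_def)

lemma L2_integrable: "f \<in> L2 \<Longrightarrow> integrable M (\<lambda>\<omega>. (cmod (f \<omega>))\<^sup>2)"
  by (simp add: L2_functions_def)

lemma Linf_measurable [measurable_dest]: "f \<in> Linf \<Longrightarrow> f \<in> borel_measurable M"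
  by (simp add: Linf_functions_def)

lemma Linf_bound:
  assumes "f \<in> Linf"
  obtains c where "c > 0" "AE \<omega> in M. cmod (f \<omega>) \<le> c"
proof -
  obtain c where "AE \<omega> in M. cmod (f \<omega>) \<le> c" using assms by (auto simp: Linf_functions_def)
  then have "AE \<omega> in M. cmod (f \<omega>) \<le> max c 1" by eventually_elim simp
  then show thesis by (intro that[of "max c 1"]) simp_all
qed

lemma LinfI:
  "f \<in> borel_measurable M \<Longrightarrow> AE \<omega> in M. cmod (f \<omega>) \<le> c \<Longrightarrow> f \<in> Linf"
  by (auto simp: Linf_functions_def)

lemma L2I_bound:
  assumes "f \<in> borel_measurable M" "integrable M g" "AE \<omega> in M. (cmod (f \<omega>))\<^sup>2 \<le> g \<omega>"
  shows "f \<in> L2"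
  unfolding L2_functions_def using assms
  by (auto intro!: Bochner_Integration.integrable_bound[OF assms(2)] elim: eventually_mono)

lemma L2_add:
  assumes "f \<in> L2" "g \<in> L2"
  shows "(\<lambda>\<omega>. f \<omega> + g \<omega>) \<in> L2"
proof (rule L2I_bound)
  show "(\<lambda>\<omega>. f \<omega> + g \<omega>) \<in> borel_measurable M" using assms by measurable
  show "integrable M (\<lambda>\<omega>. 2 * (cmod (f \<omega>))\<^sup>2 + 2 * (cmod (g \<omega>))\<^sup>2)"
    using assms by (simp add: L2_integrable)
  have "(cmod (a + b))\<^sup>2 \<le> 2 * (cmod a)\<^sup>2 + 2 * (cmod b)\<^sup>2" for a b
  proof -
    have "(cmod (a + b))\<^sup>2 \<le> (cmod a + cmod b)\<^sup>2"
      by (intro power_mono norm_triangle_ineq norm_ge_zero)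
    also have "\<dots> \<le> 2 * (cmod a)\<^sup>2 + 2 * (cmod b)\<^sup>2"
      using sum_squares_bound[of "cmod a" "cmod b"] by (simp add: power2_sum)
    finally show ?thesis .
  qed
  then show "AE \<omega> in M. (cmod (f \<omega> + g \<omega>))\<^sup>2 \<le> 2 * (cmod (f \<omega>))\<^sup>2 + 2 * (cmod (g \<omega>))\<^sup>2" by simp
qed

lemma Linf_L2: assumes "f \<in> Linf" shows "f \<in> L2"
proof -
  obtain c where c: "AE \<omega> in M. cmod (f \<omega>) \<le> c" using Linf_bound[OF assms] .
  show ?thesis
  proof (rule L2I_bound[where g = "\<lambda>_. c\<^sup>2"])
    show "AE \<omega> in M. (cmod (f \<omega>))\<^sup>2 \<le> c\<^sup>2" using c by eventually_elim (simp add: power_mono)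
  qed (use assms in simp_all)
qed

lemma Linf_mult_L2:
  assumes "f \<in> Linf" "g \<in> L2"
  shows "(\<lambda>\<omega>. f \<omega> * g \<omega>) \<in> L2"
proof -
  obtain c where c: "AE \<omega> in M. cmod (f \<omega>) \<le> c" using Linf_bound[OF assms(1)] .
  show ?thesis
  proof (rule L2I_bound[where g = "\<lambda>\<omega>. c\<^sup>2 * (cmod (g \<omega>))\<^sup>2"])
    show "AE \<omega> in M. (cmod (f \<omega> * g \<omega>))\<^sup>2 \<le> c\<^sup>2 * (cmod (g \<omega>))\<^sup>2"
      using c by eventually_elim (simp add: norm_mult power_mult_distrib mult_right_mono power_mono)
  qed (use assms in \<open>simp_all add: L2_integrable Linf_measurable L2_measurable borel_measurable_times\<close>)
qed

lemma Linf_const [simp]: "(\<lambda>_. c) \<in> Linf"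
  by (rule LinfI[of _ "cmod c"]) simp_all

lemma Linf_add:
  assumes "f \<in> Linf" "g \<in> Linf"
  shows "(\<lambda>\<omega>. f \<omega> + g \<omega>) \<in> Linf"
proof -
  obtain c d where c: "AE \<omega> in M. cmod (f \<omega>) \<le> c" and d: "AE \<omega> in M. cmod (g \<omega>) \<le> d"
    using Linf_bound assms by metis
  have "AE \<omega> in M. cmod (f \<omega> + g \<omega>) \<le> c + d"
    using c d by eventually_elim (meson add_mono norm_triangle_ineq order_trans)
  then show ?thesis using assms by (intro LinfI[of _ "c + d"]) (simp_all add: Linf_measurable)
qed

lemma Linf_mult:
  assumes "f \<in> Linf" "g \<in> Linf"
  shows "(\<lambda>\<omega>. f \<omega> * g \<omega>) \<in> Linf"
proof -
  obtain c d where c: "c > 0" "AE \<omega> in M. cmod (f \<omega>) \<le> c" and d: "AE \<omega> in M. cmod (g \<omega>) \<le> d"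
    using Linf_bound assms by metis
  have "AE \<omega> in M. cmod (f \<omega> * g \<omega>) \<le> c * d"
    using c(2) d by eventually_elim (use c(1) in \<open>simp add: norm_mult mult_mono\<close>)
  then show ?thesis using assms
    by (intro LinfI[of _ "c * d"]) (simp_all add: Linf_measurable borel_measurable_times)
qed

lemma L2_cmult: "f \<in> L2 \<Longrightarrow> (\<lambda>\<omega>. c * f \<omega>) \<in> L2"
  by (intro Linf_mult_L2 Linf_const)

lemma L2_diff:
  "f \<in> L2 \<Longrightarrow> g \<in> L2 \<Longrightarrow> (\<lambda>\<omega>. f \<omega> - g \<omega>) \<in> L2"
  using L2_add[OF _ L2_cmult[of g "-1"], of f] by simp

lemma borel_measurable_cnj [measurable]:
  "f \<in> borel_measurable N \<Longrightarrow> (\<lambda>\<omega>. cnj (f \<omega>)) \<in> borel_measurable N"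
  by (rule measurable_compose[OF _ borel_measurable_continuous_onI])
    (auto intro: continuous_intros)

lemma Linf_cnj: "f \<in> Linf \<Longrightarrow> (\<lambda>\<omega>. cnj (f \<omega>)) \<in> Linf"
  by (auto simp: Linf_functions_def)

lemma L2_cnj: "f \<in> L2 \<Longrightarrow> (\<lambda>\<omega>. cnj (f \<omega>)) \<in> L2"
  by (auto simp: L2_functions_def)

lemma Linf_indicator [simp]: "Z \<in> sets M \<Longrightarrow> indicator Z \<in> Linf"
  by (rule LinfI[of _ 1]) (auto simp: indicator_def)

section \<open>The quotient map onto the Hilbert space\<close>

lemma q_add: "f \<in> L2 \<Longrightarrow> g \<in> L2 \<Longrightarrow> q (\<lambda>\<omega>. f \<omega> + g \<omega>) = q f + q g"
  using is_L2 by (simp add: is_L2_def)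

lemma q_cmult: "f \<in> L2 \<Longrightarrow> q (\<lambda>\<omega>. c * f \<omega>) = c *\<^sub>C q f"
  using is_L2 by (simp add: is_L2_def)

lemma cinner_q:
  "f \<in> L2 \<Longrightarrow> g \<in> L2 \<Longrightarrow> cinner (q f) (q g) = (\<integral>\<omega>. cnj (f \<omega>) * g \<omega> \<partial>M)"
  using is_L2 by (simp add: is_L2_def)

lemma q_diff:
  assumes "f \<in> L2" "g \<in> L2"
  shows "q (\<lambda>\<omega>. f \<omega> - g \<omega>) = q f - q g"
  using q_add[OF assms(1) L2_cmult[OF assms(2)], of "-1"] q_cmult[OF assms(2), of "-1"]
  by (simp add: scaleC_minus_one)

lemma q_cases: obtains f where "f \<in> L2" "x = q f"
  using is_L2 unfolding is_L2_def by (metis UNIV_I imageE)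

lemma norm_q: "f \<in> L2 \<Longrightarrow> (norm (q f))\<^sup>2 = (\<integral>\<omega>. (cmod (f \<omega>))\<^sup>2 \<partial>M)"
proof -
  assume f: "f \<in> L2"
  have "complex_of_real ((norm (q f))\<^sup>2) = (\<integral>\<omega>. complex_of_real ((cmod (f \<omega>))\<^sup>2) \<partial>M)"
    using cinner_q[OF f f] by (simp only: cinner_self complex_norm_square mult.commute)
  then show ?thesis by (simp only: integral_complex_of_real of_real_eq_iff)
qed

lemma q_eq_iff:
  assumes "f \<in> L2" "g \<in> L2"
  shows "q f = q g \<longleftrightarrow> (AE \<omega> in M. f \<omega> = g \<omega>)"
proof -
  have "q f = q g \<longleftrightarrow> (norm (q (\<lambda>\<omega>. f \<omega> - g \<omega>)))\<^sup>2 = 0"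
    by (simp add: q_diff assms)
  also have "\<dots> \<longleftrightarrow> (\<integral>\<omega>. (cmod (f \<omega> - g \<omega>))\<^sup>2 \<partial>M) = 0"
    using assms by (simp add: norm_q L2_diff)
  also have "\<dots> \<longleftrightarrow> (AE \<omega> in M. (cmod (f \<omega> - g \<omega>))\<^sup>2 = 0)"
    using assms by (intro integral_nonneg_eq_0_iff_AE) (auto simp: L2_integrable L2_diff)
  finally show ?thesis by simp
qed

text \<open>Dominated convergence for the squared difference. In the applications \<open>w\<close>
  is the squared modulus of one function, or a constant on the probability space.\<close>

lemma q_tendsto:
  assumes "\<And>n. f n \<in> L2" "g \<in> L2" and w: "integrable M w"
    and bound: "\<And>n. AE \<omega> in M. (cmod (f n \<omega> - g \<omega>))\<^sup>2 \<le> w \<omega>"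
    and lim: "AE \<omega> in M. (\<lambda>n. f n \<omega>) \<longlonglongrightarrow> g \<omega>"
  shows "(\<lambda>n. q (f n)) \<longlonglongrightarrow> q g"
proof -
  have "(\<lambda>n. \<integral>\<omega>. (cmod (f n \<omega> - g \<omega>))\<^sup>2 \<partial>M) \<longlonglongrightarrow> (\<integral>\<omega>. 0 \<partial>M)"
  proof (rule integral_dominated_convergence[OF _ _ w])
    show "AE \<omega> in M. (\<lambda>n. (cmod (f n \<omega> - g \<omega>))\<^sup>2) \<longlonglongrightarrow> 0"
      using lim
    proof eventually_elim
      case (elim \<omega>)
      then have "(\<lambda>n. (cmod (f n \<omega> - g \<omega>))\<^sup>2) \<longlonglongrightarrow> (cmod (g \<omega> - g \<omega>))\<^sup>2"
        by (intro tendsto_intros)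
      then show ?case by simp
    qed
  qed (use assms bound in \<open>auto simp: L2_measurable\<close>)
  then have "(\<lambda>n. (norm (q (f n) - q g))\<^sup>2) \<longlonglongrightarrow> 0"
    by (simp add: norm_q[symmetric] L2_diff q_diff assms(1,2))
  then have "(\<lambda>n. sqrt ((norm (q (f n) - q g))\<^sup>2)) \<longlonglongrightarrow> sqrt 0"
    by (rule tendsto_real_sqrt)
  then show ?thesis by (simp add: LIM_zero_cancel tendsto_norm_zero_iff)
qed

text \<open>Values of modulus above \<open>n\<close> are replaced by 0. The last clause keeps the
  approximants of a function inside any sigma-algebra for which it is measurable; it is applied to
  the sub-sigma-algebra of F.\<close>

lemma Linf_dense:
  assumes "g \<in> L2"
  obtains f where "\<And>n. f n \<in> Linf" "(\<lambda>n. q (f n)) \<longlonglongrightarrow> q g"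
    "\<And>N n. g \<in> borel_measurable N \<Longrightarrow> f n \<in> borel_measurable N"
proof -
  define f where "f n \<omega> = (if cmod (g \<omega>) \<le> real n then g \<omega> else 0)" for n \<omega>
  have meas: "f n \<in> borel_measurable N" if "g \<in> borel_measurable N" for n N
    unfolding f_def using that by measurable
  have f: "f n \<in> Linf" for n
    using meas[OF L2_measurable[OF assms]]
    by (intro LinfI[of _ "real n"]) (auto simp: f_def)
  have "(\<lambda>n. q (f n)) \<longlonglongrightarrow> q g"
  proof (rule q_tendsto[OF Linf_L2[OF f] assms L2_integrable[OF assms]])
    show "AE \<omega> in M. (cmod (f n \<omega> - g \<omega>))\<^sup>2 \<le> (cmod (g \<omega>))\<^sup>2" for n
      by (auto simp: f_def)
    show "AE \<omega> in M. (\<lambda>n. f n \<omega>) \<longlonglongrightarrow> g \<omega>"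
    proof (rule AE_I2)
      fix \<omega>
      obtain N where "cmod (g \<omega>) \<le> real N" using real_arch_simple by blast
      then have "\<forall>\<^sub>F n in sequentially. f n \<omega> = g \<omega>"
        unfolding eventually_sequentially f_def by (intro exI[of _ N]) auto
      then show "(\<lambda>n. f n \<omega>) \<longlonglongrightarrow> g \<omega>" by (rule tendsto_eventually)
    qed
  qed
  then show thesis using f meas by (intro that[of f]) auto
qed

lemma bounded_ops_eqI:
  assumes "bounded_linear S" "bounded_linear R"
    and eq: "\<And>f. f \<in> Linf \<Longrightarrow> S (q f) = R (q f)"
  shows "S = R"
proof
  fix x
  obtain g where g: "g \<in> L2" "x = q g" by (rule q_cases)
  obtain f where f: "\<And>n. f n \<in> Linf" "(\<lambda>n. q (f n)) \<longlonglongrightarrow> q g"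
    by (rule Linf_dense[OF g(1)]) (rule that)
  have "(\<lambda>n. S (q (f n))) \<longlonglongrightarrow> S x"
    unfolding g(2) by (rule bounded_linear.tendsto[OF assms(1) f(2)])
  moreover have "(\<lambda>n. R (q (f n))) \<longlonglongrightarrow> R x"
    unfolding g(2) by (rule bounded_linear.tendsto[OF assms(2) f(2)])
  ultimately show "S x = R x" unfolding eq[OF f(1)] by (rule LIMSEQ_unique)
qed

lemma cinner_q_eqI:
  assumes "\<And>k. k \<in> Linf \<Longrightarrow> cinner (q k) x = cinner (q k) y"
  shows "x = y"
proof -
  obtain g where g: "g \<in> L2" "x - y = q g" by (rule q_cases)
  obtain f where f: "\<And>n. f n \<in> Linf" "(\<lambda>n. q (f n)) \<longlonglongrightarrow> q g"
    by (rule Linf_dense[OF g(1)]) (rule that)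
  have "(\<lambda>n. cinner (q (f n)) (x - y)) \<longlonglongrightarrow> cinner (q g) (x - y)"
    by (rule cinner_tendsto_left[OF f(2)])
  moreover have "cinner (q (f n)) (x - y) = 0" for n
    using assms[OF f(1)] by (simp add: cinner_diff_right)
  ultimately have "cinner (x - y) (x - y) = 0"
    by (simp add: g(2) LIMSEQ_const_iff)
  then show ?thesis by (simp add: cinner_self)
qed

text \<open>A pointwise Lipschitz bound passes directly to the L2 norm. With \<open>L = 1\<close> it
  serves complex conjugation, with \<open>L = n\<close> the ramps, so that maps that are not complex
  linear pass through L2 limits without almost everywhere convergent subsequences.\<close>

lemma q_tendsto_Lipschitz:
  assumes f: "\<And>n. f n \<in> L2" "g \<in> L2" "(\<lambda>n. q (f n)) \<longlonglongrightarrow> q g"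
    and f': "\<And>n. f' n \<in> L2" "g' \<in> L2"
    and le: "\<And>n \<omega>. cmod (f' n \<omega> - g' \<omega>) \<le> L * cmod (f n \<omega> - g \<omega>)"
  shows "(\<lambda>n. q (f' n)) \<longlonglongrightarrow> q g'"
proof -
  have "(norm (q (f' n) - q g'))\<^sup>2 \<le> (L * norm (q (f n) - q g))\<^sup>2" for n
  proof -
    have "(norm (q (f' n) - q g'))\<^sup>2 = (\<integral>\<omega>. (cmod (f' n \<omega> - g' \<omega>))\<^sup>2 \<partial>M)"
      by (simp add: norm_q[symmetric] L2_diff q_diff f')
    also have "\<dots> \<le> (\<integral>\<omega>. L\<^sup>2 * (cmod (f n \<omega> - g \<omega>))\<^sup>2 \<partial>M)"
      using le by (intro integral_mono integrable_mult_right L2_integrable L2_diff f f')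
        (simp_all add: power_mult_distrib[symmetric] power_mono)
    also have "\<dots> = (L * norm (q (f n) - q g))\<^sup>2"
      by (simp add: norm_q[symmetric] L2_diff q_diff f power_mult_distrib)
    finally show ?thesis .
  qed
  then have "norm (q (f' n) - q g') \<le> \<bar>L\<bar> * norm (q (f n) - q g)" for n
    using abs_le_square_iff[of "norm (q (f' n) - q g')" "L * norm (q (f n) - q g)"]
    by (simp add: abs_mult)
  then have "\<forall>\<^sub>F n in sequentially. norm (q (f' n) - q g') \<le> \<bar>L\<bar> * norm (q (f n) - q g)"
    by (intro always_eventually allI)
  moreover have "(\<lambda>n. \<bar>L\<bar> * norm (q (f n) - q g)) \<longlonglongrightarrow> 0"
    using f(3) by (intro tendsto_mult_right_zero tendsto_norm_zero LIM_zero)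
  ultimately have "(\<lambda>n. q (f' n) - q g') \<longlonglongrightarrow> 0"
    by (rule Lim_null_comparison)
  then show ?thesis by (rule LIM_zero_cancel)
qed

subsection \<open>Multiplication operators\<close>

text \<open>\<open>mult_op\<close> multiplies a chosen representative; another one differs on a null
  set only, so the product may be computed from any.\<close>

lemma mult_op_q:
  assumes "f \<in> Linf" "g \<in> L2"
  shows "mult_op M q f (q g) = q (\<lambda>\<omega>. f \<omega> * g \<omega>)"
proof -
  define g' where "g' = (SOME g'. g' \<in> L2 \<and> q g' = q g)"
  have g': "g' \<in> L2" "q g' = q g"
    unfolding g'_def using someI[of "\<lambda>g'. g' \<in> L2 \<and> q g' = q g"] assms(2) by auto
  then have "AE \<omega> in M. f \<omega> * g' \<omega> = f \<omega> * g \<omega>"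
    using q_eq_iff[OF g'(1) assms(2)] by (auto elim: eventually_mono)
  then show ?thesis
    unfolding mult_op_def g'_def[symmetric] Let_def
    using q_eq_iff[OF Linf_mult_L2[OF assms(1) g'(1)] Linf_mult_L2[OF assms]] by simp
qed

lemma mult_op_eqI:
  assumes "f \<in> Linf" "g \<in> Linf" "AE \<omega> in M. f \<omega> = g \<omega>"
  shows "mult_op M q f = mult_op M q g"
proof
  fix x
  obtain h where h: "h \<in> L2" "x = q h" by (rule q_cases)
  have "AE \<omega> in M. f \<omega> * h \<omega> = g \<omega> * h \<omega>" using assms(3) by eventually_elim simp
  then show "mult_op M q f x = mult_op M q g x"
    by (simp add: h mult_op_q assms q_eq_iff Linf_mult_L2)
qed

lemma mult_op_one: assumes "f \<in> Linf" shows "mult_op M q f (q (\<lambda>_. 1)) = q f"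
  using mult_op_q[OF assms Linf_L2[OF Linf_const, of 1]] by simp

lemma mult_op_eq_iff:
  assumes "f \<in> Linf" "g \<in> Linf"
  shows "mult_op M q f = mult_op M q g \<longleftrightarrow> (AE \<omega> in M. f \<omega> = g \<omega>)"
  using mult_op_eqI[OF assms] mult_op_one assms q_eq_iff[OF Linf_L2 Linf_L2] by metis

lemma mult_op_bounded_ops:
  assumes f: "f \<in> Linf"
  shows "mult_op M q f \<in> bounded_ops"
proof -
  obtain c where c: "c > 0" "AE \<omega> in M. cmod (f \<omega>) \<le> c" using Linf_bound[OF f] .
  have add: "mult_op M q f (x + y) = mult_op M q f x + mult_op M q f y" for x y
  proof -
    obtain g h where gh: "g \<in> L2" "x = q g" "h \<in> L2" "y = q h"
      by (metis q_cases)
    then show ?thesis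
      using f by (simp add: q_add[symmetric] mult_op_q L2_add Linf_mult_L2 ring_distribs)
  qed
  have scale: "mult_op M q f (r *\<^sub>C x) = r *\<^sub>C mult_op M q f x" for r x
  proof -
    obtain g where g: "g \<in> L2" "x = q g" by (metis q_cases)
    then show ?thesis
      using f by (simp add: q_cmult[symmetric] mult_op_q L2_cmult Linf_mult_L2 mult.left_commute)
  qed
  have "norm (mult_op M q f x) \<le> norm x * c" for x
  proof -
    obtain g where g: "g \<in> L2" "x = q g" by (metis q_cases)
    have "(norm (mult_op M q f x))\<^sup>2 = (\<integral>\<omega>. (cmod (f \<omega> * g \<omega>))\<^sup>2 \<partial>M)"
      by (simp add: g mult_op_q f norm_q Linf_mult_L2)
    also have "\<dots> \<le> (\<integral>\<omega>. c\<^sup>2 * (cmod (g \<omega>))\<^sup>2 \<partial>M)"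
    proof (intro integral_mono_AE)
      show "AE \<omega> in M. (cmod (f \<omega> * g \<omega>))\<^sup>2 \<le> c\<^sup>2 * (cmod (g \<omega>))\<^sup>2"
        using c(2)
        by eventually_elim (simp add: norm_mult power_mult_distrib mult_right_mono power_mono)
    qed (use f g in \<open>simp_all add: L2_integrable Linf_mult_L2\<close>)
    also have "\<dots> = (norm x * c)\<^sup>2"
      by (simp add: norm_q g power_mult_distrib)
    finally show ?thesis by (rule power2_le_imp_le) (use c(1) in auto)
  qed
  then show ?thesis by (intro bounded_opsI[where K = c] add scale)
qed

lemma mult_op_mult:
  assumes "f \<in> Linf" "g \<in> Linf"
  shows "mult_op M q f (mult_op M q g x) = mult_op M q (\<lambda>\<omega>. f \<omega> * g \<omega>) x"
proof -
  obtain h where h: "h \<in> L2" "x = q h" by (metis q_cases)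
  then show ?thesis using assms by (simp add: mult_op_q Linf_mult Linf_mult_L2 mult.assoc)
qed

lemma mult_op_commute:
  assumes "f \<in> Linf" "g \<in> Linf"
  shows "mult_op M q f (mult_op M q g x) = mult_op M q g (mult_op M q f x)"
  using assms by (simp add: mult_op_mult mult.commute)

lemma mult_op_add:
  assumes "f \<in> Linf" "g \<in> Linf"
  shows "mult_op M q (\<lambda>\<omega>. f \<omega> + g \<omega>) x = mult_op M q f x + mult_op M q g x"
proof -
  obtain h where h: "h \<in> L2" "x = q h" by (metis q_cases)
  then show ?thesis
    using assms by (simp add: mult_op_q Linf_add Linf_mult_L2 q_add[symmetric] ring_distribs)
qed

lemma mult_op_const: "mult_op M q (\<lambda>_. c) x = c *\<^sub>C x"
proof -
  obtain h where h: "h \<in> L2" "x = q h" by (metis q_cases)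
  then show ?thesis by (simp add: mult_op_q q_cmult)
qed

lemma cinner_mult_op:
  assumes f: "f \<in> Linf"
  shows "cinner (mult_op M q f x) y = cinner x (mult_op M q (\<lambda>\<omega>. cnj (f \<omega>)) y)"
proof -
  obtain g h where gh: "g \<in> L2" "x = q g" "h \<in> L2" "y = q h"
    by (metis q_cases)
  then show ?thesis
    using f by (simp add: mult_op_q Linf_cnj cinner_q Linf_mult_L2 mult.left_commute mult.assoc)
qed

lemma adj_mult_op:
  "f \<in> Linf \<Longrightarrow> adj (mult_op M q f) = mult_op M q (\<lambda>\<omega>. cnj (f \<omega>))"
  by (intro adj_eqI cinner_mult_op)

lemma mult_symbol:
  assumes "f \<in> Linf"
  shows "mult_symbol M q (mult_op M q f) \<in> Linf"
    and "AE \<omega> in M. mult_symbol M q (mult_op M q f) \<omega> = f \<omega>"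
proof -
  have *: "mult_symbol M q (mult_op M q f) \<in> Linf
      \<and> mult_op M q (mult_symbol M q (mult_op M q f)) = mult_op M q f"
    unfolding mult_symbol_def by (rule someI[of _ f]) (simp add: assms)
  then show "mult_symbol M q (mult_op M q f) \<in> Linf" ..
  with * assms show "AE \<omega> in M. mult_symbol M q (mult_op M q f) \<omega> = f \<omega>"
    using mult_op_eq_iff by blast
qed

lemma norm_q_indicator: "Z \<in> sets M \<Longrightarrow> (norm (q (indicator Z)))\<^sup>2 = prob Z"
proof -
  assume Z: "Z \<in> sets M"
  have "(cmod (indicator Z \<omega>))\<^sup>2 = indicator Z \<omega>" for \<omega>
    by (auto simp: indicator_def)
  then show ?thesis using Z by (simp add: norm_q Linf_L2)
qed

text \<open>The symbol must be the image of the constant 1, a priori only square-integrable. It is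
  essentially bounded because \<open>S\<close> would otherwise stretch the indicator of a set on
  which the symbol is large by more than the norm bound of \<open>S\<close>.\<close>

lemma commutant_mult_op:
  assumes S: "bounded_linear S"
    and comm: "\<And>f x. f \<in> Linf \<Longrightarrow> S (mult_op M q f x) = mult_op M q f (S x)"
  obtains g where "g \<in> Linf" "S = mult_op M q g"
proof -
  obtain g where g: "g \<in> L2" "S (q (\<lambda>_. 1)) = q g" by (metis q_cases)
  have Sq: "S (q f) = q (\<lambda>\<omega>. f \<omega> * g \<omega>)" if "f \<in> Linf" for f
    using comm[OF that, of "q (\<lambda>_. 1)"] that g by (simp add: mult_op_one mult_op_q)
  obtain B where B: "B > 0" "\<And>x. norm (S x) \<le> norm x * B"
    using bounded_linear.pos_bounded[OF S] by blast
  \<comment> \<open>The margin 1 above the bound \<open>B\<close> leaves the factor (B + 1)^2 - B^2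
    > 0, which forces the measure of \<open>Z\<close> to vanish.\<close>
  define Z where "Z = {\<omega> \<in> space M. B + 1 < cmod (g \<omega>)}"
  have Z [measurable]: "Z \<in> sets M" unfolding Z_def using g(1) by measurable

  have "(B + 1)\<^sup>2 * prob Z = (\<integral>\<omega>. (B + 1)\<^sup>2 * indicator Z \<omega> \<partial>M)"
    by simp
  also have "\<dots> \<le> (\<integral>\<omega>. (cmod (indicator Z \<omega> * g \<omega>))\<^sup>2 \<partial>M)"
  proof (intro integral_mono)
    show "integrable M (\<lambda>\<omega>. (B + 1)\<^sup>2 * indicator Z \<omega> :: real)"
      by (intro integrable_mult_right integrable_real_indicator)
        (simp_all add: emeasure_eq_measure)
    show "integrable M (\<lambda>\<omega>. (cmod (indicator Z \<omega> * g \<omega>))\<^sup>2)"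
      by (rule L2_integrable[OF Linf_mult_L2[OF Linf_indicator[OF Z] g(1)]])
    show "(B + 1)\<^sup>2 * indicator Z \<omega> \<le> (cmod (indicator Z \<omega> * g \<omega>))\<^sup>2" for \<omega>
      using B(1) by (auto simp: Z_def indicator_def intro!: power_mono)
  qed
  also have "\<dots> = (norm (S (q (indicator Z))))\<^sup>2"
    using g(1) by (simp add: Sq norm_q Linf_mult_L2)
  also have "\<dots> \<le> (norm (q (indicator Z)) * B)\<^sup>2"
    by (intro power_mono B(2) norm_ge_zero)
  also have "\<dots> = B\<^sup>2 * prob Z"
    by (simp add: power_mult_distrib norm_q_indicator)
  finally have "((B + 1)\<^sup>2 - B\<^sup>2) * prob Z \<le> 0" by (simp add: algebra_simps)
  moreover have "(B + 1)\<^sup>2 - B\<^sup>2 > 0" using B(1) by (simp add: power2_eq_square algebra_simps)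
  ultimately have "prob Z = 0" by (simp add: mult_le_0_iff measure_le_0_iff)
  then have "AE \<omega> in M. \<omega> \<notin> Z" by (simp add: AE_iff_measurable[OF Z] prob_eq_0)
  then have "AE \<omega> in M. cmod (g \<omega>) \<le> B + 1"
    using AE_space by eventually_elim (auto simp: Z_def)
  then have g': "g \<in> Linf" using g(1) by (intro LinfI[of _ "B + 1"]) (simp_all add: L2_measurable)
  moreover have "S = mult_op M q g"
    using S g' mult_op_bounded_ops[OF g']
    by (intro bounded_ops_eqI) (simp_all add: bounded_ops_def Sq mult_op_q Linf_L2 mult.commute)
  ultimately show thesis by (rule that)
qed

subsection \<open>Restriction to measurable sets\<close>

definition chi :: "'x set \<Rightarrow> 'h \<Rightarrow> 'h"
  where "chi Z = mult_op M q (indicator Z)"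

lemma chi_q:
  "Z \<in> sets M \<Longrightarrow> f \<in> L2 \<Longrightarrow> chi Z (q f) = q (\<lambda>\<omega>. indicator Z \<omega> * f \<omega>)"
  by (simp add: chi_def mult_op_q)

lemma chi_bounded_ops: "Z \<in> sets M \<Longrightarrow> chi Z \<in> bounded_ops"
  by (simp add: chi_def mult_op_bounded_ops)

lemma bounded_linear_chi: "Z \<in> sets M \<Longrightarrow> bounded_linear (chi Z)"
  using chi_bounded_ops by (simp add: bounded_ops_def)

lemma chi_simps:
  assumes "Z \<in> sets M"
  shows "chi Z 0 = 0" "chi Z (x + y) = chi Z x + chi Z y" "chi Z (x - y) = chi Z x - chi Z y"
    "chi Z (c *\<^sub>C x) = c *\<^sub>C chi Z x"
  using chi_bounded_ops[OF assms]
  by (auto simp: bounded_ops_def linear_simps)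

lemma chi_chi:
  assumes "Z \<in> sets M" "Y \<in> sets M"
  shows "chi Z (chi Y x) = chi (Z \<inter> Y) x"
  unfolding chi_def using assms by (simp add: mult_op_mult indicator_inter_arith[symmetric])

lemma chi_mult_op:
  "Z \<in> sets M \<Longrightarrow> f \<in> Linf \<Longrightarrow> chi Z (mult_op M q f x) = mult_op M q f (chi Z x)"
  unfolding chi_def by (simp add: mult_op_commute)

lemma chi_empty: "chi {} x = 0"
  using mult_op_const[of 0 x] by (simp add: chi_def indicator_def[abs_def])

lemma chi_space: "chi (space M) x = x"
proof -
  have "mult_op M q (indicator (space M)) = mult_op M q (\<lambda>_. 1)"
    by (rule mult_op_eqI) (auto intro: AE_I2)
  then show ?thesis by (simp add: chi_def mult_op_const)
qed

lemma chi_eqI: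
  assumes "Z \<in> sets M" "Y \<in> sets M" "AE \<omega> in M. \<omega> \<in> Z \<longleftrightarrow> \<omega> \<in> Y"
  shows "chi Z = chi Y"
  unfolding chi_def using assms
  by (intro mult_op_eqI) (auto elim!: eventually_mono simp: indicator_def)

lemma chi_null: "Z \<in> null_sets M \<Longrightarrow> chi Z x = 0"
  using chi_eqI[of Z "{}"] AE_not_in[of Z M] chi_empty by (auto simp: null_setsD2)

lemma cinner_chi: "Z \<in> sets M \<Longrightarrow> cinner (chi Z x) y = cinner x (chi Z y)"
proof -
  have "(\<lambda>\<omega>. cnj (indicator Z \<omega>)) = indicator Z" by (auto simp: indicator_def)
  then show "Z \<in> sets M \<Longrightarrow> ?thesis"
    unfolding chi_def using cinner_mult_op[of "indicator Z" x y] by simp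
qed

lemma norm_chi_le: "Z \<in> sets M \<Longrightarrow> norm (chi Z x) \<le> norm x"
  by (rule norm_selfadjoint_idempotent) (simp_all add: cinner_chi chi_chi)

lemma chi_disjoint_sums:
  assumes B: "\<And>k. B k \<in> sets M" "disjoint_family B"
  shows "(\<lambda>k. chi (B k) x) sums chi (\<Union>k. B k) x"
proof -
  obtain f where f: "f \<in> L2" "x = q f" by (rule q_cases)
  have U: "(\<Union>k<n. B k) \<in> sets M" for n using B by auto
  have UU: "(\<Union>k. B k) \<in> sets M" using B by auto
  have "(\<Sum>k<n. chi (B k) x) = chi (\<Union>k<n. B k) x" for n
  proof (induction n)
    case (Suc n)
    have dis: "(\<Union>k<n. B k) \<inter> B n = {}"
      using B(2) by (auto simp: disjoint_family_on_def) (metis Int_iff empty_iff less_irrefl)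
    have "chi (\<Union>k<Suc n. B k) x = mult_op M q (\<lambda>\<omega>. indicator (\<Union>k<n. B k) \<omega> + indicator (B n) \<omega>) x"
      using dis unfolding chi_def
      by (intro arg_cong[where f = "\<lambda>h. mult_op M q h x"])
        (auto simp: fun_eq_iff indicator_def lessThan_Suc)
    then show ?case using Suc U B by (simp add: mult_op_add chi_def)
  qed (simp add: chi_empty)
  moreover have "(\<lambda>n. chi (\<Union>k<n. B k) x) \<longlonglongrightarrow> chi (\<Union>k. B k) x"
    unfolding f(2) chi_q[OF U f(1)] chi_q[OF UU f(1)]
  proof (rule q_tendsto)
    show "integrable M (\<lambda>\<omega>. (cmod (f \<omega>))\<^sup>2)" by (rule L2_integrable[OF f(1)])
    show "AE \<omega> in M. (\<lambda>n. indicator (\<Union>k<n. B k) \<omega> * f \<omega>) \<longlonglongrightarrow> indicator (\<Union>k. B k) \<omega> * f \<omega>"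
      by (intro AE_I2 tendsto_mult tendsto_const LIMSEQ_indicator_UN)
    show "AE \<omega> in M. (cmod (indicator (\<Union>k<n. B k) \<omega> * f \<omega> - indicator (\<Union>k. B k) \<omega> * f \<omega>))\<^sup>2
        \<le> (cmod (f \<omega>))\<^sup>2" for n
      by (auto simp: indicator_def)
  qed (use f(1) U UU in \<open>simp_all add: Linf_mult_L2\<close>)
  ultimately show ?thesis by (simp add: sums_def)
qed

end

section \<open>Subalgebras and sub-sigma-algebras\<close>

text \<open>A piecewise linear approximation of the indicator function of the half line above \<open>c\<close>.\<close>

definition ramp :: "real \<Rightarrow> nat \<Rightarrow> real \<Rightarrow> real"
  where "ramp c n t = max 0 (min 1 (real n * (t - c)))"

lemma ramp_bounds: "0 \<le> ramp c n t" "ramp c n t \<le> 1" "\<bar>ramp c n t\<bar> \<le> 1"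
  by (auto simp: ramp_def)

lemma ramp_Lipschitz: "\<bar>ramp c n s - ramp c n t\<bar> \<le> real n * \<bar>s - t\<bar>"
proof -
  have "\<bar>max 0 (min 1 a) - max 0 (min 1 b)\<bar> \<le> \<bar>a - b\<bar>" for a b :: real
    by (simp add: max_def min_def)
  from this[of "real n * (s - c)" "real n * (t - c)"] show ?thesis
    by (simp add: ramp_def right_diff_distrib[symmetric] abs_mult)
qed

lemma continuous_ramp: "continuous_on UNIV (ramp c n)"
  unfolding ramp_def by (intro continuous_intros)

lemma ramp_measurable [measurable]: "ramp c n \<in> borel_measurable borel"
  using continuous_ramp by (rule borel_measurable_continuous_onI)

lemma ramp_tendsto: "(\<lambda>n. ramp c n t) \<longlonglongrightarrow> indicator {c<..} t"
proof (cases "t > c")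
  case True
  obtain K where K: "1 / (t - c) \<le> real K" using real_arch_simple by blast
  have "ramp c n t = 1" if "n \<ge> K" for n
  proof -
    have "1 / (t - c) \<le> real n" using K that by linarith
    then have "1 \<le> real n * (t - c)" using True by (simp add: field_simps)
    then show ?thesis by (simp add: ramp_def)
  qed
  then show ?thesis using True
    by (intro tendsto_eventually) (auto simp: eventually_sequentially)
next
  case False
  then have "real n * (t - c) \<le> 0" for n by (intro mult_nonneg_nonpos) auto
  then have "max 0 (min 1 (real n * (t - c))) = 0" for n by (meson max.absorb1 min.coboundedI2)
  then have "ramp c n t = 0" for n by (simp add: ramp_def)
  then show ?thesis using False by simp
qed

locale L2_subalgebra = L2_space M q
  for M :: "'x measure" and q :: "('x \<Rightarrow> complex) \<Rightarrow> 'h::chilbert_space" +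
  fixes N :: "('h \<Rightarrow> 'h) set"
  assumes von_neumann: "von_neumann_algebra N"
    and N_mult: "N \<subseteq> mult_op M q ` Linf"
begin

section \<open>The subalgebra as an algebra of functions, and its L2 closure\<close>

definition FF :: "('x \<Rightarrow> complex) set"
  where "FF = {f \<in> Linf. mult_op M q f \<in> N}"

definition HF :: "'h set"
  where "HF = closure (q ` FF)"

lemma FF_Linf: "f \<in> FF \<Longrightarrow> f \<in> Linf"
  and FF_mult_op: "f \<in> FF \<Longrightarrow> mult_op M q f \<in> N"
  by (simp_all add: FF_def)

lemma FF_L2: "f \<in> FF \<Longrightarrow> f \<in> L2"
  by (simp add: FF_Linf Linf_L2)

lemma N_cases: assumes "a \<in> N" obtains f where "f \<in> FF" "a = mult_op M q f"
  using assms N_mult by (auto simp: FF_def)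

text \<open>The double commutant property turns membership in F into commutation with every operator
  of the commutant. Closure under constants, sums and products then needs only algebra.\<close>

lemma FF_iff:
  assumes "f \<in> Linf"
  shows "f \<in> FF \<longleftrightarrow> (\<forall>S\<in>commutant N. \<forall>x. S (mult_op M q f x) = mult_op M q f (S x))"
proof -
  have "f \<in> FF \<longleftrightarrow> mult_op M q f \<in> commutant (commutant N)"
    using assms von_neumann by (simp add: FF_def von_neumann_algebra_def)
  then show ?thesis
    using mult_op_bounded_ops[OF assms] by (auto simp: commutant_def[of "commutant N"] fun_eq_iff)
qed

lemma commutant_linear:
  assumes "S \<in> commutant N"
  shows "bounded_linear S" "S (x + y) = S x + S y" "S (c *\<^sub>C x) = c *\<^sub>C S x"
  using assms by (auto simp: commutant_def bounded_ops_def linear_simps)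

lemma FF_commute: "f \<in> FF \<Longrightarrow> S \<in> commutant N \<Longrightarrow> S (mult_op M q f x) = mult_op M q f (S x)"
  using FF_iff[OF FF_Linf] by blast

lemma FF_const: "(\<lambda>_. c) \<in> FF"
  by (simp add: FF_iff mult_op_const commutant_linear)

lemma FF_add: "f \<in> FF \<Longrightarrow> g \<in> FF \<Longrightarrow> (\<lambda>\<omega>. f \<omega> + g \<omega>) \<in> FF"
  by (subst FF_iff) (simp_all add: Linf_add FF_Linf mult_op_add commutant_linear FF_commute)

lemma FF_mult: "f \<in> FF \<Longrightarrow> g \<in> FF \<Longrightarrow> (\<lambda>\<omega>. f \<omega> * g \<omega>) \<in> FF"
  by (subst FF_iff) (simp_all add: Linf_mult FF_Linf FF_commute flip: mult_op_mult)

lemma FF_cmult: "f \<in> FF \<Longrightarrow> (\<lambda>\<omega>. c * f \<omega>) \<in> FF"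
  by (intro FF_mult FF_const)

lemma FF_diff: "f \<in> FF \<Longrightarrow> g \<in> FF \<Longrightarrow> (\<lambda>\<omega>. f \<omega> - g \<omega>) \<in> FF"
  using FF_add[of f "\<lambda>\<omega>. -1 * g \<omega>"] FF_cmult[of g "-1"] by simp

lemma FF_cnj: "f \<in> FF \<Longrightarrow> (\<lambda>\<omega>. cnj (f \<omega>)) \<in> FF"
  using von_neumann by (auto simp: FF_def von_neumann_algebra_def Linf_cnj adj_mult_op[symmetric])

lemma FF_cong_AE:
  assumes "f \<in> FF" "g \<in> Linf" "AE \<omega> in M. f \<omega> = g \<omega>"
  shows "g \<in> FF"
  using assms mult_op_eqI[of f g] by (simp add: FF_def)

lemma closed_csubspace_HF: "closed_csubspace HF"
  unfolding HF_def
proof (rule closed_csubspace_closure, unfold csubspace_def, intro conjI ballI allI)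
  show "0 \<in> q ` FF"
    using q_cmult[OF Linf_L2[OF Linf_const], of 0] FF_const[of 0] by (auto intro: rev_image_eqI)
next
  fix x y assume "x \<in> q ` FF" "y \<in> q ` FF"
  then show "x + y \<in> q ` FF" by (auto simp: q_add[symmetric] FF_L2 FF_add)
next
  fix c x assume "x \<in> q ` FF"
  then show "c *\<^sub>C x \<in> q ` FF" by (auto simp: q_cmult[symmetric] FF_L2 FF_cmult)
qed

lemma FF_HF: "f \<in> FF \<Longrightarrow> q f \<in> HF"
  unfolding HF_def by (rule subsetD[OF closure_subset]) (rule imageI)

lemma HF_cases:
  assumes "x \<in> HF" obtains f where "\<And>n. f n \<in> FF" "(\<lambda>n. q (f n)) \<longlonglongrightarrow> x"
proof -
  obtain y where y: "\<forall>n. y n \<in> q ` FF" "y \<longlonglongrightarrow> x"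
    using assms by (auto simp: HF_def closure_sequential)
  then have "\<forall>n. \<exists>f. f \<in> FF \<and> y n = q f" by blast
  from choice[OF this] obtain f where f: "\<forall>n. f n \<in> FF \<and> y n = q (f n)" ..
  then have "y = (\<lambda>n. q (f n))" by auto
  then show thesis using y(2) f that[of f] by simp
qed

lemma HF_limit: "(\<And>n. x n \<in> HF) \<Longrightarrow> x \<longlonglongrightarrow> y \<Longrightarrow> y \<in> HF"
  using closed_csubspace_HF closed_sequentially[of HF x y] by (simp add: closed_csubspace_def)

text \<open>\<open>F\<close> is closed in the \<open>L\<^sup>2\<close> norm inside \<open>A\<close>, because it is a double commutant.\<close>

lemma FF_HF_iff:
  assumes f: "f \<in> Linf"
  shows "f \<in> FF \<longleftrightarrow> q f \<in> HF"
proof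
  assume "q f \<in> HF"
  then obtain a where a: "\<And>n. a n \<in> FF" "(\<lambda>n. q (a n)) \<longlonglongrightarrow> q f" by (rule HF_cases) (rule that)
  note aL = FF_Linf[OF a(1)]
  have a': "(\<lambda>n. q (\<lambda>\<omega>. cnj (a n \<omega>))) \<longlonglongrightarrow> q (\<lambda>\<omega>. cnj (f \<omega>))"
    by (rule q_tendsto_Lipschitz[OF _ _ a(2), where L = 1])
      (simp_all add: Linf_L2 aL f L2_cnj flip: complex_cnj_diff)
  show "f \<in> FF"
    unfolding FF_iff[OF f]
  proof (intro ballI)
    fix S assume S: "S \<in> commutant N"
    have bl: "bounded_linear (mult_op M q g)" if "g \<in> Linf" for g
      using mult_op_bounded_ops[OF that] by (simp add: bounded_ops_def)
    have "S \<circ> mult_op M q f = mult_op M q f \<circ> S"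
    proof (rule bounded_ops_eqI)
      fix h assume h: "h \<in> Linf"
      \<comment> \<open>The \<open>a n\<close> converge in L2 only, so the operators of
        multiplication by them need not converge in norm. Against bounded \<open>h\<close> and
        \<open>k\<close> the roles are exchanged: \<open>a n\<close> becomes the vector that
        \<open>h\<close> multiplies, and its conjugate the vector that \<open>k\<close>
        multiplies.\<close>
      have "S (mult_op M q f (q h)) = mult_op M q f (S (q h))"
      proof (rule cinner_q_eqI)
        fix k assume k: "k \<in> Linf"
        have "(\<lambda>n. cinner (q k) (S (mult_op M q h (q (a n))))) \<longlonglongrightarrow> cinner (q k) (S (mult_op M q h (q f)))"
          by (intro cinner_tendsto_right bounded_linear.tendsto[OF commutant_linear(1)[OF S]]
              bounded_linear.tendsto[OF bl[OF h]] a(2))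
        moreover have "(\<lambda>n. cinner (mult_op M q k (q (\<lambda>\<omega>. cnj (a n \<omega>)))) (S (q h)))
            \<longlonglongrightarrow> cinner (mult_op M q k (q (\<lambda>\<omega>. cnj (f \<omega>)))) (S (q h))"
          by (intro cinner_tendsto_left bounded_linear.tendsto[OF bl[OF k]] a')
        moreover have "cinner (q k) (S (mult_op M q h (q (a n))))
            = cinner (mult_op M q k (q (\<lambda>\<omega>. cnj (a n \<omega>)))) (S (q h))" for n
        proof -
          have "mult_op M q h (q (a n)) = mult_op M q (a n) (q h)"
            using h aL by (simp add: mult_op_q Linf_L2 mult.commute)
          then have "S (mult_op M q h (q (a n))) = mult_op M q (a n) (S (q h))"
            using FF_commute[OF a(1) S] by simp
          moreover have "mult_op M q k (q (\<lambda>\<omega>. cnj (a n \<omega>))) = mult_op M q (\<lambda>\<omega>. cnj (a n \<omega>)) (q k)"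
            using k aL by (simp add: mult_op_q Linf_L2 Linf_cnj mult.commute)
          ultimately show ?thesis
            using cinner_mult_op[OF Linf_cnj[OF aL], of n "q k" "S (q h)"] by simp
        qed
        ultimately have "cinner (q k) (S (mult_op M q h (q f)))
            = cinner (mult_op M q k (q (\<lambda>\<omega>. cnj (f \<omega>)))) (S (q h))"
          using LIMSEQ_unique by simp
        moreover have "mult_op M q h (q f) = mult_op M q f (q h)"
          using h f by (simp add: mult_op_q Linf_L2 mult.commute)
        moreover have "mult_op M q k (q (\<lambda>\<omega>. cnj (f \<omega>))) = mult_op M q (\<lambda>\<omega>. cnj (f \<omega>)) (q k)"
          using k f by (simp add: mult_op_q Linf_L2 Linf_cnj mult.commute)
        ultimately show "cinner (q k) (S (mult_op M q f (q h))) = cinner (q k) (mult_op M q f (S (q h)))"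
          using cinner_mult_op[OF Linf_cnj[OF f], of "q k" "S (q h)"] by simp
      qed
      then show "(S \<circ> mult_op M q f) (q h) = (mult_op M q f \<circ> S) (q h)" by simp
    qed (intro bounded_linear_compose[unfolded o_def[symmetric]] bl f commutant_linear(1) S)+
    then show "\<forall>x. S (mult_op M q f x) = mult_op M q f (S x)" by (simp add: fun_eq_iff)
  qed
qed (rule FF_HF)

text \<open>The role of \<open>G\<close> is its sigma-algebra; probabilities are always taken in
  \<open>M\<close>. Since F does not see null sets, every null set of \<open>M\<close> belongs to
  \<open>G\<close>.\<close>

definition G :: "'x measure"
  where "G = sigma (space M) {Z \<in> sets M. indicator Z \<in> FF}"

text \<open>Complements and finite unions are algebra operations on indicators. A countable union is
  an L2 limit of finite ones, and F is closed under such limits inside A.\<close>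

lemma sigma_algebra_FF: "sigma_algebra (space M) {Z \<in> sets M. indicator Z \<in> FF}"
  unfolding sigma_algebra_iff2
proof (intro conjI ballI allI impI)
  show "{Z \<in> sets M. indicator Z \<in> FF} \<subseteq> Pow (space M)" using sets.sets_into_space by auto
  show "{} \<in> {Z \<in> sets M. indicator Z \<in> FF}"
    using FF_const[of 0] by (simp add: indicator_def[abs_def])
next
  fix Z assume Z: "Z \<in> {Z \<in> sets M. indicator Z \<in> FF}"
  then have "(\<lambda>\<omega>. 1 - indicator Z \<omega>) \<in> FF" by (intro FF_diff FF_const) simp
  then have "indicator (space M - Z) \<in> FF"
    using Z by (rule_tac FF_cong_AE) (auto intro!: AE_I2 Linf_indicator simp: indicator_def)
  then show "space M - Z \<in> {Z \<in> sets M. indicator Z \<in> FF}" using Z by auto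
next
  fix A :: "nat \<Rightarrow> _" assume A: "range A \<subseteq> {Z \<in> sets M. indicator Z \<in> FF}"
  then have Am: "A i \<in> sets M" and Ai: "indicator (A i) \<in> FF" for i by auto
  have fin: "indicator (\<Union>i<n. A i) \<in> FF" for n
  proof (induction n)
    case 0 show ?case using FF_const[of 0] by (simp add: indicator_def[abs_def])
  next
    case (Suc n)
    then have "(\<lambda>\<omega>. indicator (\<Union>i<n. A i) \<omega> + indicator (A n) \<omega>
        - indicator (\<Union>i<n. A i) \<omega> * indicator (A n) \<omega>) \<in> FF"
      by (intro FF_diff FF_add FF_mult Ai)
    moreover have "(\<lambda>\<omega>. indicator (\<Union>i<n. A i) \<omega> + indicator (A n) \<omega>
        - indicator (\<Union>i<n. A i) \<omega> * indicator (A n) \<omega>) = (indicator (\<Union>i<Suc n. A i) :: 'x \<Rightarrow> complex)"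
      by (auto simp: fun_eq_iff indicator_def lessThan_Suc)
    ultimately show ?case by simp
  qed
  have U: "(\<Union>i. A i) \<in> sets M" using Am by auto
  have "(\<lambda>n. q (indicator (\<Union>i<n. A i))) \<longlonglongrightarrow> q (indicator (\<Union>i. A i))"
  proof (rule q_tendsto[where w = "\<lambda>_. 1"])
    show "AE \<omega> in M. (\<lambda>n. indicator (\<Union>i<n. A i) \<omega>) \<longlonglongrightarrow> (indicator (\<Union>i. A i) \<omega> :: complex)"
      by (intro AE_I2 LIMSEQ_indicator_UN)
    show "AE \<omega> in M. (cmod (indicator (\<Union>i<n. A i) \<omega> - indicator (\<Union>i. A i) \<omega>))\<^sup>2 \<le> 1" for n
      by (auto simp: indicator_def)
  qed (use fin FF_L2 U Linf_L2 Linf_indicator in auto)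
  then have "q (indicator (\<Union>i. A i)) \<in> HF" by (rule HF_limit[rotated]) (rule FF_HF[OF fin])
  then show "(\<Union>i. A i) \<in> {Z \<in> sets M. indicator Z \<in> FF}"
    using U FF_HF_iff by simp
qed

section \<open>Measurability with respect to G against membership in F\<close>

lemma space_G [simp]: "space G = space M"
  by (simp add: G_def space_measure_of_conv)

lemma sets_G: "Z \<in> sets G \<longleftrightarrow> Z \<in> sets M \<and> indicator Z \<in> FF"
proof -
  have "sets G = sigma_sets (space M) {Z \<in> sets M. indicator Z \<in> FF}"
    unfolding G_def using sets.sets_into_space by (intro sets_measure_of) auto
  then show ?thesis using sigma_algebra.sigma_sets_eq[OF sigma_algebra_FF] by simp
qed

lemma sets_G_M: "Z \<in> sets G \<Longrightarrow> Z \<in> sets M"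
  by (simp add: sets_G)

lemma subalgebra_G: "subalgebra M G"
  by (auto simp: subalgebra_def sets_G)

lemma measurable_G_M: "f \<in> borel_measurable G \<Longrightarrow> f \<in> borel_measurable M"
  by (rule measurable_from_subalg[OF subalgebra_G])

text \<open>Induction over nonnegative measurable functions. The bound \<open>c\<close> has to vary,
  since removing a factor \<open>b\<close> changes it to \<open>c / b\<close>. Monotone limits under
  a common bound are L2 limits, hence stay in F.\<close>

lemma FF_measurable_nonneg:
  fixes u :: "'x \<Rightarrow> real"
  assumes "u \<in> borel_measurable G" "\<And>\<omega>. 0 \<le> u \<omega>" "\<And>\<omega>. \<omega> \<in> space M \<Longrightarrow> u \<omega> \<le> c"
  shows "(\<lambda>\<omega>. complex_of_real (u \<omega>)) \<in> FF"
  using assms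
proof (induction arbitrary: c rule: borel_measurable_induct_real)
  case (set A)
  moreover have "(\<lambda>\<omega>. complex_of_real (indicator A \<omega>)) = indicator A" by (auto simp: indicator_def)
  ultimately show ?case by (simp add: sets_G)
next
  case (mult u b)
  show ?case
  proof (cases "b = 0")
    case True then show ?thesis using FF_const[of 0] by simp
  next
    case False
    then have "b > 0" using mult by simp
    with mult.prems have "(\<lambda>\<omega>. complex_of_real (u \<omega>)) \<in> FF"
      by (intro mult.IH[of "c / b"]) (simp add: field_simps)
    then show ?thesis using FF_cmult[of "\<lambda>\<omega>. complex_of_real (u \<omega>)" b] by simp
  qed
next
  case (add u v)
  have le: "u \<omega> \<le> c" "v \<omega> \<le> c" if "\<omega> \<in> space M" for \<omega>
    using add.prems[OF that] add.hyps(2,4)[of \<omega>] by linarith+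
  have "(\<lambda>\<omega>. complex_of_real (v \<omega>) + complex_of_real (u \<omega>)) \<in> FF"
    by (intro FF_add add.IH[of c] le)
  then show ?case by simp
next
  case (seq U)
  have le: "U i \<omega> \<le> u \<omega>" if "\<omega> \<in> space M" for i \<omega>
    using seq.hyps that by (intro incseq_le) (auto simp: incseq_def le_fun_def)
  then have U: "(\<lambda>\<omega>. complex_of_real (U i \<omega>)) \<in> FF" for i
    using seq.prems by (intro seq.IH[of i c]) (meson order_trans)
  have u: "(\<lambda>\<omega>. complex_of_real (u \<omega>)) \<in> Linf"
    using seq.prems assms(2) measurable_G_M[OF assms(1)] by (intro LinfI[of _ c]) simp_all
  have "(\<lambda>i. q (\<lambda>\<omega>. complex_of_real (U i \<omega>))) \<longlonglongrightarrow> q (\<lambda>\<omega>. complex_of_real (u \<omega>))"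
  proof (rule q_tendsto[where w = "\<lambda>_. c\<^sup>2"])
    show "AE \<omega> in M. (\<lambda>i. complex_of_real (U i \<omega>)) \<longlonglongrightarrow> complex_of_real (u \<omega>)"
      using seq.hyps by (intro AE_I2 tendsto_of_real) simp
    show "AE \<omega> in M. (cmod (complex_of_real (U i \<omega>) - complex_of_real (u \<omega>)))\<^sup>2 \<le> c\<^sup>2" for i
    proof (rule AE_I2)
      fix \<omega> assume \<omega>: "\<omega> \<in> space M"
      have "\<bar>U i \<omega> - u \<omega>\<bar> \<le> c" using le[OF \<omega>, of i] seq.hyps(2)[of i \<omega>] seq.prems[of \<omega>] \<omega> by simp
      then show "(cmod (complex_of_real (U i \<omega>) - complex_of_real (u \<omega>)))\<^sup>2 \<le> c\<^sup>2"
        using power_mono[of "\<bar>U i \<omega> - u \<omega>\<bar>" c 2] by (simp flip: of_real_diff)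
    qed
  qed (use U u FF_L2 Linf_L2 in auto)
  then have "q (\<lambda>\<omega>. complex_of_real (u \<omega>)) \<in> HF" by (rule HF_limit[rotated]) (rule FF_HF[OF U])
  then show ?case using FF_HF_iff[OF u] by simp
qed

lemma FF_measurable:
  assumes "f \<in> borel_measurable G" "f \<in> Linf"
  shows "f \<in> FF"
proof -
  obtain c where c: "c > 0" "AE \<omega> in M. cmod (f \<omega>) \<le> c" using Linf_bound[OF assms(2)] .
  \<comment> \<open>The essential bound is made a pointwise one, as the nonnegative case requires;
    only a null set is affected.\<close>
  define g where "g \<omega> = (if cmod (f \<omega>) \<le> c then f \<omega> else 0)" for \<omega>
  have [measurable]: "g \<in> borel_measurable G" unfolding g_def using assms(1) by measurable
  have bound: "cmod (g \<omega>) \<le> c" for \<omega> using c by (simp add: g_def)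
  have *: "(\<lambda>\<omega>. complex_of_real (max 0 (u \<omega>))) \<in> FF"
    if "u \<in> borel_measurable G" "\<And>\<omega>. \<bar>u \<omega>\<bar> \<le> cmod (g \<omega>)" for u
  proof (rule FF_measurable_nonneg[of _ c])
    have "u \<omega> \<le> c" for \<omega> using that(2)[of \<omega>] bound[of \<omega>] by linarith
    then show "max 0 (u \<omega>) \<le> c" for \<omega> using c(1) by simp
  qed (use that in simp_all)
  have "(\<lambda>\<omega>. complex_of_real (max 0 (Re (g \<omega>))) - complex_of_real (max 0 (- Re (g \<omega>)))
      + \<i> * (complex_of_real (max 0 (Im (g \<omega>))) - complex_of_real (max 0 (- Im (g \<omega>))))) \<in> FF"
    by (intro FF_add FF_diff FF_cmult *) (simp_all add: abs_Re_le_cmod abs_Im_le_cmod)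
  moreover have "(\<lambda>\<omega>. complex_of_real (max 0 (Re (g \<omega>))) - complex_of_real (max 0 (- Re (g \<omega>)))
      + \<i> * (complex_of_real (max 0 (Im (g \<omega>))) - complex_of_real (max 0 (- Im (g \<omega>))))) = g"
    by (auto simp: fun_eq_iff complex_eq_iff max_def)
  ultimately have "g \<in> FF" by simp
  moreover have "AE \<omega> in M. g \<omega> = f \<omega>" using c(2) by eventually_elim (simp add: g_def)
  ultimately show ?thesis using FF_cong_AE assms(2) by blast
qed

section \<open>Functional calculus, level sets, and H_F as the space L2(G)\<close>

lemma FF_polynomial:
  assumes "real_polynomial_function p" "(\<lambda>\<omega>. complex_of_real (u \<omega>)) \<in> FF"
  shows "(\<lambda>\<omega>. complex_of_real (p (u \<omega>))) \<in> FF"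
  using assms(1)
proof induction
  case (linear f)
  then obtain a where "f = (\<lambda>t. t * a)" by (auto simp: real_bounded_linear)
  then show ?case using FF_mult[OF assms(2) FF_const[of a]] by simp
next
  case (const c) show ?case by (rule FF_const)
next
  case (add f g) show ?case using FF_add[OF add.IH] by simp
next
  case (mult f g) show ?case using FF_mult[OF mult.IH] by simp
qed

text \<open>By Weierstrass the ramp is a uniform limit of polynomials on \<open>{-b..b}\<close>,
  which contains almost all values of \<open>u\<close>. Polynomials in \<open>u\<close> lie in the
  algebra F, and uniform limits are L2 limits.\<close>

lemma FF_ramp:
  assumes u: "(\<lambda>\<omega>. complex_of_real (u \<omega>)) \<in> FF"
  shows "(\<lambda>\<omega>. complex_of_real (ramp c n (u \<omega>))) \<in> FF"
proof -
  have [measurable]: "u \<in> borel_measurable M"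
    using measurable_compose[OF Linf_measurable[OF FF_Linf[OF u]] borel_measurable_Re] by simp
  obtain b where b: "AE \<omega> in M. \<bar>u \<omega>\<bar> \<le> b" using Linf_bound[OF FF_Linf[OF u]] by auto
  have "\<exists>p. real_polynomial_function p \<and> (\<forall>t\<in>{-b..b}. \<bar>ramp c n t - p t\<bar> < 1 / Suc k)" for k
  proof -
    have "continuous_on {-b..b} (ramp c n)"
      using continuous_ramp continuous_on_subset by blast
    then show ?thesis
      using Stone_Weierstrass_real_polynomial_function[of "{-b..b}" "ramp c n" "1 / Suc k"]
      by (metis compact_Icc of_nat_0_less_iff zero_less_Suc zero_less_divide_1_iff)
  qed
  then obtain p where p: "\<And>k. real_polynomial_function (p k)"
      "\<And>k t. t \<in> {-b..b} \<Longrightarrow> \<bar>ramp c n t - p k t\<bar> < 1 / Suc k"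
    by metis
  have near: "AE \<omega> in M. \<forall>k. \<bar>p k (u \<omega>) - ramp c n (u \<omega>)\<bar> \<le> 1 / Suc k"
    using b
  proof eventually_elim
    case (elim \<omega>)
    then have "u \<omega> \<in> {-b..b}" by (simp add: abs_le_iff)
    from p(2)[OF this] show ?case by (auto simp: abs_minus_commute[of "ramp c n (u \<omega>)"] intro: less_imp_le)
  qed
  note pFF = FF_polynomial[OF p(1) u]
  have r: "(\<lambda>\<omega>. complex_of_real (ramp c n (u \<omega>))) \<in> Linf"
    by (rule LinfI[of _ 1]) (simp_all add: ramp_bounds)
  have "(\<lambda>k. q (\<lambda>\<omega>. complex_of_real (p k (u \<omega>)))) \<longlonglongrightarrow> q (\<lambda>\<omega>. complex_of_real (ramp c n (u \<omega>)))"
  proof (rule q_tendsto[where w = "\<lambda>_. 1"])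
    show "AE \<omega> in M. (cmod (complex_of_real (p k (u \<omega>)) - complex_of_real (ramp c n (u \<omega>))))\<^sup>2 \<le> 1" for k
      using near
    proof eventually_elim
      case (elim \<omega>)
      then have "\<bar>p k (u \<omega>) - ramp c n (u \<omega>)\<bar> \<le> 1 / Suc k" ..
      also have "\<dots> \<le> 1" by simp
      finally show ?case by (simp add: abs_square_le_1 flip: of_real_diff)
    qed
    show "AE \<omega> in M. (\<lambda>k. complex_of_real (p k (u \<omega>))) \<longlonglongrightarrow> complex_of_real (ramp c n (u \<omega>))"
      using near
    proof eventually_elim
      case (elim \<omega>)
      then have "\<forall>\<^sub>F k in sequentially. norm (p k (u \<omega>) - ramp c n (u \<omega>)) \<le> 1 / Suc k"
        by (intro always_eventually allI) simp
      then have "(\<lambda>k. p k (u \<omega>) - ramp c n (u \<omega>)) \<longlonglongrightarrow> 0"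
        by (rule Lim_null_comparison) (rule LIMSEQ_Suc[OF lim_1_over_n])
      then show ?case by (intro tendsto_of_real) (rule LIM_zero_cancel)
    qed
  qed (use pFF r FF_L2 Linf_L2 in auto)
  then have "q (\<lambda>\<omega>. complex_of_real (ramp c n (u \<omega>))) \<in> HF"
    by (rule HF_limit[rotated]) (rule FF_HF[OF pFF])
  then show ?thesis using FF_HF_iff[OF r] by simp
qed

text \<open>The Lipschitz bound puts every ramp of \<open>u\<close> into \<open>HF\<close>. As the
  slope grows the ramps tend to the indicator of the level set, and for a bounded function
  membership in \<open>HF\<close> already means membership in F.\<close>

lemma HF_level_set:
  assumes u [measurable]: "u \<in> borel_measurable M"
    and uL: "(\<lambda>\<omega>. complex_of_real (u \<omega>)) \<in> L2" "q (\<lambda>\<omega>. complex_of_real (u \<omega>)) \<in> HF"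
  shows "{\<omega> \<in> space M. c < u \<omega>} \<in> sets G"
proof -
  obtain a where a: "\<And>k. a k \<in> FF" "(\<lambda>k. q (a k)) \<longlonglongrightarrow> q (\<lambda>\<omega>. complex_of_real (u \<omega>))"
    using uL(2) by (rule HF_cases) (rule that)
  have Re_a: "(\<lambda>\<omega>. complex_of_real (Re (a k \<omega>))) \<in> FF" for k
  proof -
    have "(\<lambda>\<omega>. (1/2) * (a k \<omega> + cnj (a k \<omega>))) \<in> FF"
      by (intro FF_cmult FF_add FF_cnj a(1))
    then show ?thesis by (simp add: complex_add_cnj)
  qed
  have r: "(\<lambda>\<omega>. complex_of_real (ramp c n (u \<omega>))) \<in> Linf" for n
    by (rule LinfI[of _ 1]) (simp_all add: ramp_bounds)
  have rHF: "q (\<lambda>\<omega>. complex_of_real (ramp c n (u \<omega>))) \<in> HF" for n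
  proof -
    have "(\<lambda>k. q (\<lambda>\<omega>. complex_of_real (ramp c n (Re (a k \<omega>)))))
        \<longlonglongrightarrow> q (\<lambda>\<omega>. complex_of_real (ramp c n (u \<omega>)))"
    proof (rule q_tendsto_Lipschitz[OF _ _ a(2), where L = "real n"])
      fix k \<omega>
      have "\<bar>ramp c n (Re (a k \<omega>)) - ramp c n (u \<omega>)\<bar> \<le> real n * \<bar>Re (a k \<omega> - complex_of_real (u \<omega>))\<bar>"
        using ramp_Lipschitz by simp
      also have "\<dots> \<le> real n * cmod (a k \<omega> - complex_of_real (u \<omega>))"
        by (intro mult_left_mono abs_Re_le_cmod) simp
      finally show "cmod (complex_of_real (ramp c n (Re (a k \<omega>))) - complex_of_real (ramp c n (u \<omega>)))
          \<le> real n * cmod (a k \<omega> - complex_of_real (u \<omega>))"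
        by (simp flip: of_real_diff)
    qed (use a(1) uL r FF_ramp[OF Re_a] FF_L2 Linf_L2 in auto)
    then show ?thesis by (rule HF_limit[rotated]) (rule FF_HF[OF FF_ramp[OF Re_a]])
  qed
  define Z where "Z = {\<omega> \<in> space M. c < u \<omega>}"
  have Z: "Z \<in> sets M" unfolding Z_def by measurable
  have "(\<lambda>n. q (\<lambda>\<omega>. complex_of_real (ramp c n (u \<omega>)))) \<longlonglongrightarrow> q (indicator Z)"
  proof (rule q_tendsto[where w = "\<lambda>_. 1"])
    show "AE \<omega> in M. (cmod (complex_of_real (ramp c n (u \<omega>)) - indicator Z \<omega>))\<^sup>2 \<le> 1" for n
    proof (rule AE_I2)
      fix \<omega>
      have "\<bar>ramp c n (u \<omega>) - indicator Z \<omega>\<bar> \<le> 1"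
        using ramp_bounds[of c n "u \<omega>"] by (auto simp: indicator_def)
      moreover have "complex_of_real (ramp c n (u \<omega>)) - indicator Z \<omega>
          = complex_of_real (ramp c n (u \<omega>) - indicator Z \<omega>)"
        by (simp add: indicator_def)
      ultimately show "(cmod (complex_of_real (ramp c n (u \<omega>)) - indicator Z \<omega>))\<^sup>2 \<le> 1"
        by (simp only: norm_of_real power_le_one abs_ge_zero)
    qed
    show "AE \<omega> in M. (\<lambda>n. complex_of_real (ramp c n (u \<omega>))) \<longlonglongrightarrow> indicator Z \<omega>"
    proof (rule AE_I2)
      fix \<omega> assume "\<omega> \<in> space M"
      then have "indicator Z \<omega> = complex_of_real (indicator {c<..} (u \<omega>))"
        by (auto simp: Z_def indicator_def)
      moreover have "(\<lambda>n. complex_of_real (ramp c n (u \<omega>))) \<longlonglongrightarrow> complex_of_real (indicator {c<..} (u \<omega>))"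
        by (intro tendsto_of_real ramp_tendsto)
      ultimately show "(\<lambda>n. complex_of_real (ramp c n (u \<omega>))) \<longlonglongrightarrow> indicator Z \<omega>"
        by simp
    qed
  qed (use r Z Linf_L2 in auto)
  then have "q (indicator Z) \<in> HF" by (rule HF_limit[rotated]) (rule rHF)
  then show ?thesis using Z FF_HF_iff by (simp add: sets_G Z_def)
qed

text \<open>Level sets of the real and imaginary parts give one direction, truncations lying in F
  the other. The statement is valid for every representative because \<open>G\<close> contains the
  null sets of \<open>M\<close>.\<close>

lemma HF_iff:
  assumes f: "f \<in> L2"
  shows "q f \<in> HF \<longleftrightarrow> f \<in> borel_measurable G"
proof
  assume qf: "q f \<in> HF"
  have HF: "x + y \<in> HF" if "x \<in> HF" "y \<in> HF" for x y
    using closed_csubspace_HF that by (auto simp: closed_csubspace_def csubspace_def)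
  have HF': "c *\<^sub>C x \<in> HF" if "x \<in> HF" for x c
    using closed_csubspace_HF that by (auto simp: closed_csubspace_def csubspace_def)
  have cnj: "q (\<lambda>\<omega>. cnj (f \<omega>)) \<in> HF"
  proof -
    obtain a where a: "\<And>n. a n \<in> FF" "(\<lambda>n. q (a n)) \<longlonglongrightarrow> q f"
      using qf by (rule HF_cases) (rule that)
    have "(\<lambda>n. q (\<lambda>\<omega>. cnj (a n \<omega>))) \<longlonglongrightarrow> q (\<lambda>\<omega>. cnj (f \<omega>))"
      by (rule q_tendsto_Lipschitz[OF _ _ a(2), where L = 1])
        (simp_all add: FF_L2 a f L2_cnj flip: complex_cnj_diff)
    then show ?thesis by (rule HF_limit[rotated]) (rule FF_HF[OF FF_cnj[OF a(1)]])
  qed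
  have re: "(\<lambda>\<omega>. complex_of_real (Re (f \<omega>))) = (\<lambda>\<omega>. (1/2) * (f \<omega> + cnj (f \<omega>)))"
    by (simp add: complex_add_cnj)
  have im: "(\<lambda>\<omega>. complex_of_real (Im (f \<omega>))) = (\<lambda>\<omega>. (-\<i>/2) * (f \<omega> + (-1) * cnj (f \<omega>)))"
    by (auto simp: fun_eq_iff complex_eq_iff)
  have [measurable]: "f \<in> borel_measurable M" using f by (rule L2_measurable)
  have "(\<lambda>\<omega>. Re (f \<omega>)) \<in> borel_measurable G"
    unfolding borel_measurable_iff_greater space_G
  proof (intro allI HF_level_set)
    show "(\<lambda>\<omega>. complex_of_real (Re (f \<omega>))) \<in> L2"
      unfolding re by (intro L2_cmult L2_add L2_cnj f)
    show "q (\<lambda>\<omega>. complex_of_real (Re (f \<omega>))) \<in> HF"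
      unfolding re q_cmult[OF L2_add[OF f L2_cnj[OF f]]] q_add[OF f L2_cnj[OF f]]
      by (intro HF HF' qf cnj)
  qed simp
  moreover have "(\<lambda>\<omega>. Im (f \<omega>)) \<in> borel_measurable G"
    unfolding borel_measurable_iff_greater space_G
  proof (intro allI HF_level_set)
    show "(\<lambda>\<omega>. complex_of_real (Im (f \<omega>))) \<in> L2"
      unfolding im by (intro L2_cmult L2_add L2_cnj f)
    show "q (\<lambda>\<omega>. complex_of_real (Im (f \<omega>))) \<in> HF"
      unfolding im q_cmult[OF L2_add[OF f L2_cmult[OF L2_cnj[OF f]]]]
        q_add[OF f L2_cmult[OF L2_cnj[OF f]]] q_cmult[OF L2_cnj[OF f]]
      by (intro HF HF' qf cnj)
  qed simp
  ultimately show "f \<in> borel_measurable G"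
    by (simp add: borel_measurable_complex_iff)
next
  assume meas: "f \<in> borel_measurable G"
  obtain a where a: "\<And>n. a n \<in> Linf" "(\<lambda>n. q (a n)) \<longlonglongrightarrow> q f" "\<And>n. a n \<in> borel_measurable G"
    by (rule Linf_dense[OF f]) (use meas that in blast)
  from a(2) show "q f \<in> HF" by (rule HF_limit[rotated]) (intro FF_HF FF_measurable a)
qed

lemma FF_iff_measurable: "f \<in> FF \<longleftrightarrow> f \<in> Linf \<and> f \<in> borel_measurable G"
  using FF_HF_iff HF_iff FF_Linf Linf_L2 by metis

text \<open>The commutant of \<open>A\<close> and \<open>e\<^sub>F\<close> consists of elements of \<open>F\<close>, so the basic construction contains
  the commutant of \<open>F\<close>.\<close>

lemma commutant_in_basic_construction:
  assumes S: "S \<in> bounded_ops"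
    and comm: "\<And>f x. f \<in> FF \<Longrightarrow> S (mult_op M q f x) = mult_op M q f (S x)"
  shows "S \<in> vn_generated (insert (orth_proj HF) (mult_op M q ` Linf))"
  unfolding vn_generated_def hull_def
proof (intro InterI, clarify)
  fix t assume t: "von_neumann_algebra t" "insert (orth_proj HF) (mult_op M q ` Linf) \<subseteq> t"
  have "S \<circ> R = R \<circ> S" if R: "R \<in> commutant t" for R
  proof -
    have R': "R \<in> bounded_ops" "\<And>a x. a \<in> t \<Longrightarrow> R (a x) = a (R x)"
      using R by (auto simp: commutant_def fun_eq_iff)
    have "bounded_linear R" using R'(1) by (simp add: bounded_ops_def)
    then obtain g where g: "g \<in> Linf" "R = mult_op M q g"
      by (rule commutant_mult_op[of R]) (use R'(2) t(2) in auto)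
    \<comment> \<open>\<open>R\<close> commutes with the projection onto \<open>HF\<close>, which
      fixes 1; hence \<open>q g\<close>, the image of 1 under \<open>R\<close>, lies in
      \<open>HF\<close>, and the bounded symbol \<open>g\<close> lies in F.\<close>
    have "orth_proj HF (q (\<lambda>_. 1)) = q (\<lambda>_. 1)"
      by (rule orth_proj_fix[OF closed_csubspace_HF FF_HF[OF FF_const]])
    then have "q g = orth_proj HF (q g)"
      using R'(2)[of "orth_proj HF" "q (\<lambda>_. 1)"] t(2) g by (simp add: mult_op_one)
    then have "g \<in> FF"
      using FF_HF_iff[OF g(1)] orth_proj_in[OF closed_csubspace_HF] by metis
    then show ?thesis by (auto simp: g(2) comm)
  qed
  then have "S \<in> commutant (commutant t)" using S by (auto simp: commutant_def[of "commutant t"])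
  then show "S \<in> t" using t(1) by (simp add: von_neumann_algebra_def)
qed

section \<open>Modules over the subalgebra\<close>

definition fmod :: "'h set \<Rightarrow> bool"
  where "fmod V \<longleftrightarrow> closed_csubspace V \<and> (\<forall>f\<in>FF. \<forall>x\<in>V. mult_op M q f x \<in> V)"

text \<open>Taken as a hull so that inclusions follow from minimality;
  \<open>fspan_eq_closure\<close> matches it with the closure of the finite F-combinations.\<close>

definition fspan :: "'h set \<Rightarrow> 'h set"
  where "fspan X = fmod hull X"

lemma fmodI:
  "closed_csubspace V \<Longrightarrow> (\<And>f x. f \<in> FF \<Longrightarrow> x \<in> V \<Longrightarrow> mult_op M q f x \<in> V) \<Longrightarrow> fmod V"
  by (simp add: fmod_def)

lemma fmod_closed_csubspace: "fmod V \<Longrightarrow> closed_csubspace V"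
  and fmod_csubspace: "fmod V \<Longrightarrow> csubspace V"
  and fmod_closed: "fmod V \<Longrightarrow> closed V"
  and fmod_mult: "fmod V \<Longrightarrow> f \<in> FF \<Longrightarrow> x \<in> V \<Longrightarrow> mult_op M q f x \<in> V"
  by (simp_all add: fmod_def closed_csubspace_def)

lemma chi_FF: "Z \<in> sets G \<Longrightarrow> indicator Z \<in> FF"
  by (simp add: sets_G)

lemma fmod_chi: "fmod V \<Longrightarrow> Z \<in> sets G \<Longrightarrow> x \<in> V \<Longrightarrow> chi Z x \<in> V"
  unfolding chi_def by (intro fmod_mult chi_FF)

lemma fmod_limit: "fmod V \<Longrightarrow> (\<And>n. x n \<in> V) \<Longrightarrow> x \<longlonglongrightarrow> y \<Longrightarrow> y \<in> V"
  using closed_sequentially[of V x y] by (simp add: fmod_closed)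

lemma fmod_Int: "fmod V \<Longrightarrow> fmod W \<Longrightarrow> fmod (V \<inter> W)"
  by (auto simp: fmod_def closed_csubspace_Int)

lemma fmod_Inter: "(\<And>V. V \<in> \<V> \<Longrightarrow> fmod V) \<Longrightarrow> fmod (\<Inter>\<V>)"
  by (auto simp: fmod_def closed_csubspace_Inter)

lemma fmod_orth_compl:
  assumes V: "fmod V" shows "fmod (orth_compl V)"
proof (rule fmodI[OF closed_csubspace_orth_compl])
  fix f x assume f: "f \<in> FF" and x: "x \<in> orth_compl V"
  have "cinner y (mult_op M q f x) = 0" if "y \<in> V" for y
    using cinner_mult_op[OF FF_Linf[OF FF_cnj[OF f]], of y x]
      orth_compl_cinner[OF x fmod_mult[OF V FF_cnj[OF f] that]] by simp
  then show "mult_op M q f x \<in> orth_compl V" by (simp add: orth_compl_def)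
qed

lemma fmod_fspan: "fmod (fspan X)"
  unfolding fspan_def by (rule hull_in) (auto intro: fmod_Inter)

lemma fspan_superset: "X \<subseteq> fspan X"
  unfolding fspan_def by (rule hull_subset)

lemma fspan_minimal: "X \<subseteq> V \<Longrightarrow> fmod V \<Longrightarrow> fspan X \<subseteq> V"
  unfolding fspan_def by (rule hull_minimal)

lemma fspan_mono: "X \<subseteq> Y \<Longrightarrow> fspan X \<subseteq> fspan Y"
  unfolding fspan_def by (rule hull_mono)

text \<open>\<open>S\<close> may change the coefficient from \<open>f\<close> to some
  \<open>g\<close>. This twist is what the Koopman operator needs, which replaces \<open>f\<close>
  by its composition with \<open>T\<close>.\<close>

lemma fmod_preimage:
  assumes V: "fmod V" and S: "S \<in> bounded_ops"
    and comm: "\<And>f. f \<in> FF \<Longrightarrow> \<exists>g\<in>FF. \<forall>x. S (mult_op M q f x) = mult_op M q g (S x)"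
  shows "fmod {x. S x \<in> V}"
proof (rule fmodI[OF closed_csubspace_preimage[OF fmod_closed_csubspace[OF V] S]])
  fix f x assume f: "f \<in> FF" and x: "x \<in> {x. S x \<in> V}"
  obtain g where "g \<in> FF" "\<forall>x. S (mult_op M q f x) = mult_op M q g (S x)" using comm[OF f] by auto
  then show "mult_op M q f x \<in> {x. S x \<in> V}" using x fmod_mult[OF V] by simp
qed

lemma fmod_preimage_chi: "fmod V \<Longrightarrow> Z \<in> sets G \<Longrightarrow> fmod {x. chi Z x \<in> V}"
  by (rule fmod_preimage) (auto simp: chi_bounded_ops sets_G_M chi_mult_op FF_Linf)

lemma fmod_eq_chi:
  assumes V: "fmod V" and Z: "Z \<in> sets G"
  shows "fmod {x \<in> V. chi Z x = x}"
proof (rule fmodI)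
  have "closed {x. chi Z x = x}"
    by (intro closed_Collect_eq continuous_on_id linear_continuous_on bounded_linear_chi sets_G_M Z)
  then have "closed_csubspace {x. chi Z x = x}"
    by (simp add: closed_csubspace_def csubspace_def chi_simps sets_G_M Z)
  then show "closed_csubspace {x \<in> V. chi Z x = x}"
    using closed_csubspace_Int[OF fmod_closed_csubspace[OF V], of "{x. chi Z x = x}"]
    by (simp add: Int_def)
qed (use V Z in \<open>auto simp: chi_mult_op sets_G_M FF_Linf intro: fmod_mult\<close>)

lemma orth_proj_fmod_commute:
  assumes "fmod V" "f \<in> FF"
  shows "orth_proj V (mult_op M q f x) = mult_op M q f (orth_proj V x)"
proof -
  have "mult_op M q f (orth_proj V x) = orth_proj V (mult_op M q f x)"
  proof (rule orth_proj_commute[OF fmod_closed_csubspace[OF assms(1)], where R = "mult_op M q (\<lambda>\<omega>. cnj (f \<omega>))"])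
    show "cinner (mult_op M q (\<lambda>\<omega>. cnj (f \<omega>)) x) y = cinner x (mult_op M q f y)" for x y
      using cinner_mult_op[OF FF_Linf[OF FF_cnj[OF assms(2)]]] by simp
  qed (use assms in \<open>auto intro!: fmod_mult FF_cnj mult_op_bounded_ops FF_Linf\<close>)
  then show ?thesis by simp
qed

lemma fmod_HF: "fmod HF"
proof (rule fmodI[OF closed_csubspace_HF])
  fix f x assume f: "f \<in> FF" and x: "x \<in> HF"
  obtain g where g: "g \<in> L2" "x = q g" by (rule q_cases)
  then have "g \<in> borel_measurable G" using x HF_iff by simp
  moreover have "f \<in> borel_measurable G" using f by (simp add: FF_iff_measurable)
  ultimately show "mult_op M q f x \<in> HF"
    using g f by (simp add: mult_op_q FF_Linf HF_iff Linf_mult_L2)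
qed

text \<open>Shows that 1_Z e_F is itself a projection, hence positive. These are the projections
  whose weight the canonical formula gives directly.\<close>

lemma orth_proj_chi_HF:
  assumes Z: "Z \<in> sets G"
  shows "orth_proj {y \<in> HF. chi Z y = y} = (\<lambda>y. chi Z (orth_proj HF y))"
proof
  note ZM = sets_G_M[OF Z]
  fix y
  show "orth_proj {y \<in> HF. chi Z y = y} y = chi Z (orth_proj HF y)"
  proof (rule orth_proj_eqI[OF fmod_closed_csubspace[OF fmod_eq_chi[OF fmod_HF Z]]])
    show "chi Z (orth_proj HF y) \<in> {y \<in> HF. chi Z y = y}"
      using fmod_chi[OF fmod_HF Z orth_proj_in[OF closed_csubspace_HF]] by (simp add: chi_chi ZM)
    have "cinner z (y - chi Z (orth_proj HF y)) = 0" if z: "z \<in> HF" "chi Z z = z" for z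
    proof -
      have "cinner z (chi Z (orth_proj HF y)) = cinner (chi Z z) (orth_proj HF y)"
        by (simp add: cinner_chi ZM)
      also have "\<dots> = cinner (orth_proj HF z) y"
        using z cinner_orth_proj[OF closed_csubspace_HF, of z y] by simp
      also have "\<dots> = cinner z y"
        using z by (simp add: orth_proj_fix[OF closed_csubspace_HF])
      finally show ?thesis by (simp add: cinner_diff_right)
    qed
    then show "y - chi Z (orth_proj HF y) \<in> orth_compl {y \<in> HF. chi Z y = y}"
      by (simp add: orth_compl_def)
  qed
qed

abbreviation BC :: "('h \<Rightarrow> 'h) set"
  where "BC \<equiv> vn_generated (insert (orth_proj HF) (mult_op M q ` Linf))"

lemma orth_proj_BC: "fmod V \<Longrightarrow> orth_proj V \<in> positive_part BC"
  unfolding positive_part_def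
  by (auto intro!: positive_orth_proj commutant_in_basic_construction orth_proj_bounded_ops
      orth_proj_fmod_commute fmod_closed_csubspace)

lemma fmod_orth_sum:
  assumes "fmod V" "fmod W" "W \<subseteq> orth_compl V"
  shows "fmod {x + y | x y. x \<in> V \<and> y \<in> W}"
proof (rule fmodI[OF orth_proj_orth_sum(1)[OF fmod_closed_csubspace[OF assms(1)] fmod_closed_csubspace[OF assms(2)] assms(3)]])
  fix f x assume f: "f \<in> FF" and "x \<in> {x + y | x y. x \<in> V \<and> y \<in> W}"
  then obtain y z where x: "x = y + z" "y \<in> V" "z \<in> W" by auto
  have "mult_op M q f x = mult_op M q f y + mult_op M q f z"
    unfolding x(1) using mult_op_bounded_ops[OF FF_Linf[OF f]] by (simp add: bounded_ops_def linear_simps)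
  then show "mult_op M q f x \<in> {x + y | x y. x \<in> V \<and> y \<in> W}"
    using fmod_mult[OF assms(1) f x(2)] fmod_mult[OF assms(2) f x(3)] by auto
qed

subsection \<open>Cyclic modules\<close>

lemma G_finite_measure_subalgebra: "finite_measure_subalgebra M G"
  by unfold_locales (rule subalgebra_G)

text \<open>The square root of the conditional expectation of |f|^2 on \<open>G\<close>. The
  conditional expectation is the one with values in [0, \<infinity>]; for square-integrable
  \<open>f\<close> it is finite almost everywhere, so the value 0 that \<open>enn2real\<close>
  assigns to \<infinity> matters only on a null set.\<close>

definition cond_norm :: "('x \<Rightarrow> complex) \<Rightarrow> 'x \<Rightarrow> real"
  where "cond_norm f \<omega> = sqrt (enn2real (nn_cond_exp M G (\<lambda>\<omega>. ennreal ((cmod (f \<omega>))\<^sup>2)) \<omega>))"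

lemma cond_norm_measurable [measurable]: "cond_norm f \<in> borel_measurable G"
  unfolding cond_norm_def by measurable

lemma cond_norm_nonneg: "0 \<le> cond_norm f \<omega>"
  by (simp add: cond_norm_def)

lemma L2_nn_integral: "f \<in> L2 \<Longrightarrow>
    (\<integral>\<^sup>+\<omega>. ennreal ((cmod (f \<omega>))\<^sup>2) \<partial>M) = ennreal ((norm (q f))\<^sup>2)"
  by (simp add: norm_q nn_integral_eq_integral L2_integrable)

lemma L2I_nn_integral:
  assumes [measurable]: "f \<in> borel_measurable M" and "(\<integral>\<^sup>+\<omega>. ennreal ((cmod (f \<omega>))\<^sup>2) \<partial>M) < \<infinity>"
  shows "f \<in> L2"
  unfolding L2_functions_def using assms by (auto intro!: integrableI_nonneg)

lemma nn_integral_cond_norm: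
  assumes f: "f \<in> L2" and [measurable]: "h \<in> borel_measurable G"
  shows "(\<integral>\<^sup>+\<omega>. h \<omega> * ennreal ((cond_norm f \<omega>)\<^sup>2) \<partial>M) = (\<integral>\<^sup>+\<omega>. h \<omega> * ennreal ((cmod (f \<omega>))\<^sup>2) \<partial>M)"
proof -
  interpret S: finite_measure_subalgebra M G by (rule G_finite_measure_subalgebra)
  define D where "D = nn_cond_exp M G (\<lambda>\<omega>. ennreal ((cmod (f \<omega>))\<^sup>2))"
  note [measurable] = L2_measurable[OF f]
  have D: "(\<integral>\<^sup>+\<omega>. g \<omega> * D \<omega> \<partial>M) = (\<integral>\<^sup>+\<omega>. g \<omega> * ennreal ((cmod (f \<omega>))\<^sup>2) \<partial>M)"
    if "g \<in> borel_measurable G" for g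
    unfolding D_def by (rule S.nn_cond_exp_intg[OF that]) measurable
  have "(\<integral>\<^sup>+\<omega>. D \<omega> \<partial>M) = ennreal ((norm (q f))\<^sup>2)"
    using D[of "\<lambda>_. 1"] L2_nn_integral[OF f] by simp
  then have "AE \<omega> in M. D \<omega> \<noteq> \<infinity>"
    unfolding D_def by (intro nn_integral_noteq_infinite) auto
  then have "AE \<omega> in M. ennreal ((cond_norm f \<omega>)\<^sup>2) = D \<omega>"
    by eventually_elim (simp add: cond_norm_def D_def less_top)
  then have "(\<integral>\<^sup>+\<omega>. h \<omega> * ennreal ((cond_norm f \<omega>)\<^sup>2) \<partial>M) = (\<integral>\<^sup>+\<omega>. h \<omega> * D \<omega> \<partial>M)"
    by (intro nn_integral_cong_AE) (auto elim: eventually_mono)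
  then show ?thesis by (simp add: D)
qed

text \<open>A coefficient from \<open>G\<close> may be unbounded as long as the product is
  square-integrable: its truncations lie in F, and the truncated products are dominated by the full
  one.\<close>

lemma q_in_fspan:
  assumes f: "f \<in> L2" and h [measurable]: "h \<in> borel_measurable G"
    and hf: "(\<lambda>\<omega>. h \<omega> * f \<omega>) \<in> L2"
  shows "q (\<lambda>\<omega>. h \<omega> * f \<omega>) \<in> fspan {q f}"
proof -
  define t where "t n \<omega> = (if cmod (h \<omega>) \<le> real n then h \<omega> else 0)" for n \<omega>
  have tG [measurable]: "t n \<in> borel_measurable G" for n unfolding t_def by measurable
  then have tF: "t n \<in> FF" for n
    unfolding FF_iff_measurable
    by (intro conjI LinfI[of _ "real n"] measurable_G_M[OF tG]) (simp_all add: t_def)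
  have "(\<lambda>n. q (\<lambda>\<omega>. t n \<omega> * f \<omega>)) \<longlonglongrightarrow> q (\<lambda>\<omega>. h \<omega> * f \<omega>)"
  proof (rule q_tendsto[OF Linf_mult_L2[OF FF_Linf[OF tF] f] hf L2_integrable[OF hf]])
    show "AE \<omega> in M. (cmod (t n \<omega> * f \<omega> - h \<omega> * f \<omega>))\<^sup>2 \<le> (cmod (h \<omega> * f \<omega>))\<^sup>2" for n
      by (auto simp: t_def)
    show "AE \<omega> in M. (\<lambda>n. t n \<omega> * f \<omega>) \<longlonglongrightarrow> h \<omega> * f \<omega>"
    proof (intro AE_I2 tendsto_mult tendsto_const)
      fix \<omega>
      obtain K where "cmod (h \<omega>) \<le> real K" using real_arch_simple by blast
      then have "\<forall>\<^sub>F n in sequentially. t n \<omega> = h \<omega>"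
        unfolding eventually_sequentially t_def by (intro exI[of _ K]) auto
      then show "(\<lambda>n. t n \<omega>) \<longlonglongrightarrow> h \<omega>" by (rule tendsto_eventually)
    qed
  qed
  then show ?thesis
  proof (rule fmod_limit[OF fmod_fspan, rotated])
    show "q (\<lambda>\<omega>. t n \<omega> * f \<omega>) \<in> fspan {q f}" for n
      using fmod_mult[OF fmod_fspan tF, of "q f" "{q f}" n] fspan_superset[of "{q f}"] FF_Linf[OF tF] f
      by (simp add: mult_op_q)
  qed
qed

text \<open>With \<open>s\<close> the square root of the conditional expectation of \<open>\<bar>x\<bar>\<^sup>2\<close> on \<open>F\<close> and \<open>Z\<close> its support,
  multiplication by \<open>x / s\<close> is a partial isometry from \<open>1\<^sub>Z H\<^sub>F\<close> onto the cyclic module of \<open>x\<close>. It commutes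
  with \<open>F\<close>, hence lies in the basic construction, although \<open>x / s\<close> may be unbounded.\<close>

lemma cyclic_module:
  obtains Z v where "Z \<in> sets G" "v \<in> BC" "adj v \<circ> v = (\<lambda>y. chi Z (orth_proj HF y))"
    "v \<circ> adj v = orth_proj (fspan {x})" "chi Z x = x"
    "\<And>Y. Y \<in> sets G \<Longrightarrow> Y \<subseteq> Z \<Longrightarrow> chi Y x = 0 \<Longrightarrow> prob Y = 0"
proof -
  obtain f where f: "f \<in> L2" "x = q f" by (rule q_cases)
  note [measurable] = L2_measurable[OF f(1)]
  define s where "s = cond_norm f"
  have s [measurable]: "s \<in> borel_measurable G" and s0: "0 \<le> s \<omega>" for \<omega>
    by (simp_all add: s_def cond_norm_nonneg)
  have sM [measurable]: "s \<in> borel_measurable M"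
    by (rule measurable_from_subalg[OF subalgebra_G s])
  \<comment> \<open>The defining property of the conditional expectation, for weights
    \<open>h\<close> with values in [0, \<infinity>], so that no integrability has to be verified
    for the quotients by \<open>s\<close>.\<close>
  have int: "(\<integral>\<^sup>+\<omega>. h \<omega> * ennreal ((s \<omega>)\<^sup>2) \<partial>M) = (\<integral>\<^sup>+\<omega>. h \<omega> * ennreal ((cmod (f \<omega>))\<^sup>2) \<partial>M)"
    if "h \<in> borel_measurable G" for h
    unfolding s_def by (rule nn_integral_cond_norm[OF f(1) that])
  define Z where "Z = {\<omega> \<in> space M. s \<omega> \<noteq> 0}"
  have "{\<omega> \<in> space G. s \<omega> \<noteq> 0} \<in> sets G" by measurable
  then have Z: "Z \<in> sets G" by (simp add: Z_def)
  note ZM [measurable] = sets_G_M[OF Z]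
  have null: "AE \<omega> in M. \<omega> \<in> Y \<longrightarrow> f \<omega> = 0" if Y: "Y \<in> sets G" "\<And>\<omega>. \<omega> \<in> Y \<Longrightarrow> s \<omega> = 0" for Y
  proof -
    have [measurable]: "Y \<in> sets M" using Y(1) by (rule sets_G_M)
    have "(\<integral>\<^sup>+\<omega>. indicator Y \<omega> * ennreal ((cmod (f \<omega>))\<^sup>2) \<partial>M) = (\<integral>\<^sup>+\<omega>. indicator Y \<omega> * ennreal ((s \<omega>)\<^sup>2) \<partial>M)"
      by (rule int[symmetric]) (use Y(1) in measurable)
    also have "\<dots> = 0"
      using Y(2) by (subst nn_integral_0_iff_AE) (auto simp: indicator_def)
    finally have "AE \<omega> in M. indicator Y \<omega> * ennreal ((cmod (f \<omega>))\<^sup>2) = 0"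
      by (subst (asm) nn_integral_0_iff_AE) auto
    then show ?thesis by eventually_elim (auto simp: indicator_def)
  qed
  have "space G - Z \<in> sets G" using Z by (rule sets.compl_sets)
  then have "AE \<omega> in M. \<omega> \<in> space G - Z \<longrightarrow> f \<omega> = 0"
    by (rule null) (simp add: Z_def)
  \<comment> \<open>Dividing by \<open>s\<close> loses nothing: where \<open>s\<close> vanishes,
    \<open>f\<close> does too, almost everywhere.\<close>
  then have f0: "AE \<omega> in M. s \<omega> = 0 \<longrightarrow> f \<omega> = 0"
    using AE_space by eventually_elim (auto simp: Z_def)
  have chix: "chi Z x = x"
  proof -
    have "AE \<omega> in M. indicator Z \<omega> * f \<omega> = f \<omega>"
      using f0 AE_space by eventually_elim (auto simp: Z_def indicator_def)
    then show ?thesis using f ZM by (simp add: chi_q q_eq_iff Linf_mult_L2)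
  qed
  have supp: "prob Y = 0" if Y: "Y \<in> sets G" "Y \<subseteq> Z" "chi Y x = 0" for Y
  proof -
    have [measurable]: "Y \<in> sets M" using Y(1) by (rule sets_G_M)
    have "q (\<lambda>\<omega>. indicator Y \<omega> * f \<omega>) = q (\<lambda>_. 0)"
      using Y(3) f chi_q[of Y f] q_cmult[OF f(1), of 0] by simp
    then have "AE \<omega> in M. indicator Y \<omega> * f \<omega> = 0"
      using f(1) Linf_L2[OF Linf_const, of 0] by (subst (asm) q_eq_iff) (auto intro: Linf_mult_L2)
    then have "AE \<omega> in M. indicator Y \<omega> * ennreal ((cmod (f \<omega>))\<^sup>2) = 0"
      by eventually_elim (auto simp: indicator_def)
    then have "(\<integral>\<^sup>+\<omega>. indicator Y \<omega> * ennreal ((cmod (f \<omega>))\<^sup>2) \<partial>M) = 0"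
      by (subst nn_integral_0_iff_AE) auto
    then have "(\<integral>\<^sup>+\<omega>. indicator Y \<omega> * ennreal ((s \<omega>)\<^sup>2) \<partial>M) = 0"
      using Y(1) by (subst int) auto
    then have "AE \<omega> in M. indicator Y \<omega> * ennreal ((s \<omega>)\<^sup>2) = 0"
      by (subst (asm) nn_integral_0_iff_AE) auto
    then have "AE \<omega> in M. \<omega> \<notin> Y"
      by eventually_elim (use Y(2) s0 in \<open>auto simp: Z_def indicator_def\<close>)
    then show ?thesis by (simp add: prob_eq_0)
  qed
  \<comment> \<open>Division by zero gives 0, so \<open>f'\<close> vanishes where \<open>s\<close>
    does, that is, off \<open>Z\<close>.\<close>
  define f' where "f' \<omega> = f \<omega> / complex_of_real (s \<omega>)" for \<omega>
  have f'M [measurable]: "f' \<in> borel_measurable M" unfolding f'_def by measurable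
  have f'int: "(\<integral>\<^sup>+\<omega>. ennreal ((cmod (f' \<omega> * g \<omega>))\<^sup>2) \<partial>M)
      = (\<integral>\<^sup>+\<omega>. ennreal ((cmod (indicator Z \<omega> * g \<omega>))\<^sup>2) \<partial>M)"
    if g [measurable]: "g \<in> borel_measurable G" for g
  proof -
    have "(\<integral>\<^sup>+\<omega>. ennreal ((cmod (f' \<omega> * g \<omega>))\<^sup>2) \<partial>M)
        = (\<integral>\<^sup>+\<omega>. ennreal ((cmod (g \<omega>) / s \<omega>)\<^sup>2) * ennreal ((cmod (f \<omega>))\<^sup>2) \<partial>M)"
      by (intro nn_integral_cong)
        (simp add: f'_def norm_mult norm_divide power_mult_distrib power_divide mult.commute
          flip: ennreal_mult)
    also have "\<dots> = (\<integral>\<^sup>+\<omega>. ennreal ((cmod (g \<omega>) / s \<omega>)\<^sup>2) * ennreal ((s \<omega>)\<^sup>2) \<partial>M)"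
      by (rule int[symmetric]) measurable
    also have "\<dots> = (\<integral>\<^sup>+\<omega>. ennreal ((cmod (indicator Z \<omega> * g \<omega>))\<^sup>2) \<partial>M)"
      by (intro nn_integral_cong)
        (auto simp: Z_def indicator_def power_divide simp flip: ennreal_mult)
    finally show ?thesis .
  qed
  have f'L2: "(\<lambda>\<omega>. f' \<omega> * g \<omega>) \<in> L2"
    and f'norm: "norm (q (\<lambda>\<omega>. f' \<omega> * g \<omega>)) = norm (chi Z (q g))"
    if g: "g \<in> L2" "g \<in> borel_measurable G" for g
  proof -
    have Zg: "(\<lambda>\<omega>. indicator Z \<omega> * g \<omega>) \<in> L2" using g ZM by (simp add: Linf_mult_L2)
    have eq: "(\<integral>\<^sup>+\<omega>. ennreal ((cmod (f' \<omega> * g \<omega>))\<^sup>2) \<partial>M) = ennreal ((norm (chi Z (q g)))\<^sup>2)"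
      using f'int[OF g(2)] L2_nn_integral[OF Zg] chi_q[OF ZM g(1)] by simp
    show L2: "(\<lambda>\<omega>. f' \<omega> * g \<omega>) \<in> L2"
      using L2_measurable[OF g(1)] eq by (intro L2I_nn_integral) auto
    have "ennreal ((norm (q (\<lambda>\<omega>. f' \<omega> * g \<omega>)))\<^sup>2) = ennreal ((norm (chi Z (q g)))\<^sup>2)"
      using eq L2_nn_integral[OF L2] by simp
    then show "norm (q (\<lambda>\<omega>. f' \<omega> * g \<omega>)) = norm (chi Z (q g))"
      by (simp add: power2_eq_iff_nonneg)
  qed
  define r where "r y = (SOME g. g \<in> L2 \<and> q g = y)" for y
  have r: "r y \<in> L2" "q (r y) = y" for y
  proof -
    obtain g where "g \<in> L2" "y = q g" by (rule q_cases)
    then have "\<exists>g. g \<in> L2 \<and> q g = y" by auto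
    from someI_ex[OF this] show "r y \<in> L2" "q (r y) = y" by (simp_all add: r_def)
  qed
  have proj_meas: "r (orth_proj HF y) \<in> borel_measurable G" for y
    using HF_iff[OF r(1)] orth_proj_in[OF closed_csubspace_HF] r(2) by simp
  define v where "v y = q (\<lambda>\<omega>. f' \<omega> * r (orth_proj HF y) \<omega>)" for y
  \<comment> \<open>\<open>v\<close> may be computed from any representative of the projection. Its
    \<open>G\<close>-measurability is what keeps the product with the possibly unbounded
    \<open>f'\<close> in L2.\<close>
  have v_eq: "v y = q (\<lambda>\<omega>. f' \<omega> * g \<omega>)"
    if "g \<in> L2" "g \<in> borel_measurable G" "q g = orth_proj HF y" for g y
  proof -
    have "AE \<omega> in M. r (orth_proj HF y) \<omega> = g \<omega>"
      using that r q_eq_iff by metis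
    then have "AE \<omega> in M. f' \<omega> * r (orth_proj HF y) \<omega> = f' \<omega> * g \<omega>" by eventually_elim simp
    then show ?thesis unfolding v_def using that r proj_meas by (simp add: q_eq_iff f'L2)
  qed
  have proj_cases: "\<exists>g. g \<in> L2 \<and> g \<in> borel_measurable G \<and> q g = orth_proj HF y" for y
    using r proj_meas by blast
  note P = orth_proj_bounded_ops[OF closed_csubspace_HF]
  have v_add: "v (y + z) = v y + v z" for y z
  proof -
    obtain g h where g: "g \<in> L2" "g \<in> borel_measurable G" "q g = orth_proj HF y"
      and h: "h \<in> L2" "h \<in> borel_measurable G" "q h = orth_proj HF z"
      using proj_cases by metis
    have "q (\<lambda>\<omega>. g \<omega> + h \<omega>) = orth_proj HF (y + z)"
      using g h P by (simp add: q_add bounded_ops_def linear_simps)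
    then have "v (y + z) = q (\<lambda>\<omega>. f' \<omega> * (g \<omega> + h \<omega>))"
      using g h by (intro v_eq L2_add) simp_all
    also have "\<dots> = v y + v z"
      using g h by (simp add: v_eq q_add[symmetric] f'L2 distrib_left)
    finally show ?thesis .
  qed
  have v_mult: "v (mult_op M q a y) = mult_op M q a (v y)" if a: "a \<in> FF" for a y
  proof -
    obtain g where g: "g \<in> L2" "g \<in> borel_measurable G" "q g = orth_proj HF y"
      using proj_cases by metis
    have "q (\<lambda>\<omega>. a \<omega> * g \<omega>) = orth_proj HF (mult_op M q a y)"
      using g a by (simp add: orth_proj_fmod_commute[OF fmod_HF a] mult_op_q FF_Linf flip: g(3))
    then have "v (mult_op M q a y) = q (\<lambda>\<omega>. f' \<omega> * (a \<omega> * g \<omega>))"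
      using g a by (intro v_eq Linf_mult_L2 borel_measurable_times) (simp_all add: FF_iff_measurable)
    also have "\<dots> = mult_op M q a (v y)"
      using g a by (simp add: v_eq mult_op_q FF_Linf f'L2 mult.left_commute)
    finally show ?thesis .
  qed
  have v_scale: "v (c *\<^sub>C y) = c *\<^sub>C v y" for c y
    using v_mult[OF FF_const, of c y] by (simp add: mult_op_const)
  have v_norm: "norm (v y) = norm (chi Z (orth_proj HF y))" for y
    using f'norm[OF r(1) proj_meas, of y] r(2) by (simp add: v_def)
  define E where "E = {y \<in> HF. chi Z y = y}"
  have Efm: "fmod E" unfolding E_def by (rule fmod_eq_chi[OF fmod_HF Z])
  note E = fmod_closed_csubspace[OF Efm]
  have projE: "orth_proj E = (\<lambda>y. chi Z (orth_proj HF y))"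
    unfolding E_def by (rule orth_proj_chi_HF[OF Z])
  have vb: "v \<in> bounded_ops"
  proof (intro v_scale bounded_opsI[where K = 1] v_add)
    show "norm (v y) \<le> norm y * 1" for y
      using norm_chi_le[OF ZM, of "orth_proj HF y"] norm_orth_proj_le[OF closed_csubspace_HF, of y]
      by (simp add: v_norm)
  qed
  have vE: "v (orth_proj E y) = v y" for y
  proof -
    have "orth_proj E y \<in> E" by (rule orth_proj_in[OF E])
    then have "orth_proj HF (orth_proj E y) = orth_proj E y" "chi Z (orth_proj E y) = orth_proj E y"
      by (simp_all add: E_def orth_proj_fix[OF closed_csubspace_HF])
    moreover have "orth_proj HF (y - orth_proj E y) = orth_proj HF y - orth_proj HF (orth_proj E y)"
      using P by (simp add: bounded_ops_def linear_simps)
    ultimately have "chi Z (orth_proj HF (y - orth_proj E y)) = 0"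
      by (simp add: chi_simps ZM) (simp add: projE)
    then have "norm (v (y - orth_proj E y)) = 0" by (simp add: v_norm)
    then show ?thesis using vb by (simp add: bounded_ops_def linear_simps)
  qed
  have normE: "norm (v y) = norm y" if "y \<in> E" for y
    using that by (simp add: v_norm E_def orth_proj_fix[OF closed_csubspace_HF])
  note pi = partial_isometry[OF E vb vE cinner_isometry[OF vb fmod_csubspace[OF Efm] normE]]
  have range: "v ` E = fspan {x}"
  proof
    show "v ` E \<subseteq> fspan {x}"
    proof
      fix z assume "z \<in> v ` E"
      then obtain y where y: "y \<in> E" "z = v y" by auto
      obtain g where g: "g \<in> L2" "g \<in> borel_measurable G" "q g = orth_proj HF y"
        using proj_cases by metis
      have eq: "(\<lambda>\<omega>. f' \<omega> * g \<omega>) = (\<lambda>\<omega>. (g \<omega> / complex_of_real (s \<omega>)) * f \<omega>)" by (simp add: f'_def mult.commute)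
      have "q (\<lambda>\<omega>. (g \<omega> / complex_of_real (s \<omega>)) * f \<omega>) \<in> fspan {q f}"
      proof (rule q_in_fspan[OF f(1)])
        show "(\<lambda>\<omega>. g \<omega> / complex_of_real (s \<omega>)) \<in> borel_measurable G"
          using g(2) by measurable
        show "(\<lambda>\<omega>. (g \<omega> / complex_of_real (s \<omega>)) * f \<omega>) \<in> L2"
          using f'L2[OF g(1,2)] unfolding eq .
      qed
      then show "z \<in> fspan {x}" using y(2) v_eq[OF g] f(2) eq by simp
    qed
    show "fspan {x} \<subseteq> v ` E"
    proof (rule fspan_minimal)
      show "fmod (v ` E)"
      proof (rule fmodI[OF pi(1)])
        fix a z assume a: "a \<in> FF" and "z \<in> v ` E"
        then obtain y where y: "y \<in> E" "z = v y" by auto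
        then show "mult_op M q a z \<in> v ` E"
          using fmod_mult[OF Efm a y(1)] v_mult[OF a, of y] by (metis image_eqI)
      qed
      have "(\<integral>\<^sup>+\<omega>. ennreal ((cmod (complex_of_real (s \<omega>)))\<^sup>2) \<partial>M) = ennreal ((norm (q f))\<^sup>2)"
        using int[of "\<lambda>_. 1"] L2_nn_integral[OF f(1)] by simp
      then have sL2: "(\<lambda>\<omega>. complex_of_real (s \<omega>)) \<in> L2" by (intro L2I_nn_integral) auto
      have sG: "(\<lambda>\<omega>. complex_of_real (s \<omega>)) \<in> borel_measurable G" by measurable
      \<comment> \<open>The generator \<open>x\<close> is reached as the image of \<open>s\<close>,
        which is \<open>G\<close>-measurable and square-integrable, hence represents an element of
        \<open>HF\<close>.\<close>
      define y where "y = q (\<lambda>\<omega>. complex_of_real (s \<omega>))"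
      have y: "y \<in> HF" using HF_iff[OF sL2] sG by (simp add: y_def)
      have "v y = q (\<lambda>\<omega>. f' \<omega> * complex_of_real (s \<omega>))"
        using sL2 sG orth_proj_fix[OF closed_csubspace_HF y] by (intro v_eq) (simp_all add: y_def)
      also have "\<dots> = x"
      proof -
        have "AE \<omega> in M. f' \<omega> * complex_of_real (s \<omega>) = f \<omega>"
          using f0 by eventually_elim (simp add: f'_def)
        then show ?thesis using f f'L2[OF sL2 sG] by (simp add: q_eq_iff)
      qed
      finally have "x = v (orth_proj E y)" using vE by simp
      then show "{x} \<subseteq> v ` E" using orth_proj_in[OF E] by blast
    qed
  qed
  show thesis
  proof (rule that[OF Z _ _ _ chix supp])
    show "v \<in> BC" by (rule commutant_in_basic_construction[OF vb v_mult])
    show "adj v \<circ> v = (\<lambda>y. chi Z (orth_proj HF y))" using pi(3) unfolding projE .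
    show "v \<circ> adj v = orth_proj (fspan {x})" using pi(2) unfolding range .
  qed
qed

text \<open>The union of a sequence whose measures approach the supremum is maximal up to null sets.
  Disjoint unions are enough in the hypothesis, because a family closed under subsets contains the
  disjointed pieces of any sequence of its members.\<close>

lemma ae_largest_set:
  assumes sub: "\<S> \<subseteq> sets G" and ne: "\<S> \<noteq> {}"
    and subset: "\<And>Y Z. Z \<in> \<S> \<Longrightarrow> Y \<in> sets G \<Longrightarrow> Y \<subseteq> Z \<Longrightarrow> Y \<in> \<S>"
    and union: "\<And>B :: nat \<Rightarrow> _. disjoint_family B \<Longrightarrow> (\<And>k. B k \<in> \<S>) \<Longrightarrow> (\<Union>k. B k) \<in> \<S>"
  obtains Z where "Z \<in> \<S>" "\<And>Y. Y \<in> \<S> \<Longrightarrow> prob (Y - Z) = 0"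
proof -
  have Un: "(\<Union>k. B k) \<in> \<S>" if B: "\<And>k. B k \<in> \<S>" for B :: "nat \<Rightarrow> _"
  proof -
    have "disjointed B k \<in> \<S>" for k
    proof (rule subset[OF B[of k]])
      show "disjointed B k \<in> sets G"
        using B sub sets.range_disjointed_sets[of B G] by auto
    qed (auto simp: disjointed_def)
    then have "(\<Union>k. disjointed B k) \<in> \<S>" by (intro union disjoint_family_disjointed)
    then show ?thesis by (simp add: UN_disjointed_eq)
  qed
  define s where "s = (SUP Y\<in>\<S>. prob Y)"
  have bdd: "bdd_above (prob ` \<S>)" by (rule bdd_aboveI[of _ 1]) auto
  have le_s: "prob Y \<le> s" if "Y \<in> \<S>" for Y
    unfolding s_def by (rule cSUP_upper[OF that bdd])
  have "\<exists>Y. Y \<in> \<S> \<and> s - 1 / Suc k < prob Y" for k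
    using less_cSUP_iff[OF ne bdd, of "s - 1 / Suc k"] by (auto simp: s_def)
  then have "\<forall>k. \<exists>Y. Y \<in> \<S> \<and> s - 1 / Suc k < prob Y" by simp
  from choice[OF this] obtain B where B: "\<forall>k. B k \<in> \<S> \<and> s - 1 / real (Suc k) < prob (B k)" ..
  define Z where "Z = (\<Union>k. B k)"
  have Z: "Z \<in> \<S>" unfolding Z_def using B by (intro Un) simp
  have S_M: "Y \<in> sets M" if "Y \<in> \<S>" for Y using that sub sets_G_M by blast
  have "s - 1 / Suc k \<le> prob Z" for k
  proof -
    have "prob (B k) \<le> prob Z"
      by (rule finite_measure_mono[OF _ S_M[OF Z]]) (auto simp: Z_def)
    then show ?thesis using B by (meson less_imp_le order_trans)
  qed
  moreover have "(\<lambda>k. s - 1 / real (Suc k)) \<longlonglongrightarrow> s - 0"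
    by (intro tendsto_diff tendsto_const LIMSEQ_Suc[OF lim_1_over_n])
  ultimately have s_le: "s \<le> prob Z"
    using LIMSEQ_le_const2[of "\<lambda>k. s - 1 / real (Suc k)" s "prob Z"] by simp
  show thesis
  proof (rule that[OF Z])
    fix Y assume Y: "Y \<in> \<S>"
    have "(\<Union>k::nat. if k = 0 then Y else Z) \<in> \<S>" by (intro Un) (simp add: Y Z)
    moreover have "(\<Union>k::nat. if k = 0 then Y else Z) = Z \<union> (Y - Z)"
      by (auto split: if_splits)
    ultimately have "prob (Z \<union> (Y - Z)) \<le> s" using le_s by simp
    moreover have "prob (Z \<union> (Y - Z)) = prob Z + prob (Y - Z)"
      using S_M Y Z by (intro finite_measure_Union) auto
    ultimately show "prob (Y - Z) = 0" using s_le measure_nonneg[of M "Y - Z"] by linarith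
  qed
qed

text \<open>The pieces over disjoint sets are summed with damping factors. A nonzero scalar on a
  piece changes neither what the piece generates nor its support, so one vector can replace the
  whole sequence.\<close>

lemma fmod_glue:
  fixes B :: "nat \<Rightarrow> 'x set"
  assumes V: "fmod V" and B: "\<And>k. B k \<in> sets G" "disjoint_family B" and x: "\<And>k. x k \<in> V"
  obtains y c where "y \<in> V" "\<And>k. chi (B k) y = c k *\<^sub>C chi (B k) (x k)" "\<And>k. c k \<noteq> 0"
proof -
  \<comment> \<open>Bounds the norm of the k-th term by 2^-k, so the series converges, while
    remaining nonzero; the 1 in the denominator covers \<open>x k = 0\<close>.\<close>
  define c :: "nat \<Rightarrow> real" where "c k = (1/2) ^ k / (1 + norm (x k))" for k
  define g where "g k = c k *\<^sub>R chi (B k) (x k)" for k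
  have pos: "1 + norm (x k) > 0" for k using norm_ge_zero[of "x k"] by linarith
  have c0: "c k > 0" for k unfolding c_def by (intro divide_pos_pos pos) simp
  have "norm (g k) \<le> (1/2) ^ k" for k
  proof -
    have "norm (g k) \<le> c k * norm (x k)"
      using c0[of k] norm_chi_le[OF sets_G_M[OF B(1)], of k "x k"] by (simp add: g_def)
    also have "\<dots> \<le> c k * (1 + norm (x k))" using c0[of k] by simp
    also have "\<dots> = (1/2) ^ k" using pos[of k] by (simp add: c_def)
    finally show ?thesis .
  qed
  then have summ: "summable g"
    by (intro summable_comparison_test'[OF summable_geometric[of "1/2::real"], of 0 g]) auto
  have gV: "g k \<in> V" for k
    unfolding g_def by (intro csubspace_scaleR fmod_csubspace V fmod_chi B x)
  from summable_LIMSEQ[OF summ] have yV: "suminf g \<in> V"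
    by (rule fmod_limit[OF V, rotated]) (intro csubspace_sum fmod_csubspace V gV)
  have "chi (B k) (suminf g) = complex_of_real (c k) *\<^sub>C chi (B k) (x k)" for k
  proof -
    have "chi (B k) (g j) = 0" if "j \<noteq> k" for j
    proof -
      have "B k \<inter> B j = {}" using B(2) that by (auto simp: disjoint_family_on_def)
      then show ?thesis
        using chi_simps(4)[OF sets_G_M[OF B(1)[of k]], of "complex_of_real (c j)"]
        by (simp add: g_def scaleC_of_real chi_chi sets_G_M B chi_empty)
    qed
    then have "(\<Sum>j. chi (B k) (g j)) = (\<Sum>j\<in>{k}. chi (B k) (g j))"
      by (intro suminf_finite) auto
    moreover have "chi (B k) (g k) = complex_of_real (c k) *\<^sub>C chi (B k) (x k)"
      using chi_simps(4)[OF sets_G_M[OF B(1)[of k]], of "complex_of_real (c k)"]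
      by (simp add: g_def scaleC_of_real chi_chi sets_G_M B)
    ultimately show ?thesis
      using bounded_linear.suminf[OF bounded_linear_chi[OF sets_G_M[OF B(1)]] summ, of k] by simp
  qed
  then show thesis using c0 by (intro that[of "suminf g" "\<lambda>k. complex_of_real (c k)"] yV) (auto simp: less_imp_neq[symmetric])
qed

subsection \<open>Sets over which a module is generated by n vectors\<close>

text \<open>The vectors need not be carried by \<open>Y\<close>, and their span only has to contain
  the part of \<open>V\<close> over \<open>Y\<close>. So the same vectors serve for all smaller
  sets; equality is recovered in \<open>gen_sets_restrict\<close>.\<close>

definition gen_sets :: "nat \<Rightarrow> 'h set \<Rightarrow> 'x set set"
  where "gen_sets n V = {Y \<in> sets G. \<exists>x. (\<forall>i<n. x i \<in> V) \<and>
    {z \<in> V. chi Y z = z} \<subseteq> fspan (x ` {..<n})}"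

lemma gen_sets_subset:
  assumes "Z \<in> gen_sets n V" "Y \<in> sets G" "Y \<subseteq> Z"
  shows "Y \<in> gen_sets n V"
proof -
  obtain x where x: "\<forall>i<n. x i \<in> V" "{z \<in> V. chi Z z = z} \<subseteq> fspan (x ` {..<n})"
    and Z: "Z \<in> sets G" using assms(1) by (auto simp: gen_sets_def)
  have "chi Z z = z" if "chi Y z = z" for z
    using chi_chi[of Z Y z] assms Z that by (simp add: sets_G_M Int_absorb1)
  then have "{z \<in> V. chi Y z = z} \<subseteq> fspan (x ` {..<n})" using x(2) by auto
  then show ?thesis unfolding gen_sets_def using x(1) assms(2) by auto
qed

lemma chi_preimage_fspan:
  assumes "Z \<in> sets G" "fmod V" "\<And>x. x \<in> X \<Longrightarrow> chi Z x \<in> V" "z \<in> fspan X"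
  shows "chi Z z \<in> V"
  using fspan_minimal[OF _ fmod_preimage_chi[OF assms(2,1)], of X] assms(3,4) by auto

text \<open>The i-th generators of all pieces are glued into a single vector, so \<open>n\<close>
  does not grow with the number of pieces. A vector over the union is the sum of its pieces, each of
  which the glued vectors generate.\<close>

lemma gen_sets_union:
  fixes B :: "nat \<Rightarrow> 'x set"
  assumes V: "fmod V" and dis: "disjoint_family B" and B: "\<And>k. B k \<in> gen_sets n V"
  shows "(\<Union>k. B k) \<in> gen_sets n V"
proof -
  have BG: "B k \<in> sets G" for k using B by (auto simp: gen_sets_def)
  have "\<forall>k. \<exists>x. (\<forall>i<n. x i \<in> V) \<and> {z \<in> V. chi (B k) z = z} \<subseteq> fspan (x ` {..<n})"
    using B by (auto simp: gen_sets_def)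
  from choice[OF this] obtain x where x: "\<And>k i. i < n \<Longrightarrow> x k i \<in> V"
    "\<And>k. {z \<in> V. chi (B k) z = z} \<subseteq> fspan (x k ` {..<n})" by auto
  have "\<exists>y. i < n \<longrightarrow> y \<in> V \<and> (\<forall>k. \<exists>c. chi (B k) (x k i) = c *\<^sub>C chi (B k) y)" for i
  proof (cases "i < n")
    case True
    obtain y c where y: "y \<in> V" "\<And>k. chi (B k) y = c k *\<^sub>C chi (B k) (x k i)" "\<And>k. c k \<noteq> 0"
      using fmod_glue[of V B "\<lambda>k. x k i", OF V BG dis x(1)[OF True]] by blast
    have "chi (B k) (x k i) = inverse (c k) *\<^sub>C chi (B k) y" for k
      using y(3)[of k] by (simp add: y(2) scaleC_scaleC)
    then show ?thesis using y(1) by blast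
  qed simp
  then have "\<forall>i. \<exists>y. i < n \<longrightarrow> y \<in> V \<and> (\<forall>k. \<exists>c. chi (B k) (x k i) = c *\<^sub>C chi (B k) y)" by simp
  from choice[OF this] obtain y where
    y: "\<And>i. i < n \<Longrightarrow> y i \<in> V" "\<And>i k. i < n \<Longrightarrow> \<exists>c. chi (B k) (x k i) = c *\<^sub>C chi (B k) (y i)" by auto
  let ?W = "fspan (y ` {..<n})"
  have "z \<in> ?W" if z: "z \<in> V" "chi (\<Union>k. B k) z = z" for z
  proof -
    have piece: "chi (B k) z \<in> ?W" for k
    proof -
      have "chi (B k) z \<in> fspan (x k ` {..<n})"
        using x(2)[of k] fmod_chi[OF V BG z(1)] by (auto simp: chi_chi sets_G_M BG)
      then have "chi (B k) (chi (B k) z) \<in> ?W"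
      proof (rule chi_preimage_fspan[OF BG fmod_fspan, rotated])
        fix u assume "u \<in> x k ` {..<n}"
        then obtain i where i: "i < n" "u = x k i" by auto
        then obtain c where "chi (B k) u = c *\<^sub>C chi (B k) (y i)" using y(2) by blast
        moreover have "y i \<in> ?W" using i(1) fspan_superset[of "y ` {..<n}"] by auto
        ultimately show "chi (B k) u \<in> ?W"
          by (simp add: csubspace_scaleC fmod_csubspace fmod_fspan fmod_chi BG)
      qed
      then show ?thesis by (simp add: chi_chi sets_G_M BG)
    qed
    have "(\<lambda>k. chi (B k) z) sums z"
      using chi_disjoint_sums[OF sets_G_M[OF BG] dis, of z] z(2) by simp
    then have "(\<lambda>m. \<Sum>k<m. chi (B k) z) \<longlonglongrightarrow> z" by (simp add: sums_def)
    then show ?thesis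
      by (rule fmod_limit[OF fmod_fspan, rotated]) (intro csubspace_sum fmod_csubspace fmod_fspan piece)
  qed
  then have "{z \<in> V. chi (\<Union>k. B k) z = z} \<subseteq> ?W" by auto
  then show ?thesis unfolding gen_sets_def using y(1) BG by auto
qed

lemma gen_sets_largest:
  assumes V: "fmod V"
  obtains Z where "Z \<in> gen_sets n V" "\<And>Y. Y \<in> gen_sets n V \<Longrightarrow> prob (Y - Z) = 0"
proof (rule ae_largest_set[of "gen_sets n V"])
  have "{z \<in> V. chi {} z = z} \<subseteq> fspan ((\<lambda>_. 0) ` {..<n})"
    using csubspace_0[OF fmod_csubspace[OF fmod_fspan]] by (auto simp: chi_empty)
  then have "{} \<in> gen_sets n V"
    unfolding gen_sets_def using csubspace_0[OF fmod_csubspace[OF V]] by (intro CollectI conjI exI[of _ "\<lambda>_. 0"]) auto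
  then show "gen_sets n V \<noteq> {}" by auto
  show "gen_sets n V \<subseteq> sets G" by (auto simp: gen_sets_def)
  show "Y \<in> gen_sets n V" if "Z \<in> gen_sets n V" "Y \<in> sets G" "Y \<subseteq> Z" for Y Z
    using that by (rule gen_sets_subset)
  show "(\<Union>k. B k) \<in> gen_sets n V" if "disjoint_family B" "\<And>k. B k \<in> gen_sets n V" for B :: "nat \<Rightarrow> _"
    using that by (rule gen_sets_union[OF V])
qed (rule that)

text \<open>Generators may be cut off to \<open>Y\<close>, since the cut-off commutes with the
  action of F; the part of \<open>V\<close> over \<open>Y\<close> is then of finite rank in its own
  right.\<close>

lemma gen_sets_restrict:
  assumes V: "fmod V" and Y: "Y \<in> gen_sets n V"
  obtains x where "\<And>i. i < n \<Longrightarrow> x i \<in> {z \<in> V. chi Y z = z}"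
    "{z \<in> V. chi Y z = z} = fspan (x ` {..<n})"
proof -
  obtain x where x: "\<And>i. i < n \<Longrightarrow> x i \<in> V" "{z \<in> V. chi Y z = z} \<subseteq> fspan (x ` {..<n})"
    and YG: "Y \<in> sets G" using Y by (auto simp: gen_sets_def)
  define x' where "x' i = chi Y (x i)" for i
  have x': "x' i \<in> {z \<in> V. chi Y z = z}" if "i < n" for i
    using fmod_chi[OF V YG x(1)[OF that]] by (simp add: x'_def chi_chi sets_G_M YG)
  have "{z \<in> V. chi Y z = z} \<subseteq> fspan (x' ` {..<n})"
  proof
    fix z assume z: "z \<in> {z \<in> V. chi Y z = z}"
    with x(2) have "z \<in> fspan (x ` {..<n})" by auto
    then have "chi Y z \<in> fspan (x' ` {..<n})"
    proof (rule chi_preimage_fspan[OF YG fmod_fspan, rotated])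
      fix u assume "u \<in> x ` {..<n}"
      then show "chi Y u \<in> fspan (x' ` {..<n})"
        using fspan_superset[of "x' ` {..<n}"] by (auto simp: x'_def)
    qed
    then show "z \<in> fspan (x' ` {..<n})" using z by simp
  qed
  moreover have "fspan (x' ` {..<n}) \<subseteq> {z \<in> V. chi Y z = z}"
    using x' by (intro fspan_minimal fmod_eq_chi V YG) auto
  ultimately show thesis using x' by (intro that[of x']) auto
qed

end

section \<open>The weight\<close>

text \<open>The trace property carries the known values on 1_Z e_F to equivalent projections, and
  additivity handles orthogonal sums of modules.\<close>

locale L2_weight = L2_subalgebra M q N
  for M :: "'x measure" and q :: "('x \<Rightarrow> complex) \<Rightarrow> 'h::chilbert_space" and N :: "('h \<Rightarrow> 'h) set" +
  fixes w :: "('h \<Rightarrow> 'h) \<Rightarrow> ennreal"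
  assumes w_add: "a \<in> positive_part BC \<Longrightarrow> b \<in> positive_part BC \<Longrightarrow> w (\<lambda>x. a x + b x) = w a + w b"
    and w_trace: "a \<in> BC \<Longrightarrow> w (adj a \<circ> a) = w (a \<circ> adj a)"
    and w_chi: "Z \<in> sets G \<Longrightarrow> w (\<lambda>x. chi Z (orth_proj HF x)) = ennreal (prob Z)"
begin

text \<open>The trace property compares the initial and final projections of the partial isometry.
  The last two clauses make \<open>Z\<close> the support of \<open>x\<close> among the sets of
  \<open>G\<close>, up to null sets.\<close>

lemma w_cyclic:
  obtains Z where "Z \<in> sets G" "w (orth_proj (fspan {x})) = ennreal (prob Z)" "chi Z x = x"
    "\<And>Y. Y \<in> sets G \<Longrightarrow> Y \<subseteq> Z \<Longrightarrow> chi Y x = 0 \<Longrightarrow> prob Y = 0"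
proof -
  obtain Z v where Z: "Z \<in> sets G" "v \<in> BC" "adj v \<circ> v = (\<lambda>y. chi Z (orth_proj HF y))"
    "v \<circ> adj v = orth_proj (fspan {x})" "chi Z x = x"
    "\<And>Y. Y \<in> sets G \<Longrightarrow> Y \<subseteq> Z \<Longrightarrow> chi Y x = 0 \<Longrightarrow> prob Y = 0"
    by (rule cyclic_module[of x]) (rule that)
  have "w (orth_proj (fspan {x})) = ennreal (prob Z)"
    using w_trace[OF Z(2)] w_chi[OF Z(1)] Z(3,4) by simp
  then show thesis using Z by (intro that[of Z]) auto
qed

section \<open>Additivity, monotonicity and finiteness of the weight on modules\<close>

lemma w_split:
  assumes "fmod V" "fmod W" "V \<subseteq> W"
  shows "w (orth_proj W) = w (orth_proj V) + w (orth_proj (W \<inter> orth_compl V))"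
  using assms
  by (simp add: orth_proj_split[of V W] fmod_closed_csubspace w_add orth_proj_BC fmod_Int fmod_orth_compl)

lemma w_mono: "fmod V \<Longrightarrow> fmod W \<Longrightarrow> V \<subseteq> W \<Longrightarrow> w (orth_proj V) \<le> w (orth_proj W)"
  by (simp add: w_split[of V W])

lemma fspan_orth_residual:
  assumes V: "fmod V" shows "fspan {x - orth_proj V x} \<subseteq> orth_compl V"
  using orth_proj_compl[OF fmod_closed_csubspace[OF V]] by (intro fspan_minimal fmod_orth_compl V) simp

text \<open>A Gram-Schmidt step: adding \<open>x\<close> enlarges the module at most by the cyclic
  module of the residual of \<open>x\<close>, which is orthogonal to what was there.\<close>

lemma w_fspan_finite:
  assumes "finite X" shows "w (orth_proj (fspan X)) < \<infinity>"
  using assms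
proof induction
  \<comment> \<open>Compared with the cyclic module of 0, so that the cyclic case supplies the
    finite bound.\<close>
  case empty
  have "w (orth_proj (fspan {})) \<le> w (orth_proj (fspan {0}))"
    by (intro w_mono fmod_fspan fspan_mono) simp
  also have "\<dots> < \<infinity>" by (rule w_cyclic[of 0]) simp
  finally show ?case .
next
  case (insert x X)
  let ?V = "fspan X" let ?W = "fspan {x - orth_proj ?V x}"
  let ?S = "{a + b | a b. a \<in> ?V \<and> b \<in> ?W}"
  note orth = fspan_orth_residual[OF fmod_fspan, of x X]
  have S: "fmod ?S" by (intro fmod_orth_sum fmod_fspan orth)
  have "insert x X \<subseteq> ?S"
  proof -
    have zero: "0 \<in> ?V" "0 \<in> ?W" by (intro csubspace_0 fmod_csubspace fmod_fspan)+
    have "orth_proj ?V x \<in> ?V" "x - orth_proj ?V x \<in> ?W"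
      using orth_proj_in[OF fmod_closed_csubspace[OF fmod_fspan]] fspan_superset[of "{x - orth_proj ?V x}"] by auto
    then have "x \<in> ?S" by (intro CollectI exI[of _ "orth_proj ?V x"] exI[of _ "x - orth_proj ?V x"]) simp
    moreover have "y \<in> ?S" if "y \<in> X" for y
      using that zero fspan_superset[of X] by (intro CollectI exI[of _ y] exI[of _ 0]) auto
    ultimately show ?thesis by blast
  qed
  then have "w (orth_proj (fspan (insert x X))) \<le> w (orth_proj ?S)"
    by (intro w_mono fmod_fspan S fspan_minimal)
  also have "\<dots> = w (orth_proj ?V) + w (orth_proj ?W)"
    by (simp add: orth_proj_orth_sum(2) fmod_closed_csubspace fmod_fspan orth w_add orth_proj_BC)
  also have "\<dots> < \<infinity>"
    by (rule w_cyclic[of "x - orth_proj ?V x"]) (use insert.IH in simp)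
  finally show ?case .
qed

text \<open>Outside every set over which \<open>V\<close> is generated by finitely many vectors one finds arbitrarily many
  mutually orthogonal cyclic submodules of full support, each of weight at least the measure of the set.\<close>

lemma gen_sets_exhaust:
  assumes V: "fmod V" and fin: "w (orth_proj V) < \<infinity>"
    and Y: "\<And>n. Y n \<in> sets G" "\<And>n X. X \<in> gen_sets n V \<Longrightarrow> prob (X - Y n) = 0"
  shows "prob (space M - (\<Union>n. Y n)) = 0"
proof -
  define Z where "Z = space M - (\<Union>n. Y n)"
  have "(\<Union>n. Y n) \<in> sets G" using Y(1) by auto
  then have Z: "Z \<in> sets G" unfolding Z_def using sets.compl_sets[of "\<Union>n. Y n" G] by simp
  have next_vector: "\<exists>y\<in>V \<inter> orth_compl (fspan (x ` {..<n})). ennreal (prob Z) \<le> w (orth_proj (fspan {y}))"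
    if x: "\<And>i. i < n \<Longrightarrow> x i \<in> V" for x and n :: nat
  proof -
    let ?W = "fspan (x ` {..<n})"
    let ?R = "V \<inter> orth_compl ?W"
    have R: "fmod ?R" by (intro fmod_Int V fmod_orth_compl fmod_fspan)
    have WV: "?W \<subseteq> V" using x by (intro fspan_minimal V) auto
    \<comment> \<open>\<open>y\<close> has full support on \<open>S\<close>: restricting it to a
      part of \<open>S\<close> of positive measure never gives 0. A largest such \<open>S\<close>
      acts as the support of the whole complement \<open>?R\<close>, attained by one vector.\<close>
    define full where "full S y \<longleftrightarrow> (\<forall>X\<in>sets G. X \<subseteq> S \<longrightarrow> chi X y = 0 \<longrightarrow> prob X = 0)" for S y
    define \<S> where "\<S> = {S \<in> sets G. \<exists>y\<in>?R. full S y}"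
    obtain S where S: "S \<in> \<S>" "\<And>X. X \<in> \<S> \<Longrightarrow> prob (X - S) = 0"
    proof (rule ae_largest_set[of \<S>])
      have "full {} 0" by (auto simp: full_def)
      then show "\<S> \<noteq> {}"
        unfolding \<S>_def using csubspace_0[OF fmod_csubspace[OF R]] by blast
      show "\<S> \<subseteq> sets G" by (auto simp: \<S>_def)
      show "X \<in> \<S>" if X: "S \<in> \<S>" "X \<in> sets G" "X \<subseteq> S" for X S
      proof -
        obtain y where y: "y \<in> ?R" "full S y" using X(1) by (auto simp: \<S>_def)
        have "full X y" using y(2) order_trans[OF _ X(3)] unfolding full_def by simp
        then show ?thesis using y(1) X(2) by (auto simp: \<S>_def)
      qed
      show "(\<Union>k. B k) \<in> \<S>" if dis: "disjoint_family B" and B: "\<And>k. B k \<in> \<S>" for B :: "nat \<Rightarrow> _"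
      proof -
        have BG: "B k \<in> sets G" for k using B by (auto simp: \<S>_def)
        have "\<forall>k. \<exists>y. y \<in> ?R \<and> full (B k) y" using B by (auto simp: \<S>_def)
        from choice[OF this] obtain y where y: "\<And>k. y k \<in> ?R" "\<And>k. full (B k) (y k)" by auto
        obtain u c where u: "u \<in> ?R" "\<And>k. chi (B k) u = c k *\<^sub>C chi (B k) (y k)" "\<And>k. c k \<noteq> 0"
          by (rule fmod_glue[OF R BG dis y(1)]) (rule that)
        have "prob X = 0" if X: "X \<in> sets G" "X \<subseteq> (\<Union>k. B k)" "chi X u = 0" for X
        proof -
          have null: "prob (X \<inter> B k) = 0" for k
          proof -
            have "c k *\<^sub>C chi (X \<inter> B k) (y k) = chi X (c k *\<^sub>C chi (B k) (y k))"
              by (simp add: chi_simps chi_chi sets_G_M X BG)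
            also have "\<dots> = chi (B k) (chi X u)"
              by (simp add: u(2)[symmetric] chi_chi sets_G_M X(1) BG Int_commute)
            also have "\<dots> = 0" using X(3) by (simp add: chi_simps sets_G_M BG)
            finally have "inverse (c k) *\<^sub>C (c k *\<^sub>C chi (X \<inter> B k) (y k)) = 0" by simp
            then have "chi (X \<inter> B k) (y k) = 0" using u(3)[of k] by (simp add: scaleC_scaleC)
            then show ?thesis using y(2)[of k] X(1) BG[of k] by (simp add: full_def)
          qed
          then have "X \<inter> B k \<in> null_sets M" for k
            using X(1) BG[of k] by (intro null_setsI) (simp_all add: emeasure_eq_measure sets_G_M sets.Int)
          then have "(\<Union>k. X \<inter> B k) \<in> null_sets M" by (rule null_sets_UN)
          moreover have "(\<Union>k. X \<inter> B k) = X" using X(2) by auto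
          ultimately show ?thesis by (simp add: null_sets_def measure_def)
        qed
        then show ?thesis using u(1) BG by (auto simp: \<S>_def full_def)
      qed
    qed (rule that)
    then obtain y where y: "y \<in> ?R" "full S y" and SG: "S \<in> sets G" by (auto simp: \<S>_def)
    \<comment> \<open>Over \<open>Z - S\<close> nothing in \<open>V\<close> is orthogonal to
      \<open>?W\<close>: the residual \<open>u\<close> of a vector there has a support that
      maximality places inside \<open>S\<close> up to a null set, so \<open>u = 0\<close>. Hence the
      given \<open>n\<close> vectors already generate over \<open>Z - S\<close>.\<close>
    have "Z - S \<in> gen_sets n V"
    proof -
      have "z \<in> ?W" if z: "z \<in> V" "chi (Z - S) z = z" for z
      proof -
        note Wc = fmod_closed_csubspace[OF fmod_fspan, of "x ` {..<n}"]
        have ZS: "Z - S \<in> sets G" using Z SG by auto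
        define u where "u = chi (Z - S) (z - orth_proj ?W z)"
        have "z - orth_proj ?W z \<in> ?R"
          using orth_proj_compl[OF Wc, of z] orth_proj_in[OF Wc, of z] WV z(1)
            csubspace_diff[OF fmod_csubspace[OF V]] by auto
        then have uR: "u \<in> ?R" unfolding u_def by (intro fmod_chi[OF R ZS])
        obtain Z1 where Z1: "Z1 \<in> sets G" "chi Z1 u = u"
          "\<And>Y. Y \<in> sets G \<Longrightarrow> Y \<subseteq> Z1 \<Longrightarrow> chi Y u = 0 \<Longrightarrow> prob Y = 0"
          by (rule w_cyclic[of u]) (rule that)
        have "Z1 \<in> \<S>" using Z1 uR by (auto simp: \<S>_def full_def)
        then have "prob (Z1 - S) = 0" by (rule S(2))
        moreover have "Z1 - S \<in> sets M" using Z1(1) SG by (auto intro: sets_G_M)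
        ultimately have "Z1 - S \<in> null_sets M" by (simp add: null_sets_def emeasure_eq_measure)
        then have null: "Z1 \<inter> (Z - S) \<in> null_sets M"
          by (rule null_sets_subset) (use Z1(1) ZS sets_G_M in auto)
        have "u = chi Z1 (chi (Z - S) u)"
          using Z1(2) ZS by (simp add: u_def chi_chi sets_G_M)
        also have "\<dots> = 0" using Z1(1) ZS chi_null[OF null] by (simp add: chi_chi sets_G_M)
        finally have "u = 0" .
        then have "z = chi (Z - S) (orth_proj ?W z)"
          using z(2) ZS by (simp add: u_def chi_simps sets_G_M)
        then show ?thesis using fmod_chi[OF fmod_fspan ZS orth_proj_in[OF Wc]] by metis
      qed
      then show ?thesis unfolding gen_sets_def using x Z SG by (intro CollectI conjI exI[of _ x]) auto
    qed
    \<comment> \<open>\<open>Y n\<close> absorbs \<open>Z - S\<close> up to a null set and yet is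
      disjoint from \<open>Z\<close>; so \<open>S\<close> covers almost all of
      \<open>Z\<close>.\<close>
    then have "prob (Z - S - Y n) = 0" by (rule Y(2))
    moreover have "Z - S - Y n = Z - S" by (auto simp: Z_def)
    ultimately have "prob (Z - S) = 0" by simp
    obtain Z0 where Z0: "Z0 \<in> sets G" "w (orth_proj (fspan {y})) = ennreal (prob Z0)" "chi Z0 y = y"
      by (rule w_cyclic[of y]) (rule that)
    have "chi (S - Z0) y = chi (S - Z0) (chi Z0 y)" by (simp add: Z0(3))
    also have "\<dots> = 0"
      using SG Z0(1) by (simp add: chi_chi sets_G_M chi_empty Int_commute[of _ Z0])
    finally have "prob (S - Z0) = 0" using y(2) SG Z0(1) by (auto simp: full_def)
    have "prob Z \<le> prob ((Z - S) \<union> ((S - Z0) \<union> Z0))"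
      using Z SG Z0(1) by (intro finite_measure_mono) (auto intro: sets_G_M)
    also have "\<dots> \<le> prob (Z - S) + (prob (S - Z0) + prob Z0)"
      using Z SG Z0(1) by (intro order_trans[OF measure_Un_le] add_left_mono measure_Un_le) (auto intro: sets_G_M)
    also have "\<dots> = prob Z0" using \<open>prob (Z - S) = 0\<close> \<open>prob (S - Z0) = 0\<close> by simp
    finally show ?thesis using y(1) Z0(2) by (intro bexI[of _ y]) (simp_all add: ennreal_leI)
  qed
  \<comment> \<open>Each new cyclic module is orthogonal to the span of the earlier vectors, so the
    weights add. All these modules stay inside \<open>V\<close>, so its finite weight bounds every
    \<open>n\<close>.\<close>
  have many: "\<exists>x. (\<forall>i<n. x i \<in> V) \<and> ennreal (real n * prob Z) \<le> w (orth_proj (fspan (x ` {..<n})))" for n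
  proof (induction n)
    case (Suc n)
    then obtain x where x: "\<And>i. i < n \<Longrightarrow> x i \<in> V"
      "ennreal (real n * prob Z) \<le> w (orth_proj (fspan (x ` {..<n})))" by auto
    obtain y where y: "y \<in> V" "y \<in> orth_compl (fspan (x ` {..<n}))"
      "ennreal (prob Z) \<le> w (orth_proj (fspan {y}))"
      using next_vector[of n x, OF x(1)] by auto
    let ?x = "x(n := y)" let ?V = "fspan (?x ` {..<Suc n})" let ?W = "fspan (x ` {..<n})"
    have sub: "?W \<subseteq> ?V" "fspan {y} \<subseteq> ?V"
      by (intro fspan_mono, force)+
    have "fspan {y} \<subseteq> orth_compl ?W"
      using y(2) by (intro fspan_minimal fmod_orth_compl fmod_fspan) simp
    then have le: "w (orth_proj (fspan {y})) \<le> w (orth_proj (?V \<inter> orth_compl ?W))"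
      using sub(2) by (intro w_mono fmod_fspan fmod_Int fmod_orth_compl) simp
    have "ennreal (real (Suc n) * prob Z) = ennreal (real n * prob Z) + ennreal (prob Z)"
      by (simp add: ring_distribs add.commute flip: ennreal_plus)
    also have "\<dots> \<le> w (orth_proj ?W) + w (orth_proj (?V \<inter> orth_compl ?W))"
      by (intro add_mono x(2) order_trans[OF y(3) le])
    also have "\<dots> = w (orth_proj ?V)"
      by (rule w_split[OF fmod_fspan fmod_fspan sub(1), symmetric])
    finally have "ennreal (real (Suc n) * prob Z) \<le> w (orth_proj ?V)" .
    moreover have "\<forall>i<Suc n. ?x i \<in> V" using x(1) y(1) by (simp add: less_Suc_eq)
    ultimately show ?case by (intro exI[of _ ?x] conjI)
  qed simp
  obtain c where c: "w (orth_proj V) = ennreal c" "c \<ge> 0"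
    using fin by (cases "w (orth_proj V)") auto
  have bound: "real n * prob Z \<le> c" for n
  proof -
    obtain x where x: "\<forall>i<n. x i \<in> V" "ennreal (real n * prob Z) \<le> w (orth_proj (fspan (x ` {..<n})))"
      using many by blast
    note x(2)
    also have "w (orth_proj (fspan (x ` {..<n}))) \<le> w (orth_proj V)"
      using x(1) by (intro w_mono fmod_fspan V fspan_minimal) auto
    finally show ?thesis using c by (simp add: ennreal_le_iff)
  qed
  show ?thesis
  proof (rule ccontr)
    assume "prob (space M - (\<Union>n. Y n)) \<noteq> 0"
    then have pos: "prob Z > 0" using measure_nonneg[of M Z] by (simp add: Z_def less_le)
    obtain n where "c < real n * prob Z" using reals_Archimedean3[OF pos] by blast
    then show False using bound[of n] by simp
  qed
qed

end

section \<open>Invariant modules\<close>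

text \<open>The set map \<tau> stands for taking preimages under \<open>T\<close>. Coefficients are
  matched in both directions because the automorphism maps F onto F; this makes the inverse of
  \<open>U\<close> move modules as well.\<close>

locale L2_dynamics = L2_weight M q N w
  for M :: "'x measure" and q :: "('x \<Rightarrow> complex) \<Rightarrow> 'h::chilbert_space" and N :: "('h \<Rightarrow> 'h) set"
    and w :: "('h \<Rightarrow> 'h) \<Rightarrow> ennreal" +
  fixes U :: "'h \<Rightarrow> 'h" and \<tau> :: "'x set \<Rightarrow> 'x set"
  assumes U_unitary: "unitary_op U"
    and U_mult: "f \<in> FF \<Longrightarrow> \<exists>g\<in>FF. \<forall>x. U (mult_op M q f x) = mult_op M q g (U x)"
    and U_mult': "f \<in> FF \<Longrightarrow> \<exists>g\<in>FF. \<forall>x. U (mult_op M q g x) = mult_op M q f (U x)"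
    and \<tau>_G: "Y \<in> sets G \<Longrightarrow> \<tau> Y \<in> sets G"
    and prob_\<tau>: "Y \<in> sets G \<Longrightarrow> prob (\<tau> Y) = prob Y"
    and U_chi: "Y \<in> sets G \<Longrightarrow> U (chi Y x) = chi (\<tau> Y) (U x)"
    and U_HF: "U ` HF = HF"
begin

section \<open>Moving modules with U and its inverse\<close>

lemma U_bounded: "U \<in> bounded_ops"
  and U_surj: "surj U"
  and U_cinner: "cinner (U x) (U y) = cinner x y"
  using U_unitary by (simp_all add: unitary_op_def)

lemma U_simps: "U (x + y) = U x + U y" "U (x - y) = U x - U y" "U (c *\<^sub>C x) = c *\<^sub>C U x"
  "U 0 = 0"
  using U_bounded by (auto simp: bounded_ops_def linear_simps)

lemma U_norm: "norm (U x) = norm x"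
  by (rule norm_eqI_cinner) (rule U_cinner)

lemma U_inj: "U x = U y \<longleftrightarrow> x = y"
  using U_norm[of "x - y"] by (auto simp: U_simps)

lemma U_inv: "U (inv U x) = x" "inv U (U x) = x"
  using U_surj U_inj by (simp_all add: surj_f_inv_f inv_f_f inj_def)

lemma inv_U_bounded: "inv U \<in> bounded_ops"
proof (rule bounded_opsI[where K = 1])
  have eqI: "inv U y = x" if "U x = y" for x y using that U_inv(2) by auto
  show "inv U (x + y) = inv U x + inv U y" for x y by (rule eqI) (simp add: U_simps U_inv)
  show "inv U (c *\<^sub>C x) = c *\<^sub>C inv U x" for c x by (rule eqI) (simp add: U_simps U_inv)
  show "norm (inv U x) \<le> norm x * 1" for x using U_norm[of "inv U x"] by (simp add: U_inv)
qed

lemma inv_U_mult: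
  assumes "f \<in> FF" shows "\<exists>g\<in>FF. \<forall>x. inv U (mult_op M q f x) = mult_op M q g (inv U x)"
proof -
  obtain g where g: "g \<in> FF" "\<And>x. U (mult_op M q g x) = mult_op M q f (U x)"
    using U_mult'[OF assms] by auto
  have "inv U (mult_op M q f x) = mult_op M q g (inv U x)" for x
    using g(2)[of "inv U x"] U_inv(2)[of "mult_op M q g (inv U x)"] by (simp add: U_inv)
  then show ?thesis using g(1) by blast
qed

lemma U_fspan:
  assumes "U ` X = X" shows "U ` fspan X = fspan X"
proof
  have "fspan X \<subseteq> {x. U x \<in> fspan X}"
    using assms fspan_superset[of X] by (intro fspan_minimal fmod_preimage[OF fmod_fspan U_bounded U_mult]) auto
  then show "U ` fspan X \<subseteq> fspan X" by auto
  have "X \<subseteq> {x. inv U x \<in> fspan X}"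
  proof
    fix x assume "x \<in> X"
    then obtain y where "y \<in> X" "x = U y" using assms by auto
    then show "x \<in> {x. inv U x \<in> fspan X}" using fspan_superset[of X] by (auto simp: U_inv)
  qed
  then have "fspan X \<subseteq> {x. inv U x \<in> fspan X}"
    by (intro fspan_minimal fmod_preimage[OF fmod_fspan inv_U_bounded inv_U_mult])
  then show "fspan X \<subseteq> U ` fspan X" by (auto intro!: image_eqI[where x = "inv U _"] simp: U_inv)
qed

lemma U_orth_proj_HF: "U (orth_proj HF x) = orth_proj HF (U x)"
proof (rule orth_proj_eqI[OF closed_csubspace_HF, symmetric])
  show "U (orth_proj HF x) \<in> HF" using orth_proj_in[OF closed_csubspace_HF] U_HF by blast
  show "U x - U (orth_proj HF x) \<in> orth_compl HF"
    unfolding orth_compl_def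
  proof (intro CollectI ballI)
    fix y assume "y \<in> HF"
    then obtain z where z: "z \<in> HF" "y = U z" using U_HF by auto
    then have "cinner z (x - orth_proj HF x) = 0"
      using orth_compl_cinner[OF orth_proj_compl[OF closed_csubspace_HF]] by blast
    then show "cinner y (U x - U (orth_proj HF x)) = 0"
      using U_cinner[of z "x - orth_proj HF x"] by (simp add: z U_simps)
  qed
qed

text \<open>Projecting an invariant finite rank module away from \<open>H\<^sub>F\<close> keeps it invariant and of finite
  rank.\<close>

lemma finite_rank_imp_weight_module:
  assumes fin: "finite X" and inv: "U ` fspan X = fspan X"
    and x: "x \<in> fspan X" "x \<in> orth_compl HF"
  obtains V where "fmod V" "U ` V = V" "V \<subseteq> orth_compl HF" "w (orth_proj V) < \<infinity>" "x \<in> V"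
proof -
  define R where "R y = y - orth_proj HF y" for y
  have R_orth: "R y \<in> orth_compl HF" for y
    unfolding R_def by (rule orth_proj_compl[OF closed_csubspace_HF])
  have R_bounded: "R \<in> bounded_ops"
    using orth_proj_bounded_ops[OF closed_csubspace_HF]
    by (auto simp: R_def[abs_def] bounded_ops_def scaleC_diff_right intro!: bounded_linear_sub)
  have R_mult: "\<exists>g\<in>FF. \<forall>x. R (mult_op M q f x) = mult_op M q g (R x)" if "f \<in> FF" for f
  proof (intro bexI[OF _ that] allI)
    show "R (mult_op M q f x) = mult_op M q f (R x)" for x
      using mult_op_bounded_ops[OF FF_Linf[OF that]]
      by (simp add: R_def orth_proj_fmod_commute[OF fmod_HF that] bounded_ops_def linear_simps)
  qed
  \<comment> \<open>The whole module is projected, not just \<open>X\<close>: \<open>fspan X\<close>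
    is invariant under \<open>U\<close> while \<open>X\<close> need not be. That the vectors of
    \<open>R\<close> on \<open>X\<close> suffice to generate is shown separately, for the weight
    bound.\<close>
  define V where "V = fspan (R ` fspan X)"
  have V: "fmod V" unfolding V_def by (rule fmod_fspan)
  have "U ` R ` fspan X = R ` U ` fspan X"
    by (auto simp: image_image R_def U_simps U_orth_proj_HF)
  then have "U ` V = V" unfolding V_def using inv by (intro U_fspan) simp
  moreover have "V \<subseteq> orth_compl HF"
    unfolding V_def using R_orth by (intro fspan_minimal fmod_orth_compl fmod_HF) auto
  moreover have "V \<subseteq> fspan (R ` X)"
  proof -
    have "fspan X \<subseteq> {y. R y \<in> fspan (R ` X)}"
      using fspan_superset[of "R ` X"]
      by (intro fspan_minimal fmod_preimage[OF fmod_fspan R_bounded R_mult]) auto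
    then show ?thesis unfolding V_def by (intro fspan_minimal fmod_fspan) auto
  qed
  then have "w (orth_proj V) \<le> w (orth_proj (fspan (R ` X)))" by (intro w_mono V fmod_fspan)
  then have "w (orth_proj V) < \<infinity>" using w_fspan_finite[of "R ` X"] fin by (auto intro: le_less_trans)
  moreover have "x \<in> V"
  proof -
    have "R x = x" using orth_proj_orth[OF closed_csubspace_HF x(2)] by (simp add: R_def)
    then show ?thesis unfolding V_def using fspan_superset[of "R ` fspan X"] x(1) by (metis image_eqI subsetD)
  qed
  ultimately show thesis using V by (intro that[of V])
qed

text \<open>\<open>U\<close> exchanges the part of \<open>V\<close> over \<open>Y\<close> for the
  part over its image under \<tau>, and takes generators to generators.\<close>

lemma gen_sets_\<tau>:
  assumes V: "U ` V = V" and Y: "Y \<in> gen_sets n V" shows "\<tau> Y \<in> gen_sets n V"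
proof -
  obtain x where x: "\<And>i. i < n \<Longrightarrow> x i \<in> V" "{z \<in> V. chi Y z = z} \<subseteq> fspan (x ` {..<n})"
    and YG: "Y \<in> sets G" using Y by (auto simp: gen_sets_def)
  let ?W = "fspan ((\<lambda>i. U (x i)) ` {..<n})"
  have W: "fspan (x ` {..<n}) \<subseteq> {z. U z \<in> ?W}"
    using fspan_superset[of "(\<lambda>i. U (x i)) ` {..<n}"]
    by (intro fspan_minimal fmod_preimage[OF fmod_fspan U_bounded U_mult]) auto
  have "z \<in> ?W" if z: "z \<in> V" "chi (\<tau> Y) z = z" for z
  proof -
    obtain u where u: "u \<in> V" "z = U u" using z(1) V by auto
    have "U (chi Y u) = U u" using z(2) u(2) U_chi[OF YG] by simp
    then have "chi Y u = u" by (simp add: U_inj)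
    then show ?thesis using u x(2) W by auto
  qed
  then have "{z \<in> V. chi (\<tau> Y) z = z} \<subseteq> ?W" by auto
  moreover have "U (x i) \<in> V" if "i < n" for i using x(1)[OF that] V by auto
  ultimately show ?thesis
    unfolding gen_sets_def using \<tau>_G[OF YG] by (intro CollectI conjI exI[of _ "\<lambda>i. U (x i)"]) auto
qed

text \<open>The union consists of F-eigenvectors; the span is taken only afterwards, to match the
  classical definition.\<close>

definition finite_rank_parts :: "'h set \<Rightarrow> 'h set"
  where "finite_rank_parts V = \<Union>{W. W \<subseteq> V \<and> fmod W \<and> U ` W = W \<and>
    (\<exists>(n::nat) x. (\<forall>i<n. x i \<in> W) \<and> W = fspan (x ` {..<n}))}"

text \<open>The largest sets over which \<open>V\<close> is generated by \<open>n\<close> vectors are invariant and exhaust the space.\<close>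

lemma weight_module_imp_finite_rank:
  assumes V: "fmod V" and inv: "U ` V = V" and fin: "w (orth_proj V) < \<infinity>"
  shows "V \<subseteq> closed_cspan (finite_rank_parts V)"
proof
  fix z assume z: "z \<in> V"
  let ?C = "closed_cspan (finite_rank_parts V)"
  have C: "csubspace ?C" "closed ?C"
    using closed_csubspace_closed_cspan by (auto simp: closed_csubspace_def)
  have "\<forall>n. \<exists>Y. Y \<in> gen_sets n V \<and> (\<forall>X. X \<in> gen_sets n V \<longrightarrow> prob (X - Y) = 0)"
  proof
    fix n
    obtain Y where "Y \<in> gen_sets n V" "\<And>X. X \<in> gen_sets n V \<Longrightarrow> prob (X - Y) = 0"
      by (rule gen_sets_largest[OF V]) (rule that)
    then show "\<exists>Y. Y \<in> gen_sets n V \<and> (\<forall>X. X \<in> gen_sets n V \<longrightarrow> prob (X - Y) = 0)" by auto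
  qed
  from choice[OF this] obtain Y where
    Y: "\<And>n. Y n \<in> gen_sets n V" "\<And>n X. X \<in> gen_sets n V \<Longrightarrow> prob (X - Y n) = 0" by auto
  have YG: "Y n \<in> sets G" for n using Y(1)[of n] by (simp add: gen_sets_def)
  have part: "{z \<in> V. chi (Y n) z = z} \<subseteq> ?C" for n
  proof -
    let ?W = "{z \<in> V. chi (Y n) z = z}"
    have \<tau>: "\<tau> (Y n) \<in> gen_sets n V" by (rule gen_sets_\<tau>[OF inv Y(1)])
    note M = sets_G_M[OF YG[of n]] sets_G_M[OF \<tau>_G[OF YG[of n]]]
    \<comment> \<open>Maximality gives one inclusion up to a null set; as the measures of both sets
      are finite and equal, the other follows.\<close>
    have diff: "prob (\<tau> (Y n) - Y n) = 0" by (rule Y(2)[OF \<tau>])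
    have "prob (\<tau> (Y n)) = prob (\<tau> (Y n) - Y n) + prob (\<tau> (Y n) \<inter> Y n)"
      using finite_measure_Diff'[OF M(2,1)] by simp
    moreover have "prob (Y n - \<tau> (Y n)) = prob (Y n) - prob (Y n \<inter> \<tau> (Y n))"
      by (rule finite_measure_Diff'[OF M])
    ultimately have diff': "prob (Y n - \<tau> (Y n)) = 0"
      using diff prob_\<tau>[OF YG[of n]] by (simp add: Int_commute)
    have "AE \<omega> in M. \<omega> \<notin> \<tau> (Y n) - Y n" "AE \<omega> in M. \<omega> \<notin> Y n - \<tau> (Y n)"
      using diff diff' M by (simp_all add: prob_eq_0 del: Diff_iff)
    then have "AE \<omega> in M. \<omega> \<in> \<tau> (Y n) \<longleftrightarrow> \<omega> \<in> Y n" by eventually_elim auto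
    \<comment> \<open>The two indicators now give literally the same operator, so the module
      restricted to \<open>Y n\<close> is exactly invariant, with no null set left over.\<close>
    then have chi_eq: "chi (\<tau> (Y n)) = chi (Y n)" by (intro chi_eqI M)
    have "U ` ?W = ?W"
    proof
      show "U ` ?W \<subseteq> ?W"
        using inv U_chi[OF YG[of n]] by (auto simp: chi_eq) (metis chi_eq)
      show "?W \<subseteq> U ` ?W"
      proof
        fix y assume y: "y \<in> ?W"
        then obtain u where u: "u \<in> V" "y = U u" using inv by auto
        have "U (chi (Y n) u) = U u" using y u(2) U_chi[OF YG[of n], of u] by (simp add: chi_eq)
        then have "chi (Y n) u = u" by (simp add: U_inj)
        then show "y \<in> U ` ?W" using u by auto
      qed
    qed
    moreover have "fmod ?W" by (rule fmod_eq_chi[OF V YG])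
    moreover obtain x where "\<And>i. i < n \<Longrightarrow> x i \<in> ?W" "?W = fspan (x ` {..<n})"
      by (rule gen_sets_restrict[OF V Y(1)]) (rule that)
    ultimately have "?W \<subseteq> finite_rank_parts V"
      unfolding finite_rank_parts_def by (intro Union_upper) auto
    then show ?thesis using closed_cspan_superset by (rule order_trans)
  qed
  \<comment> \<open>The \<open>Y n\<close> may overlap. Disjointing them writes \<open>z\<close> as
    a convergent series whose n-th term still lies in the part of \<open>V\<close> over
    \<open>Y n\<close>.\<close>
  define B where "B = disjointed Y"
  have BG: "B n \<in> sets G" for n
    unfolding B_def using sets.range_disjointed_sets[of Y G] YG by auto
  have "AE \<omega> in M. \<omega> \<notin> space M - (\<Union>n. Y n)"
  proof (subst prob_eq_0[symmetric])
    have "(\<Union>n. Y n) \<in> sets M" using sets_G_M[OF YG] by (intro sets.countable_UN) auto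
    then show "space M - (\<Union>n. Y n) \<in> sets M" by auto
    show "prob (space M - (\<Union>n. Y n)) = 0"
      by (rule gen_sets_exhaust[OF V fin, of Y]) (fact YG, fact Y(2))
  qed
  then have "AE \<omega> in M. \<omega> \<in> (\<Union>n. B n) \<longleftrightarrow> \<omega> \<in> space M"
    using AE_space by eventually_elim (auto simp: B_def UN_disjointed_eq)
  then have "chi (\<Union>n. B n) = chi (space M)"
    using BG by (intro chi_eqI) (auto intro: sets_G_M)
  then have "(\<lambda>n. chi (B n) z) sums z"
    using chi_disjoint_sums[of B z] sets_G_M[OF BG] disjoint_family_disjointed[of Y]
    by (simp add: B_def chi_space)
  then have lim: "(\<lambda>m. \<Sum>n<m. chi (B n) z) \<longlonglongrightarrow> z" by (simp add: sums_def)
  have "chi (B n) z \<in> ?C" for n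
  proof -
    have "B n \<subseteq> Y n" by (simp add: B_def disjointed_def)
    then have "chi (Y n) (chi (B n) z) = chi (B n) z"
      by (simp add: chi_chi sets_G_M YG BG Int_absorb1)
    then show ?thesis using part[of n] fmod_chi[OF V BG z] by auto
  qed
  then have "(\<Sum>n<m. chi (B n) z) \<in> ?C" for m by (intro csubspace_sum C)
  then show "z \<in> ?C" by (rule closed_sequentially[OF C(2) _ lim])
qed

end

context L2_space
begin

text \<open>Meaningful only for a map \<open>\<Phi>\<close> that respects equality almost everywhere.\<close>

definition lift_L2 :: "(('x \<Rightarrow> complex) \<Rightarrow> ('x \<Rightarrow> complex)) \<Rightarrow> 'h \<Rightarrow> 'h"
  where "lift_L2 \<Phi> x = q (\<Phi> (SOME f. f \<in> L2 \<and> q f = x))"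

lemma lift_L2_q:
  assumes "f \<in> L2"
    and "\<And>g. g \<in> L2 \<Longrightarrow> \<Phi> g \<in> L2"
    and "\<And>g h. g \<in> L2 \<Longrightarrow> h \<in> L2 \<Longrightarrow> AE \<omega> in M. g \<omega> = h \<omega> \<Longrightarrow>
      AE \<omega> in M. \<Phi> g \<omega> = \<Phi> h \<omega>"
  shows "lift_L2 \<Phi> (q f) = q (\<Phi> f)"
proof -
  define g where "g = (SOME g. g \<in> L2 \<and> q g = q f)"
  have g: "g \<in> L2" "q g = q f"
    unfolding g_def using someI[of "\<lambda>g. g \<in> L2 \<and> q g = q f"] assms(1) by auto
  then have "AE \<omega> in M. \<Phi> g \<omega> = \<Phi> f \<omega>" using q_eq_iff assms by auto
  then show ?thesis
    unfolding lift_L2_def g_def[symmetric] using q_eq_iff[OF assms(2)[OF g(1)] assms(2)[OF assms(1)]] by simp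
qed

subsection \<open>The modular conjugation\<close>

definition conj_op :: "'h \<Rightarrow> 'h"
  where "conj_op = lift_L2 (\<lambda>f \<omega>. cnj (f \<omega>))"

lemma conj_op_q: "f \<in> L2 \<Longrightarrow> conj_op (q f) = q (\<lambda>\<omega>. cnj (f \<omega>))"
  unfolding conj_op_def by (rule lift_L2_q) (auto simp: L2_cnj elim: eventually_mono)

lemma conj_op_add: "conj_op (x + y) = conj_op x + conj_op y"
proof -
  obtain f g where "f \<in> L2" "x = q f" "g \<in> L2" "y = q g" by (metis q_cases)
  then show ?thesis by (simp add: conj_op_q L2_cnj L2_add flip: q_add)
qed

lemma conj_op_scaleC: "conj_op (c *\<^sub>C x) = cnj c *\<^sub>C conj_op x"
proof -
  obtain f where "f \<in> L2" "x = q f" by (metis q_cases)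
  then show ?thesis by (simp add: conj_op_q L2_cnj L2_cmult flip: q_cmult)
qed

lemma conj_op_conj_op: "conj_op (conj_op x) = x"
proof -
  obtain f where "f \<in> L2" "x = q f" by (metis q_cases)
  then show ?thesis by (simp add: conj_op_q L2_cnj)
qed

lemma cinner_conj_op: "cinner (conj_op x) (conj_op y) = cinner y x"
proof -
  obtain f g where "f \<in> L2" "x = q f" "g \<in> L2" "y = q g" by (metis q_cases)
  then show ?thesis by (simp add: conj_op_q L2_cnj cinner_q mult.commute)
qed

lemma antiunitary_conj_op: "antiunitary_op conj_op"
  unfolding antiunitary_op_def
  by (auto simp: conj_op_add conj_op_scaleC cinner_conj_op intro!: surjI[of _ conj_op] conj_op_conj_op)

lemma antiunitary_norm: "antiunitary_op W \<Longrightarrow> norm (W (x::'h)) = norm x"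
  by (rule norm_eqI_cinner) (simp add: antiunitary_op_def)

text \<open>For uniqueness, compose an antiunitary candidate with complex conjugation: the result is
  linear and bounded and fixes the dense set of bounded functions, hence is the identity.\<close>

lemma modular_conj_eq:
  assumes A: "alg A = mult_op M q ` Linf"
  shows "modular_conj A (q (\<lambda>_. 1)) = conj_op"
  unfolding modular_conj_def
proof (rule the_equality)
  show "antiunitary_op conj_op \<and> (\<forall>a\<in>alg A. conj_op (a (q (\<lambda>_. 1))) = adj a (q (\<lambda>_. 1)))"
    by (auto simp: antiunitary_conj_op A mult_op_one adj_mult_op conj_op_q Linf_L2 Linf_cnj)
next
  fix W assume W: "antiunitary_op W \<and> (\<forall>a\<in>alg A. W (a (q (\<lambda>_. 1))) = adj a (q (\<lambda>_. 1)))"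
  have "(\<lambda>x. conj_op (W x)) = (\<lambda>x. x)"
  proof (rule bounded_ops_eqI)
    have "norm (conj_op (W x)) = norm x" for x
      using W by (simp add: antiunitary_norm antiunitary_conj_op)
    then have "(\<lambda>x. conj_op (W x)) \<in> bounded_ops"
      using W by (intro bounded_opsI[where K = 1])
        (simp_all add: antiunitary_op_def conj_op_add conj_op_scaleC)
    then show "bounded_linear (\<lambda>x. conj_op (W x))" by (simp add: bounded_ops_def)
    fix f assume f: "f \<in> Linf"
    then have "W (mult_op M q f (q (\<lambda>_. 1))) = adj (mult_op M q f) (q (\<lambda>_. 1))" using W by (simp add: A)
    then show "conj_op (W (q f)) = q f"
      using f by (simp add: mult_op_one adj_mult_op Linf_cnj conj_op_q L2_cnj Linf_L2)
  qed simp
  then show "W = conj_op" by (metis conj_op_conj_op ext)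
qed

text \<open>Commutativity makes the right action agree with multiplication, so right-F-submodules
  are the F-modules of the classical definition.\<close>

lemma jmap_mult_op:
  assumes A: "alg A = mult_op M q ` Linf" and f: "f \<in> Linf"
  shows "jmap A (q (\<lambda>_. 1)) (mult_op M q f) = mult_op M q f"
proof
  fix x
  obtain g where g: "g \<in> L2" "x = q g" by (rule q_cases)
  then show "jmap A (q (\<lambda>_. 1)) (mult_op M q f) x = mult_op M q f x"
    using f by (simp add: jmap_def modular_conj_eq[OF A] adj_mult_op conj_op_q mult_op_q L2_cnj Linf_cnj Linf_mult_L2)
qed

end

section \<open>The Koopman operator\<close>

locale L2_koopman = L2_space M q
  for M :: "'x measure" and q :: "('x \<Rightarrow> complex) \<Rightarrow> 'h::chilbert_space" +
  fixes T :: "'x \<Rightarrow> 'x"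
  assumes T_invertible: "invertible_measure_preserving M T"
begin

abbreviation Ti :: "'x \<Rightarrow> 'x" where "Ti \<equiv> the_inv_into (space M) T"

lemma T_bij: "bij_betw T (space M) (space M)"
  and T_measurable [measurable]: "T \<in> measurable M M"
  and Ti_measurable [measurable]: "Ti \<in> measurable M M"
  and T_emeasure: "Z \<in> sets M \<Longrightarrow> emeasure M (T -` Z \<inter> space M) = emeasure M Z"
  using T_invertible by (simp_all add: invertible_measure_preserving_def)

lemma T_space: "\<omega> \<in> space M \<Longrightarrow> T \<omega> \<in> space M"
  using T_measurable by (rule measurable_space)

lemma Ti_T: "\<omega> \<in> space M \<Longrightarrow> Ti (T \<omega>) = \<omega>"
  using T_bij by (intro the_inv_into_f_f) (auto simp: bij_betw_def)

lemma distr_T: "distr M M T = M"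
  by (rule measure_eqI) (simp_all add: emeasure_distr T_emeasure)

lemma distr_Ti: "distr M M Ti = M"
proof (rule measure_eqI)
  fix Z assume "Z \<in> sets (distr M M Ti)"
  then have Z: "Z \<in> sets M" by simp
  have "emeasure M (Ti -` Z \<inter> space M) = emeasure M (T -` (Ti -` Z \<inter> space M) \<inter> space M)"
    by (rule T_emeasure[symmetric]) (rule measurable_sets[OF Ti_measurable Z])
  also have "T -` (Ti -` Z \<inter> space M) \<inter> space M = Z"
    using sets.sets_into_space[OF Z] by (auto simp: Ti_T T_space)
  finally show "emeasure (distr M M Ti) Z = emeasure M Z" using Z by (simp add: emeasure_distr)
qed simp

text \<open>Stated for any measure-preserving map, because both \<open>T\<close> and its inverse are
  needed: the inverse yields surjectivity of the Koopman operator.\<close>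

context
  fixes S assumes S [measurable]: "S \<in> measurable M M" and distr_S: "distr M M S = M"
begin

lemma AE_comp: "AE \<omega> in M. P \<omega> \<Longrightarrow> AE \<omega> in M. P (S \<omega>)"
proof -
  assume "AE \<omega> in M. P \<omega>"
  then have "AE \<omega> in distr M M S. P \<omega>" unfolding distr_S .
  then show ?thesis by (rule AE_distrD[OF S])
qed

lemma L2_comp: "f \<in> L2 \<Longrightarrow> (\<lambda>\<omega>. f (S \<omega>)) \<in> L2"
  using integrable_distr[OF S, of "\<lambda>\<omega>. (cmod (f \<omega>))\<^sup>2"] measurable_compose[OF S, of f borel]
  by (simp add: L2_functions_def distr_S)

lemma Linf_comp: "f \<in> Linf \<Longrightarrow> (\<lambda>\<omega>. f (S \<omega>)) \<in> Linf"
  using AE_comp measurable_compose[OF S, of f borel] by (fastforce simp: Linf_functions_def)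

lemma integral_comp:
  fixes f :: "'x \<Rightarrow> complex"
  shows "f \<in> borel_measurable M \<Longrightarrow> (\<integral>\<omega>. f (S \<omega>) \<partial>M) = (\<integral>\<omega>. f \<omega> \<partial>M)"
  using integral_distr[OF S, of f] by (simp add: distr_S)

end

lemmas AE_T = AE_comp[OF T_measurable distr_T]
  and L2_T = L2_comp[OF T_measurable distr_T]
  and Linf_T = Linf_comp[OF T_measurable distr_T]

definition koopman :: "'h \<Rightarrow> 'h"
  where "koopman = lift_L2 (\<lambda>f \<omega>. f (T \<omega>))"

lemma koopman_q: "f \<in> L2 \<Longrightarrow> koopman (q f) = q (\<lambda>\<omega>. f (T \<omega>))"
  unfolding koopman_def by (rule lift_L2_q) (simp, erule L2_T, erule AE_T)

lemma koopman_cinner: "cinner (koopman x) (koopman y) = cinner x y"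
proof -
  obtain f g where fg: "f \<in> L2" "x = q f" "g \<in> L2" "y = q g" by (metis q_cases)
  have "(\<lambda>\<omega>. cnj (f \<omega>) * g \<omega>) \<in> borel_measurable M"
    using L2_measurable[OF fg(1)] L2_measurable[OF fg(3)] by measurable
  from integral_comp[OF T_measurable distr_T this] show ?thesis
    using fg by (simp add: koopman_q cinner_q L2_T)
qed

lemma koopman_surj: "surj koopman"
proof (rule surjI)
  fix x
  obtain f where f: "f \<in> L2" "x = q f" by (rule q_cases)
  note fTi = L2_comp[OF Ti_measurable distr_Ti f(1)]
  have "AE \<omega> in M. f (Ti (T \<omega>)) = f \<omega>" by (intro AE_I2) (simp add: Ti_T)
  moreover have "lift_L2 (\<lambda>f \<omega>. f (Ti \<omega>)) x = q (\<lambda>\<omega>. f (Ti \<omega>))"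
    unfolding f(2) using f(1)
    by (rule lift_L2_q) (erule L2_comp[OF Ti_measurable distr_Ti], erule AE_comp[OF Ti_measurable distr_Ti])
  ultimately show "koopman (lift_L2 (\<lambda>f \<omega>. f (Ti \<omega>)) x) = x"
    using koopman_q[OF fTi] q_eq_iff[OF L2_T[OF fTi] f(1)] f(2) by simp
qed

lemma koopman_unitary: "unitary_op koopman"
proof -
  have add: "koopman (x + y) = koopman x + koopman y" for x y
  proof -
    obtain f g where "f \<in> L2" "x = q f" "g \<in> L2" "y = q g" by (metis q_cases)
    then show ?thesis by (simp add: koopman_q L2_T L2_add flip: q_add)
  qed
  have scale: "koopman (c *\<^sub>C x) = c *\<^sub>C koopman x" for c x
  proof -
    obtain f where "f \<in> L2" "x = q f" by (metis q_cases)
    then show ?thesis by (simp add: koopman_q L2_T L2_cmult flip: q_cmult)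
  qed
  have "norm (koopman x) = norm x" for x
    by (rule norm_eqI_cinner) (rule koopman_cinner)
  then have "koopman \<in> bounded_ops" by (intro bounded_opsI[where K = 1] add scale) simp
  then show ?thesis by (simp add: unitary_op_def koopman_surj koopman_cinner)
qed

lemma koopman_mult_op:
  assumes f: "f \<in> Linf"
  shows "koopman (mult_op M q f x) = mult_op M q (\<lambda>\<omega>. f (T \<omega>)) (koopman x)"
proof -
  obtain g where "g \<in> L2" "x = q g" by (rule q_cases)
  then show ?thesis using f by (simp add: mult_op_q koopman_q L2_T Linf_T Linf_mult_L2)
qed

text \<open>The definition of \<open>aut\<close> composes a chosen symbol with \<open>T\<close>. Two
  symbols agree almost everywhere and \<open>T\<close> pulls null sets back to null sets, so the
  choice is immaterial.\<close>

lemma aut_classical_system: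
  assumes f: "f \<in> Linf"
  shows "aut (classical_system M T q) (mult_op M q f) = mult_op M q (\<lambda>\<omega>. f (T \<omega>))"
proof -
  let ?g = "mult_symbol M q (mult_op M q f)"
  have "AE \<omega> in M. ?g (T \<omega>) = f (T \<omega>)" using mult_symbol(2)[OF f] by (rule AE_T)
  then have "mult_op M q (\<lambda>\<omega>. ?g (T \<omega>)) = mult_op M q (\<lambda>\<omega>. f (T \<omega>))"
    using mult_symbol(1)[OF f] f by (intro mult_op_eqI Linf_T)
  then show ?thesis by (simp add: classical_system_def comp_def)
qed

lemma alg_classical_system: "alg (classical_system M T q) = mult_op M q ` Linf"
  by (simp add: classical_system_def)

lemma tr_classical_system:
  assumes f: "f \<in> Linf"
  shows "tr (classical_system M T q) (mult_op M q f) = (\<integral>\<omega>. f \<omega> \<partial>M)"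
  using mult_symbol[OF f] Linf_measurable f
  by (simp add: classical_system_def) (intro integral_cong_AE, auto)

lemma sys_unitary_classical_system:
  "sys_unitary (classical_system M T q) (q (\<lambda>_. 1)) = koopman"
  unfolding sys_unitary_def
proof (rule the_equality)
  show "unitary_op koopman \<and> (\<forall>a\<in>alg (classical_system M T q).
      koopman (a (q (\<lambda>_. 1))) = aut (classical_system M T q) a (q (\<lambda>_. 1)))"
    by (auto simp: koopman_unitary alg_classical_system aut_classical_system mult_op_one koopman_q
        Linf_T Linf_L2)
next
  fix W assume W: "unitary_op W \<and> (\<forall>a\<in>alg (classical_system M T q).
      W (a (q (\<lambda>_. 1))) = aut (classical_system M T q) a (q (\<lambda>_. 1)))"
  show "W = koopman"
  proof (rule bounded_ops_eqI)
    fix f assume f: "f \<in> Linf"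
    then have "W (mult_op M q f (q (\<lambda>_. 1))) = aut (classical_system M T q) (mult_op M q f) (q (\<lambda>_. 1))"
      using W by (simp add: alg_classical_system)
    then show "W (q f) = koopman (q f)"
      using f by (simp add: aut_classical_system mult_op_one koopman_q Linf_T Linf_L2)
  qed (use W koopman_unitary in \<open>auto simp: unitary_op_def bounded_ops_def\<close>)
qed

end

section \<open>Subsystems of the classical system\<close>

context L2_subalgebra
begin

lemma HF_eq: "closure ((\<lambda>a. a (q (\<lambda>_. 1))) ` N) = HF"
proof -
  have "(\<lambda>a. a (q (\<lambda>_. 1))) ` N = q ` FF"
  proof (intro equalityI subsetI)
    fix y assume "y \<in> (\<lambda>a. a (q (\<lambda>_. 1))) ` N"
    then obtain a where a: "a \<in> N" "y = a (q (\<lambda>_. 1))" by auto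
    from a(1) obtain f where "f \<in> FF" "a = mult_op M q f" by (rule N_cases)
    then show "y \<in> q ` FF" using a(2) by (simp add: mult_op_one FF_Linf)
  next
    fix y assume "y \<in> q ` FF"
    then obtain f where f: "f \<in> FF" "y = q f" by auto
    then have "y = mult_op M q f (q (\<lambda>_. 1))" by (simp add: mult_op_one FF_Linf)
    then show "y \<in> (\<lambda>a. a (q (\<lambda>_. 1))) ` N" using FF_mult_op[OF f(1)] by blast
  qed
  then show ?thesis by (simp add: HF_def)
qed

lemma fmod_iff: "fmod V \<longleftrightarrow> closed_csubspace V \<and> (\<forall>x\<in>V. \<forall>a\<in>N. a x \<in> V)"
proof -
  have "(\<forall>a\<in>N. a x \<in> V) \<longleftrightarrow> (\<forall>f\<in>FF. mult_op M q f x \<in> V)" for x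
    using N_cases FF_mult_op by metis
  then show ?thesis by (auto simp: fmod_def)
qed

text \<open>Matches the hull with the closure in the definition of finite rank. The finite
  combinations are closed under the module operations by algebra, and continuity of multiplication
  extends this to their closure.\<close>

lemma fspan_eq_closure:
  fixes n :: nat
  shows "fspan (x ` {..<n}) = closure {\<Sum>i<n. a i (x i) | a. \<forall>i<n. a i \<in> N}"
proof
  define S where "S = {\<Sum>i<n. mult_op M q (f i) (x i) | f. \<forall>i<n. f i \<in> FF}"
  have S: "{\<Sum>i<n. a i (x i) | a. \<forall>i<n. a i \<in> N} = S"
  proof (intro equalityI subsetI)
    fix y assume "y \<in> {\<Sum>i<n. a i (x i) | a. \<forall>i<n. a i \<in> N}"
    then obtain a where a: "y = (\<Sum>i<n. a i (x i))" "\<forall>i<n. a i \<in> N" by auto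
    have "\<forall>i. \<exists>f. i < n \<longrightarrow> f \<in> FF \<and> a i = mult_op M q f"
      using a(2) N_cases by metis
    from choice[OF this] obtain f where f: "\<forall>i. i < n \<longrightarrow> f i \<in> FF \<and> a i = mult_op M q (f i)" ..
    then have "y = (\<Sum>i<n. mult_op M q (f i) (x i))" unfolding a(1) by (intro sum.cong) auto
    then show "y \<in> S" unfolding S_def using f by auto
  next
    fix y assume "y \<in> S"
    then obtain f where f: "y = (\<Sum>i<n. mult_op M q (f i) (x i))" "\<forall>i<n. f i \<in> FF" by (auto simp: S_def)
    then show "y \<in> {\<Sum>i<n. a i (x i) | a. \<forall>i<n. a i \<in> N}"
      by (intro CollectI exI[of _ "\<lambda>i. mult_op M q (f i)"]) (simp add: FF_mult_op)
  qed
  have mult: "mult_op M q g y \<in> S" if g: "g \<in> FF" and y: "y \<in> S" for g y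
  proof -
    obtain f where f: "y = (\<Sum>i<n. mult_op M q (f i) (x i))" "\<forall>i<n. f i \<in> FF" using y by (auto simp: S_def)
    have "linear (mult_op M q g)"
      using mult_op_bounded_ops[OF FF_Linf[OF g]] by (simp add: bounded_ops_def bounded_linear.linear)
    then have "mult_op M q g y = (\<Sum>i<n. mult_op M q (\<lambda>\<omega>. g \<omega> * f i \<omega>) (x i))"
      using f g by (simp add: linear_sum mult_op_mult FF_Linf)
    then show ?thesis
      unfolding S_def using f(2) g by (intro CollectI exI[of _ "\<lambda>i \<omega>. g \<omega> * f i \<omega>"]) (simp add: FF_mult)
  qed
  have "csubspace S"
    unfolding csubspace_def
  proof (intro conjI ballI allI)
    have "mult_op M q (\<lambda>_. 0) y = 0" for y using mult_op_const[of 0 y] by simp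
    then show "0 \<in> S"
      unfolding S_def by (intro CollectI exI[of _ "\<lambda>i \<omega>. 0"]) (simp add: FF_const)
  next
    fix y z assume "y \<in> S" "z \<in> S"
    then obtain f g where f: "y = (\<Sum>i<n. mult_op M q (f i) (x i))" "\<forall>i<n. f i \<in> FF"
      and g: "z = (\<Sum>i<n. mult_op M q (g i) (x i))" "\<forall>i<n. g i \<in> FF" by (auto simp: S_def)
    then show "y + z \<in> S"
      unfolding S_def
      by (intro CollectI exI[of _ "\<lambda>i \<omega>. f i \<omega> + g i \<omega>"]) (simp add: FF_add mult_op_add FF_Linf sum.distrib)
  next
    fix c y assume "y \<in> S"
    then show "c *\<^sub>C y \<in> S" using mult[OF FF_const[of c]] by (simp add: mult_op_const)
  qed
  then have cl: "closed_csubspace (closure S)" by (rule closed_csubspace_closure)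
  have fm: "fmod (closure S)"
  proof (rule fmodI[OF cl])
    fix g y assume g: "g \<in> FF" and y: "y \<in> closure S"
    have "closed {z. mult_op M q g z \<in> closure S}"
      using closed_csubspace_preimage[OF cl mult_op_bounded_ops[OF FF_Linf[OF g]]]
      by (simp add: closed_csubspace_def)
    then have "closure S \<subseteq> {z. mult_op M q g z \<in> closure S}"
      using mult[OF g] closure_subset[of S] by (intro closure_minimal) auto
    then show "mult_op M q g y \<in> closure S" using y by auto
  qed
  \<comment> \<open>Constant coefficients 0 and 1 select a single generator.\<close>
  have "x i \<in> S" if "i < n" for i
  proof -
    have "mult_op M q (\<lambda>_. of_bool (j = i)) (x j) = (if j = i then x i else 0)" for j
      by (simp add: mult_op_const)
    then have "x i = (\<Sum>j<n. mult_op M q (\<lambda>_. of_bool (j = i)) (x j))" using that by simp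
    then show ?thesis unfolding S_def by (intro CollectI exI[of _ "\<lambda>j _. of_bool (j = i)"]) (simp add: FF_const)
  qed
  then have "fspan (x ` {..<n}) \<subseteq> closure S"
    using closure_subset[of S] by (intro fspan_minimal fm) auto
  then show "fspan (x ` {..<n}) \<subseteq> closure {\<Sum>i<n. a i (x i) | a. \<forall>i<n. a i \<in> N}" by (simp add: S)
  have "S \<subseteq> fspan (x ` {..<n})"
  proof
    fix y assume "y \<in> S"
    then obtain f where f: "y = (\<Sum>i<n. mult_op M q (f i) (x i))" "\<forall>i<n. f i \<in> FF" by (auto simp: S_def)
    show "y \<in> fspan (x ` {..<n})"
      unfolding f(1) using f(2) fspan_superset[of "x ` {..<n}"]
      by (intro csubspace_sum fmod_csubspace fmod_fspan fmod_mult) auto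
  qed
  then show "closure {\<Sum>i<n. a i (x i) | a. \<forall>i<n. a i \<in> N} \<subseteq> fspan (x ` {..<n})"
    unfolding S by (intro closure_minimal fmod_closed fmod_fspan)
qed

end

section \<open>Specialization to the classical system and comparison of the two spectra\<close>

theorem proposition3p9:
  fixes M :: "'x measure"
    and T :: "'x \<Rightarrow> 'x"
    and q :: "('x \<Rightarrow> complex) \<Rightarrow> 'h::chilbert_space"
    and A F :: "'h vn_system"
    and \<Omega> :: 'h
    and mubar :: "('h \<Rightarrow> 'h) \<Rightarrow> ennreal"
  assumes "standard_prob_space M"
    and "invertible_measure_preserving M T"
    and "is_L2 M q"
    and "A = classical_system M T q"
    and "\<Omega> = q (\<lambda>\<omega>. 1)"
    and "subsystem F A"
    and "canonical_weight A F \<Omega> mubar"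
  shows "rel_discrete_spectrum A F \<Omega> mubar \<longleftrightarrow> classical_rel_discrete_spectrum A F \<Omega>"
proof -
  note \<Omega> = assms(5)
  interpret K: L2_koopman M q T
    using assms(1-3) by (auto simp: L2_koopman_def L2_koopman_axioms_def L2_space_def
        L2_space_axioms_def standard_prob_space_def)
  have algA: "alg A = mult_op M q ` Linf_functions M"
    using assms(4) by (simp add: K.alg_classical_system)
  have F: "von_neumann_algebra (alg F)" "alg F \<subseteq> alg A" "id \<in> alg F"
    "bij_betw (aut F) (alg F) (alg F)" "\<And>a. a \<in> alg F \<Longrightarrow> aut F a = aut A a"
    using assms(6) by (auto simp: subsystem_def is_system_def star_automorphism_def)
  interpret B: L2_subalgebra M q "alg F"
    using F algA by unfold_locales auto
  have HF: "sub_space F \<Omega> = B.HF" unfolding sub_space_def \<Omega> by (rule B.HF_eq)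
  have BC: "basic_construction A F \<Omega> = B.BC"
    by (simp add: basic_construction_def sub_proj_def HF algA)
  have U: "sys_unitary A \<Omega> = K.koopman"
    unfolding assms(4) \<Omega> by (rule K.sys_unitary_classical_system)
  have autF: "aut F (mult_op M q f) = mult_op M q (\<lambda>\<omega>. f (T \<omega>))" if "f \<in> B.FF" for f
    using F(5)[OF B.FF_mult_op[OF that]] K.aut_classical_system[OF B.FF_Linf[OF that]] assms(4) by simp
  have FF_T: "(\<lambda>\<omega>. f (T \<omega>)) \<in> B.FF" if "f \<in> B.FF" for f
    using autF[OF that] bij_betwE[OF F(4)] B.FF_mult_op[OF that] K.Linf_T[OF B.FF_Linf[OF that]]
    by (auto simp: B.FF_def)
  \<comment> \<open>Uses that the automorphism maps F onto F. Mere invariance of F would only place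
    the Koopman image of \<open>HF\<close> inside \<open>HF\<close>.\<close>
  have FF_T': "\<exists>g\<in>B.FF. mult_op M q (\<lambda>\<omega>. g (T \<omega>)) = mult_op M q f" if f: "f \<in> B.FF" for f
  proof -
    obtain a where a: "a \<in> alg F" "aut F a = mult_op M q f"
      using F(4) B.FF_mult_op[OF f] by (metis bij_betw_imp_surj_on imageE)
    from a(1) obtain g where "g \<in> B.FF" "a = mult_op M q g" by (rule B.N_cases)
    then show ?thesis using a(2) autF by auto
  qed
  define \<tau> where "\<tau> Y = T -` Y \<inter> space M" for Y
  have \<tau>_sets: "\<tau> Y \<in> sets M" if "Y \<in> sets M" for Y
    unfolding \<tau>_def using that by measurable
  have \<tau>_AE: "AE \<omega> in M. indicator Y (T \<omega>) = (indicator (\<tau> Y) \<omega> :: complex)" for Y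
    by (rule AE_I2) (auto simp: \<tau>_def indicator_def)
  note weight = assms(7)[unfolded canonical_weight_def BC fns_tracial_weight_def]
  interpret D: L2_dynamics M q "alg F" mubar K.koopman \<tau>
  proof unfold_locales
    show "mubar (\<lambda>x. a x + b x) = mubar a + mubar b"
      if "a \<in> positive_part B.BC" "b \<in> positive_part B.BC" for a b
      using weight that by simp
    show "mubar (adj a \<circ> a) = mubar (a \<circ> adj a)" if "a \<in> B.BC" for a
      using weight that by simp
    show "mubar (\<lambda>x. K.chi Z (orth_proj B.HF x)) = ennreal (K.prob Z)" if Z: "Z \<in> sets B.G" for Z
    proof -
      let ?S = "\<lambda>x. K.chi Z (orth_proj B.HF x)"
      have ZM: "Z \<in> sets M" by (rule B.sets_G_M[OF Z])
      have chi: "K.chi Z \<in> alg A" using ZM by (simp add: algA K.chi_def)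
      have id: "id \<in> alg A" using F by auto
      have pos: "positive_op ?S"
        using positive_orth_proj[OF B.fmod_closed_csubspace[OF B.fmod_eq_chi[OF B.fmod_HF Z]]]
        by (simp add: B.orth_proj_chi_HF[OF Z])
      \<comment> \<open>The canonical formula with a single summand, \<open>K.chi Z\<close> on the
        left and \<open>id\<close> on the right; the trace of their product is the integral of the
        indicator.\<close>
      have "?S = (\<lambda>x. \<Sum>i<1::nat. K.chi Z (sub_proj F \<Omega> (id x)))"
        by (simp add: sub_proj_def HF)
      then have w: "mubar ?S < \<infinity> \<and>
          complex_of_real (enn2real (mubar ?S)) = (\<Sum>i<1::nat. tr A (K.chi Z \<circ> id))"
        using weight[THEN conjunct2, THEN spec[of _ 1], THEN spec[of _ "\<lambda>_. K.chi Z"],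
            THEN spec[of _ "\<lambda>_. id"], THEN spec[of _ ?S]] chi id pos by simp
      have "(\<integral>\<omega>. indicator Z \<omega> \<partial>M) = complex_of_real (K.prob Z)"
      proof -
        have "(\<lambda>\<omega>. complex_of_real (indicator Z \<omega>)) = indicator Z" by (auto simp: indicator_def)
        then show ?thesis using ZM integral_complex_of_real[of M "indicator Z"] by simp
      qed
      then have "enn2real (mubar ?S) = K.prob Z"
        using w K.tr_classical_system[of "indicator Z"] ZM
        by (simp add: K.chi_def assms(4))
      then show ?thesis using w by (metis ennreal_enn2real infinity_ennreal_def)
    qed
    show "unitary_op K.koopman" by (rule K.koopman_unitary)
    show "\<exists>g\<in>B.FF. \<forall>x. K.koopman (mult_op M q f x) = mult_op M q g (K.koopman x)" if "f \<in> B.FF" for f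
      using FF_T[OF that] K.koopman_mult_op[OF B.FF_Linf[OF that]] by blast
    show "\<exists>g\<in>B.FF. \<forall>x. K.koopman (mult_op M q g x) = mult_op M q f (K.koopman x)" if f: "f \<in> B.FF" for f
    proof -
      obtain g where "g \<in> B.FF" "mult_op M q (\<lambda>\<omega>. g (T \<omega>)) = mult_op M q f" using FF_T'[OF f] by auto
      then show ?thesis using K.koopman_mult_op[OF B.FF_Linf] by (intro bexI[of _ g]) auto
    qed
    show "\<tau> Y \<in> sets B.G" if Y: "Y \<in> sets B.G" for Y
      unfolding B.sets_G
    proof
      show M: "\<tau> Y \<in> sets M" by (rule \<tau>_sets[OF B.sets_G_M[OF Y]])
      show "indicator (\<tau> Y) \<in> B.FF"
        by (rule B.FF_cong_AE[OF FF_T[OF B.chi_FF[OF Y]] K.Linf_indicator[OF M] \<tau>_AE])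
    qed
    show "K.prob (\<tau> Y) = K.prob Y" if "Y \<in> sets B.G" for Y
      using K.T_emeasure[OF B.sets_G_M[OF that]] by (simp add: \<tau>_def measure_def)
    show "K.koopman (K.chi Y x) = K.chi (\<tau> Y) (K.koopman x)" if Y: "Y \<in> sets B.G" for Y x
    proof -
      note Y' = K.Linf_indicator[OF B.sets_G_M[OF Y]]
      have "mult_op M q (\<lambda>\<omega>. indicator Y (T \<omega>)) = mult_op M q (indicator (\<tau> Y))"
        by (rule K.mult_op_eqI[OF K.Linf_T[OF Y'] K.Linf_indicator[OF \<tau>_sets[OF B.sets_G_M[OF Y]]] \<tau>_AE])
      then show ?thesis unfolding K.chi_def K.koopman_mult_op[OF Y'] by simp
    qed
    have kb: "K.koopman \<in> bounded_ops" using K.koopman_unitary by (simp add: unitary_op_def)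
    have knorm: "norm (K.koopman x - K.koopman y) = norm (x - y)" for x y
    proof -
      have "K.koopman x - K.koopman y = K.koopman (x - y)"
        using kb by (simp add: bounded_ops_def linear_simps)
      then show ?thesis using norm_eqI_cinner[OF K.koopman_cinner] by simp
    qed
    show "K.koopman ` B.HF = B.HF"
    proof
      have "closed {x. K.koopman x \<in> B.HF}"
        using closed_csubspace_preimage[OF B.closed_csubspace_HF kb] by (simp add: closed_csubspace_def)
      moreover have "q ` B.FF \<subseteq> {x. K.koopman x \<in> B.HF}"
        by (auto simp: K.koopman_q B.FF_L2 intro!: B.FF_HF FF_T)
      ultimately have "closure (q ` B.FF) \<subseteq> {x. K.koopman x \<in> B.HF}" by (intro closure_minimal)
      then have "B.HF \<subseteq> {x. K.koopman x \<in> B.HF}" by (simp only: B.HF_def[symmetric])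
      then show "K.koopman ` B.HF \<subseteq> B.HF" by auto
      show "B.HF \<subseteq> K.koopman ` B.HF"
      proof
        fix x assume "x \<in> B.HF"
        then obtain f where f: "\<And>n. f n \<in> B.FF" "(\<lambda>n. q (f n)) \<longlonglongrightarrow> x" by (rule B.HF_cases) (rule that)
        \<comment> \<open>The approximants of \<open>x\<close> have preimages in F, and these
          converge to the preimage of \<open>x\<close> because the Koopman operator is
          isometric.\<close>
        have "\<forall>n. \<exists>g. g \<in> B.FF \<and> K.koopman (q g) = q (f n)"
        proof
          fix n
          obtain g where g: "g \<in> B.FF" "mult_op M q (\<lambda>\<omega>. g (T \<omega>)) = mult_op M q (f n)"
            using FF_T'[OF f(1)] by auto
          have "K.koopman (q g) = q (\<lambda>\<omega>. g (T \<omega>))" by (rule K.koopman_q[OF B.FF_L2[OF g(1)]])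
          also have "\<dots> = q (f n)"
            using g(2) K.mult_op_one[OF K.Linf_T[OF B.FF_Linf[OF g(1)]]] K.mult_op_one[OF B.FF_Linf[OF f(1)]]
            by metis
          finally show "\<exists>g. g \<in> B.FF \<and> K.koopman (q g) = q (f n)" using g(1) by auto
        qed
        from choice[OF this] obtain g where g: "\<forall>n. g n \<in> B.FF \<and> K.koopman (q (g n)) = q (f n)" ..
        obtain y where y: "x = K.koopman y" using K.koopman_surj by (metis surjD)
        have "norm (q (g n) - y) = norm (q (f n) - x)" for n
          using knorm[of "q (g n)" y] g y by simp
        then have "(\<lambda>n. norm (q (g n) - y)) \<longlonglongrightarrow> 0"
          using f(2) by (simp add: tendsto_norm_zero_iff LIM_zero)
        then have "(\<lambda>n. q (g n)) \<longlonglongrightarrow> y" by (simp add: tendsto_norm_zero_iff LIM_zero_iff)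
        then have "y \<in> B.HF" by (rule B.HF_limit[rotated]) (use g B.FF_HF in auto)
        then show "x \<in> K.koopman ` B.HF" using y by auto
      qed
    qed
  qed
  have right: "right_submodule A F \<Omega> V \<longleftrightarrow> B.fmod V" for V
  proof -
    have "jmap A \<Omega> a = a" if "a \<in> alg F" for a
      using that F(2) K.jmap_mult_op[OF algA] unfolding \<Omega> algA by auto
    then show ?thesis by (simp add: right_submodule_def B.fmod_iff)
  qed
  have finrank: "finite_rank_module F V \<longleftrightarrow>
      B.fmod V \<and> (\<exists>(n::nat) x. (\<forall>i<n. x i \<in> V) \<and> V = B.fspan (x ` {..<n}))" for V
    by (simp add: finite_rank_module_def B.fmod_iff B.fspan_eq_closure conj_assoc)
  define \<V> where "\<V> = {V. U_weight_module A F \<Omega> mubar V}"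
  define E where "E = {x \<in> orth_compl B.HF. F_eigenvector A F \<Omega> x}"
  have \<V>: "V \<in> \<V> \<longleftrightarrow> B.fmod V \<and> K.koopman ` V = V \<and> V \<subseteq> orth_compl B.HF \<and> mubar (orth_proj V) < \<infinity>" for V
    by (simp add: \<V>_def U_weight_module_def right U HF)
  \<comment> \<open>The comparison is asymmetric: a vector of a weight module is only approximated
    by sums of eigenvectors, whereas each eigenvector orthogonal to \<open>HF\<close> lies in a
    single weight module. This is enough for equal closed spans.\<close>
  have "\<Union>\<V> \<subseteq> closed_cspan E"
  proof
    fix z assume "z \<in> \<Union>\<V>"
    then obtain V where V: "z \<in> V" "B.fmod V" "K.koopman ` V = V" "V \<subseteq> orth_compl B.HF"
      "mubar (orth_proj V) < \<infinity>" by (auto simp: \<V>)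
    have "D.finite_rank_parts V \<subseteq> E"
      using V(4) by (auto simp: D.finite_rank_parts_def E_def F_eigenvector_def finrank U)
    then have "closed_cspan (D.finite_rank_parts V) \<subseteq> closed_cspan E"
      by (meson closed_cspan_minimal closed_cspan_superset closed_csubspace_closed_cspan order_trans)
    then show "z \<in> closed_cspan E"
      using D.weight_module_imp_finite_rank[OF V(2,3,5)] V(1) by blast
  qed
  moreover have "E \<subseteq> \<Union>\<V>"
  proof
    fix x assume x: "x \<in> E"
    then obtain W where "finite_rank_module F W" "K.koopman ` W = W" "x \<in> W"
      by (auto simp: E_def F_eigenvector_def U)
    then obtain n :: nat and y where W: "W = B.fspan (y ` {..<n})" "K.koopman ` W = W" "x \<in> W"
      by (auto simp: finrank)
    obtain V where "B.fmod V" "K.koopman ` V = V" "V \<subseteq> orth_compl B.HF"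
      "mubar (orth_proj V) < \<infinity>" "x \<in> V"
      by (rule D.finite_rank_imp_weight_module[of "y ` {..<n}" x]) (use W x in \<open>auto simp: E_def\<close>)
    then show "x \<in> \<Union>\<V>" using \<V> by blast
  qed
  ultimately have "closed_cspan (\<Union>\<V>) = closed_cspan E"
    by (meson closed_cspan_minimal closed_cspan_superset closed_csubspace_closed_cspan order_trans subset_antisym)
  then show ?thesis
    by (simp add: rel_discrete_spectrum_def discrete_part_def classical_rel_discrete_spectrum_def
        \<V>_def[symmetric] E_def HF)
qed

end
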